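(* Let $(X,\mathsf d,\mathfrak m)$ be an infinitesimally strictly convex metric measure space, $\Omega\subset X$ open, and $\varphi,\psi\in W^{1,2}_0(\Omega)\cap D(\mathbf\Delta,\Omega)$ with $\varphi\le\psi$ $\mathfrak m$-a.e. Let $E(u)=\frac12\int_X|Du|^2\,d\mathfrak m$. Then every minimizer $\bar u$ of $E$ over $[\varphi,\psi]=\{u\in W^{1,2}_0(\Omega):\varphi\le u\le\psi\ \mathfrak m\text{-a.e.}\}$ satisfies $\bar u\in D(\mathbf\Delta,\Omega)$ and $$\mathbf\Delta\varphi|_\Omega\wedge 0\ \prec\ \mathbf\Delta\bar u|_\Omega\ \prec\ \mathbf\Delta\psi|_\Omega\vee 0 .$$
   Context: A metric measure space $(X,\mathsf d,\mathfrak m)$ is a complete separable metric space with a non-negative Radon measure $\mathfrak m$ giving positive mass to every nonempty open set. Sobolev space: a test plan is a Borel probability measure $\pi$ on $C([0,1],X)$, concentrated on absolutely continuous curves, with $(e_t)_\#\pi\le C\mathfrak m$ for all $t$ and some $C$ (where $e_t(\gamma)=\gamma_t$), and $\iint_0^1|\dot\gamma_t|^2\,dt\,d\pi(\gamma)<\infty$. $f\in W^{1,2}(X,\mathsf d,\mathfrak m)$ if $f\in L^2(\mathfrak m)$ and there is $G\in L^2(\mathfrak m)$, $G\ge0$, with $\int|f(\gamma_1)-f(\gamma_0)|\,d\pi\le\iint_0^1G(\gamma_t)|\dot\gamma_t|\,dt\,d\pi$ for all test plans $\pi$; the $\mathfrak m$-a.e. minimal such $G$ is the minimal weak upper gradient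 $|Df|$. $W^{1,2}$ is a Banach space with norm $\|f\|_{W^{1,2}}^2=\|f\|_{L^2}^2+\||Df|\|_{L^2}^2$. Locality: $|Df|=|Dg|$ $\mathfrak m$-a.e. on $\{f=g\}$. $(X,\mathsf d,\mathfrak m)$ is infinitesimally strictly convex if $E:W^{1,2}(X,\mathsf d,\mathfrak m)\to\mathbb R$ is differentiable; equivalently, for all $f,g\in W^{1,2}$ the limit $\lim_{\varepsilon\to0}\frac{|D(g+\varepsilon f)|^2-|Dg|^2}{2\varepsilon}$ exists in $L^1(X,\mathfrak m)$. For $\Omega\subset X$ open, $W^{1,2}_0(\Omega)$ is the closed subspace of $W^{1,2}(X,\mathsf d,\mathfrak m)$ of functions vanishing $\mathfrak m$-a.e. outside $\Omega$, ordered by the $\mathfrak m$-a.e. order. $W^{-1,2}(\Omega)$ is its topological dual and $W^{-1,2}_\prec(\Omega)=P^*-P^*$, where $P^*$ is the set of $L\in W^{-1,2}(\Omega)$ with $L(v)\ge0$ for all $0\le v\in W^{1,2}_0(\Omega)$. For $L,M\in W^{-1,2}_\prec(\Omega)$, $L\prec M$ means $M-L\in P^*$, and lattice operations are given, for $0\le v\in W^{1,2}_0(\Omega)$, by $(L\vee M)(v)=\sup_{0\le z\le v}\{L(z)+M(v-z)\}$ and $(L\wedge M)(v)=\inf_{0\le z\le v}\{L(z)+M(v-z)\}$. Laplacian: for $f\in W^{1,2}(X,\mathsf d,\mathfrak m)$ let $E_{f,\Omega}:W^{1,2}_0(\Omega)\to\mathbb R$, $E_{f,\Omega}(g)=\frac12\int_\Omega|D(f+g)|^2\,d\mathfrak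 m$; it is convex, continuous and (under infinitesimal strict convexity) differentiable. One writes $f\in D(\mathbf\Delta,\Omega)$ if the unique element of $\partial E_{f,\Omega}(0)\subset W^{-1,2}(\Omega)$ belongs to $W^{-1,2}_\prec(\Omega)$, and then $\mathbf\Delta f|_\Omega$ denotes minus this element. (Elements of $W^{-1,2}_\prec(\Omega)$ are identified with the measures representing them on compactly supported Lipschitz functions.) *)

theory Defs
  imports "HOL-Probability.Probability"
begin

text \<open>
  The metric space is a type of class \<^class>\<open>polish_space\<close> (complete, separable metric space) and
  the reference measure is a Borel measure \<^term>\<open>m\<close> on it.  Elements of function spaces are
  represented by Borel functions \<^typ>\<open>'a \<Rightarrow> real\<close>, not by a.e. classes.
\<close>

definition radon_measure :: "'a::polish_space measure \<Rightarrow> bool" where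
  "radon_measure m \<longleftrightarrow> sets m = sets borel \<and>
     (\<forall>x. \<exists>U. open U \<and> x \<in> U \<and> emeasure m U < \<infinity>) \<and>
     (\<forall>A\<in>sets borel. emeasure m A = (SUP K\<in>{K. K \<subseteq> A \<and> compact K}. emeasure m K))"

definition metric_measure_space :: "'a::polish_space measure \<Rightarrow> bool" where
  "metric_measure_space m \<longleftrightarrow> radon_measure m \<and>
     (\<forall>U. open U \<and> U \<noteq> {} \<longrightarrow> emeasure m U > 0)"

subsection \<open>Curves and test plans\<close>

text \<open>\<open>C([0,1],X)\<close> with the sup distance; its elements are \<^const>\<open>undefined\<close> outside \<open>[0,1]\<close>.\<close>

definition curve_metric :: "(real \<Rightarrow> 'a::polish_space) metric" where
  "curve_metric = cfunspace (top_of_set {0..1::real}) euclidean_metric"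

definition curve_borel :: "(real \<Rightarrow> 'a::polish_space) measure" where
  "curve_borel = sigma (mspace curve_metric) {U. openin (mtopology_of curve_metric) U}"

definition abs_cont_curve :: "(real \<Rightarrow> 'a::metric_space) \<Rightarrow> bool" where
  "abs_cont_curve \<gamma> \<longleftrightarrow> (\<exists>g::real \<Rightarrow> real. set_integrable lborel {0..1} g \<and>
     (\<forall>s t. 0 \<le> s \<longrightarrow> s \<le> t \<longrightarrow> t \<le> 1 \<longrightarrow> dist (\<gamma> s) (\<gamma> t) \<le> (LINT r:{s..t}|lborel. g r)))"

text \<open>
  The metric speed is the limit of the difference quotients, which for an absolutely continuous
  curve exists at a.e. time.  The upper limit gives it a value at the remaining times as well.
\<close>

definition metric_speed :: "(real \<Rightarrow> 'a::metric_space) \<Rightarrow> real \<Rightarrow> ennreal" where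
  "metric_speed \<gamma> t =
     Limsup (at t within {0..1}) (\<lambda>s. ennreal (dist (\<gamma> s) (\<gamma> t) / \<bar>s - t\<bar>))"

definition test_plan :: "'a::polish_space measure \<Rightarrow> (real \<Rightarrow> 'a) measure \<Rightarrow> bool" where
  "test_plan m \<pi> \<longleftrightarrow> prob_space \<pi> \<and> sets \<pi> = sets curve_borel \<and>
     (AE \<gamma> in \<pi>. abs_cont_curve \<gamma>) \<and>
     (\<exists>C::real. \<forall>t\<in>{0..1}. \<forall>A\<in>sets borel.
        emeasure (distr \<pi> borel (\<lambda>\<gamma>. \<gamma> t)) A \<le> ennreal C * emeasure m A) \<and>
     (\<integral>\<^sup>+\<gamma>. (\<integral>\<^sup>+t\<in>{0..1}. (metric_speed \<gamma> t)\<^sup>2 \<partial>lborel) \<partial>\<pi>) < \<infinity>"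

subsection \<open>Sobolev functions\<close>

definition L2_fun :: "'a measure \<Rightarrow> ('a \<Rightarrow> real) set" where
  "L2_fun m = {f \<in> borel_measurable m. integrable m (\<lambda>x. (f x)\<^sup>2)}"

definition weak_upper_gradient ::
    "'a::polish_space measure \<Rightarrow> ('a \<Rightarrow> real) \<Rightarrow> ('a \<Rightarrow> real) \<Rightarrow> bool" where
  "weak_upper_gradient m f G \<longleftrightarrow> G \<in> L2_fun m \<and> (AE x in m. 0 \<le> G x) \<and>
     (\<forall>\<pi>. test_plan m \<pi> \<longrightarrow>
        (\<integral>\<^sup>+\<gamma>. ennreal \<bar>f (\<gamma> 1) - f (\<gamma> 0)\<bar> \<partial>\<pi>)
          \<le> (\<integral>\<^sup>+\<gamma>. (\<integral>\<^sup>+t\<in>{0..1}. ennreal (G (\<gamma> t)) * metric_speed \<gamma> t \<partial>lborel) \<partial>\<pi>))"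

definition sobolev :: "'a::polish_space measure \<Rightarrow> ('a \<Rightarrow> real) set" where
  "sobolev m = {f \<in> L2_fun m. \<exists>G. weak_upper_gradient m f G}"

text \<open>A representative of \<open>|Df|\<close>, which is determined only up to a.e. equality.\<close>

definition min_wug :: "'a::polish_space measure \<Rightarrow> ('a \<Rightarrow> real) \<Rightarrow> 'a \<Rightarrow> real" where
  "min_wug m f = (SOME G. weak_upper_gradient m f G \<and>
     (\<forall>H. weak_upper_gradient m f H \<longrightarrow> (AE x in m. G x \<le> H x)))"

definition sobolev_norm :: "'a::polish_space measure \<Rightarrow> ('a \<Rightarrow> real) \<Rightarrow> real" where
  "sobolev_norm m f = sqrt ((LINT x|m. (f x)\<^sup>2) + (LINT x|m. (min_wug m f x)\<^sup>2))"

definition sobolev0 :: "'a::polish_space measure \<Rightarrow> 'a set \<Rightarrow> ('a \<Rightarrow> real) set" where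
  "sobolev0 m \<Omega> = {f \<in> sobolev m. AE x in m. x \<notin> \<Omega> \<longrightarrow> f x = 0}"

definition energy :: "'a::polish_space measure \<Rightarrow> ('a \<Rightarrow> real) \<Rightarrow> real" where
  "energy m u = (1/2) * (LINT x|m. (min_wug m u x)\<^sup>2)"

subsection \<open>The dual space and its order\<close>

text \<open>
  A functional on \<open>W\<^sub>0\<close> is set to \<open>0\<close> outside it, so that equality in the dual is equality of
  HOL functions.  The norm bound makes it independent of the choice of representatives.
\<close>

definition sobolev0_dual ::
    "'a::polish_space measure \<Rightarrow> 'a set \<Rightarrow> (('a \<Rightarrow> real) \<Rightarrow> real) set" where
  "sobolev0_dual m \<Omega> = {L.
     (\<forall>f\<in>sobolev0 m \<Omega>. \<forall>g\<in>sobolev0 m \<Omega>. L (\<lambda>x. f x + g x) = L f + L g) \<and>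
     (\<forall>c. \<forall>f\<in>sobolev0 m \<Omega>. L (\<lambda>x. c * f x) = c * L f) \<and>
     (\<exists>C. \<forall>f\<in>sobolev0 m \<Omega>. \<bar>L f\<bar> \<le> C * sobolev_norm m f) \<and>
     (\<forall>f. f \<notin> sobolev0 m \<Omega> \<longrightarrow> L f = 0)}"

definition dual_pos_cone ::
    "'a::polish_space measure \<Rightarrow> 'a set \<Rightarrow> (('a \<Rightarrow> real) \<Rightarrow> real) set" where
  "dual_pos_cone m \<Omega> = {L \<in> sobolev0_dual m \<Omega>.
     \<forall>v\<in>sobolev0 m \<Omega>. (AE x in m. 0 \<le> v x) \<longrightarrow> 0 \<le> L v}"

definition order_dual ::
    "'a::polish_space measure \<Rightarrow> 'a set \<Rightarrow> (('a \<Rightarrow> real) \<Rightarrow> real) set" where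
  "order_dual m \<Omega> = {(\<lambda>v. P v - Q v) | P Q. P \<in> dual_pos_cone m \<Omega> \<and> Q \<in> dual_pos_cone m \<Omega>}"

definition dual_prec ::
    "'a::polish_space measure \<Rightarrow> 'a set \<Rightarrow>
      (('a \<Rightarrow> real) \<Rightarrow> real) \<Rightarrow> (('a \<Rightarrow> real) \<Rightarrow> real) \<Rightarrow> bool" where
  "dual_prec m \<Omega> L M \<longleftrightarrow> (\<lambda>v. M v - L v) \<in> dual_pos_cone m \<Omega>"

definition order_segment ::
    "'a::polish_space measure \<Rightarrow> 'a set \<Rightarrow> ('a \<Rightarrow> real) \<Rightarrow> ('a \<Rightarrow> real) \<Rightarrow> ('a \<Rightarrow> real) set" where
  "order_segment m \<Omega> f g = {u \<in> sobolev0 m \<Omega>. AE x in m. f x \<le> u x \<and> u x \<le> g x}"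

text \<open>Linear extension, via positive and negative parts, of an additive map on the cone \<open>v \<ge> 0\<close>.\<close>

definition cone_extension ::
    "'a::polish_space measure \<Rightarrow> 'a set \<Rightarrow>
      (('a \<Rightarrow> real) \<Rightarrow> real) \<Rightarrow> ('a \<Rightarrow> real) \<Rightarrow> real" where
  "cone_extension m \<Omega> S v =
     (if v \<in> sobolev0 m \<Omega> then S (\<lambda>x. max (v x) 0) - S (\<lambda>x. max (- v x) 0) else 0)"

definition dual_sup ::
    "'a::polish_space measure \<Rightarrow> 'a set \<Rightarrow>
      (('a \<Rightarrow> real) \<Rightarrow> real) \<Rightarrow> (('a \<Rightarrow> real) \<Rightarrow> real) \<Rightarrow> ('a \<Rightarrow> real) \<Rightarrow> real" where
  "dual_sup m \<Omega> L M = cone_extension m \<Omega>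
     (\<lambda>v. SUP z\<in>order_segment m \<Omega> (\<lambda>_. 0) v. L z + M (\<lambda>x. v x - z x))"

definition dual_inf ::
    "'a::polish_space measure \<Rightarrow> 'a set \<Rightarrow>
      (('a \<Rightarrow> real) \<Rightarrow> real) \<Rightarrow> (('a \<Rightarrow> real) \<Rightarrow> real) \<Rightarrow> ('a \<Rightarrow> real) \<Rightarrow> real" where
  "dual_inf m \<Omega> L M = cone_extension m \<Omega>
     (\<lambda>v. INF z\<in>order_segment m \<Omega> (\<lambda>_. 0) v. L z + M (\<lambda>x. v x - z x))"

subsection \<open>Infinitesimal strict convexity and the Laplacian\<close>

text \<open>
  Differentiability of \<open>E\<close> is meant in the sense of Gateaux; this is what corresponds to the
  existence of the limits of \<open>(|D(g + \<epsilon> f)|\<^sup>2 - |Dg|\<^sup>2) / (2 \<epsilon>)\<close> in \<open>L\<^sup>1\<close> for all \<open>f\<close> and \<open>g\<close>.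
  Since \<open>W\<^sub>0(X) = W(X)\<close>, the dual of the whole Sobolev space is \<open>sobolev0_dual m UNIV\<close>.
\<close>

definition infinitesimally_strictly_convex :: "'a::polish_space measure \<Rightarrow> bool" where
  "infinitesimally_strictly_convex m \<longleftrightarrow>
     (\<forall>g\<in>sobolev m. \<exists>L\<in>sobolev0_dual m UNIV. \<forall>f\<in>sobolev m.
        ((\<lambda>\<epsilon>. (energy m (\<lambda>x. g x + \<epsilon> * f x) - energy m g) / \<epsilon>) \<longlongrightarrow> L f) (at 0))"

definition local_energy ::
    "'a::polish_space measure \<Rightarrow> 'a set \<Rightarrow> ('a \<Rightarrow> real) \<Rightarrow> ('a \<Rightarrow> real) \<Rightarrow> real" where
  "local_energy m \<Omega> f g = (1/2) * (LINT x:\<Omega>|m. (min_wug m (\<lambda>y. f y + g y) x)\<^sup>2)"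

definition subdifferential ::
    "'a::polish_space measure \<Rightarrow> 'a set \<Rightarrow> (('a \<Rightarrow> real) \<Rightarrow> real) \<Rightarrow> ('a \<Rightarrow> real) \<Rightarrow>
      (('a \<Rightarrow> real) \<Rightarrow> real) set" where
  "subdifferential m \<Omega> F u = {L \<in> sobolev0_dual m \<Omega>.
     \<forall>v\<in>sobolev0 m \<Omega>. F u + L v \<le> F (\<lambda>x. u x + v x)}"

definition laplacian_domain :: "'a::polish_space measure \<Rightarrow> 'a set \<Rightarrow> ('a \<Rightarrow> real) set" where
  "laplacian_domain m \<Omega> = {f \<in> sobolev m.
     \<exists>L\<in>order_dual m \<Omega>. subdifferential m \<Omega> (local_energy m \<Omega> f) (\<lambda>_. 0) = {L}}"

definition laplacian ::
    "'a::polish_space measure \<Rightarrow> 'a set \<Rightarrow> ('a \<Rightarrow> real) \<Rightarrow> ('a \<Rightarrow> real) \<Rightarrow> real" where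
  "laplacian m \<Omega> f = (\<lambda>v. - the_elem (subdifferential m \<Omega> (local_energy m \<Omega> f) (\<lambda>_. 0)) v)"

end

theory Submission
  imports Defs
begin

text \<open>
  Along almost every curve of a test plan, the increments of a Sobolev function are bounded by the
  integrals of any weak upper gradient.  Choosing at each time the better of two bounds shows that
  weak upper gradients are stable under minima, so that a minimal one exists; cutting out the part
  of a curve between its first and its last zero shows that it vanishes on the zero set.
  Consequently the energy is modular, \<open>E(f \<or> g) + E(f \<and> g) = E(f) + E(g)\<close>.

  For \<open>v \<ge> 0\<close>, modularity applied to \<open>u + \<epsilon> v\<close> and \<open>\<psi>\<close>, together with the minimality of \<open>u\<close>, bounds
  \<open>E(u + \<epsilon> v) - E(u)\<close> from below by \<open>E(\<psi> + \<epsilon> z) - E(\<psi>)\<close> for some \<open>0 \<le> z \<le> v\<close>.  By convexity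
  this is at least \<open>\<epsilon>\<close> times the differential of the energy at \<open>\<psi>\<close> in the direction \<open>z\<close>, and
  \<open>\<epsilon> \<rightarrow> 0\<close> gives the upper bound for the Laplacian of \<open>u\<close>.  The lower bound is symmetric.
\<close>

section \<open>The space of curves\<close>

text \<open>The inequality defining a weak upper gradient is integrated over a whole test plan and
  compares only the times 0 and 1. It is localized by two operations under which test plans stay
  test plans: conditioning on a set of bad curves (\<open>uniform_measure\<close>) and stopping
  curves outside [s, t] (\<open>freeze\<close>). The result holds for each fixed pair of times,
  outside a null set of curves that depends on the pair, and no continuity of f along curves is
  established. This shapes both curve arguments: the choice between two gradients uses only the
  countably many grid times k/n, while the zero-set argument uses almost every time, obtained from
  Fubini; hence the joint measurability lemmas. Plans of stopped curves must again live on
  absolutely continuous curves, which is why distances are first bounded by the integrated metric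
  speed.

  On the dual side, order-boundedness of the Laplacians of \<phi> and \<psi> keeps the suprema in
  the lattice operations finite. The bound for u then writes its differential as a difference of two
  positive functionals, and this is what puts u into the domain of the Laplacian.\<close>

lemma mspace_curve_metric:
  "\<gamma> \<in> mspace curve_metric \<longleftrightarrow> continuous_on {0..1} \<gamma> \<and> \<gamma> \<in> extensional {0..1}"
proof -
  have "bounded (\<gamma> ` {0..1})" if "continuous_on {0..1} \<gamma>"
    using that by (intro compact_imp_bounded compact_continuous_image) auto
  then show ?thesis
    unfolding curve_metric_def by (auto simp: mbounded_iff_bounded Met_TC.mbounded_def)
qed

lemma mdist_curve_metric_ge:
  assumes "f \<in> mspace curve_metric" "g \<in> mspace curve_metric" "t \<in> {0..1}"
  shows "dist (f t) (g t) \<le> mdist curve_metric f g"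
  using cfunspace_mdist_le[of f "top_of_set {0..1}" euclidean_metric g "mdist curve_metric f g"] assms
  unfolding curve_metric_def by auto

lemma mdist_curve_metric_le:
  assumes "0 \<le> B" "\<And>t. t \<in> {0..1} \<Longrightarrow> dist (f t) (g t) \<le> B"
  shows "mdist curve_metric f g \<le> B"
  unfolding curve_metric_def by (rule mdist_cfunspace_le) (use assms in auto)

lemma openin_curve_metric:
  "openin (mtopology_of curve_metric) U \<longleftrightarrow> U \<subseteq> mspace curve_metric \<and>
     (\<forall>f\<in>U. \<exists>r>0. \<forall>g\<in>mspace curve_metric. mdist curve_metric f g < r \<longrightarrow> g \<in> U)"
proof -
  interpret Metric_space "mspace curve_metric :: (real \<Rightarrow> 'a) set" "mdist curve_metric"
    by simp
  have "mball f r \<subseteq> U \<longleftrightarrow> (\<forall>g\<in>mspace curve_metric. mdist curve_metric f g < r \<longrightarrow> g \<in> U)"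
    if "f \<in> mspace curve_metric" for f r
    using that by (auto simp: subset_iff in_mball)
  then show ?thesis
    unfolding mtopology_of_def openin_mtopology by (meson subsetD)
qed

lemma space_curve_borel: "space curve_borel = mspace curve_metric"
  unfolding curve_borel_def by (rule space_measure_of) (auto simp: openin_curve_metric)

lemma sets_curve_borel:
  "sets curve_borel = sigma_sets (mspace curve_metric) {U. openin (mtopology_of curve_metric) U}"
  unfolding curve_borel_def by (rule sets_measure_of) (auto simp: openin_curve_metric)

lemma measurable_curve_eval:
  assumes t: "t \<in> {0..1}"
  shows "(\<lambda>\<gamma>. \<gamma> t) \<in> curve_borel \<rightarrow>\<^sub>M (borel :: 'a::polish_space measure)"
proof (rule borel_measurableI)
  fix S :: "'a set" assume "open S"
  have "openin (mtopology_of curve_metric) ((\<lambda>\<gamma>. \<gamma> t) -` S \<inter> mspace curve_metric)"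
    unfolding openin_curve_metric
  proof (intro conjI ballI)
    fix f assume f: "f \<in> (\<lambda>\<gamma>. \<gamma> t) -` S \<inter> mspace curve_metric"
    then obtain r where "r > 0" "\<And>y. dist y (f t) < r \<Longrightarrow> y \<in> S"
      using \<open>open S\<close> by (auto simp: open_dist)
    then show "\<exists>r>0. \<forall>g\<in>mspace curve_metric. mdist curve_metric f g < r \<longrightarrow>
        g \<in> (\<lambda>\<gamma>. \<gamma> t) -` S \<inter> mspace curve_metric"
      using mdist_curve_metric_ge[OF _ _ t, of f] f
      by (intro exI[of _ r]) (metis IntD2 IntI dist_commute le_less_trans vimageI2)
  qed auto
  then show "(\<lambda>\<gamma>. \<gamma> t) -` S \<inter> space curve_borel \<in> sets curve_borel"
    unfolding space_curve_borel sets_curve_borel by (intro sigma_sets.Basic) auto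
qed

definition freeze :: "real \<Rightarrow> real \<Rightarrow> (real \<Rightarrow> 'a) \<Rightarrow> real \<Rightarrow> 'a" where
  "freeze s t \<gamma> = (\<lambda>r\<in>{0..1}. \<gamma> (max s (min t r)))"

lemma freeze_in_mspace:
  assumes "0 \<le> s" "s \<le> t" "t \<le> 1" "\<gamma> \<in> mspace curve_metric"
  shows "freeze s t \<gamma> \<in> mspace curve_metric"
proof -
  have "continuous_on {0..1} (\<lambda>r. \<gamma> (max s (min t r)))"
    by (rule continuous_on_compose2[of "{0..1}" \<gamma>])
      (use assms in \<open>auto simp: mspace_curve_metric intro!: continuous_intros\<close>)
  then have "continuous_on {0..1} (freeze s t \<gamma>)"
    by (subst continuous_on_cong[OF refl]) (auto simp: freeze_def)
  then show ?thesis by (auto simp: mspace_curve_metric freeze_def)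
qed

text \<open>Freezing only evaluates at clamped times, so it does not increase the sup distance;
  hence preimages of open sets of curves are open.\<close>

lemma measurable_freeze:
  assumes "0 \<le> s" "s \<le> t" "t \<le> 1"
  shows "freeze s t \<in> curve_borel \<rightarrow>\<^sub>M (curve_borel :: (real \<Rightarrow> 'a::polish_space) measure)"
proof (rule measurable_sigma_sets[OF sets_curve_borel])
  show "{U. openin (mtopology_of curve_metric) U} \<subseteq> Pow (mspace (curve_metric :: (real \<Rightarrow> 'a) metric))"
    by (auto simp: openin_curve_metric)
  show "freeze s t \<in> space curve_borel \<rightarrow> mspace (curve_metric :: (real \<Rightarrow> 'a) metric)"
    using freeze_in_mspace assms by (auto simp: space_curve_borel)
  fix U :: "(real \<Rightarrow> 'a) set"
  assume U: "U \<in> {U. openin (mtopology_of curve_metric) U}"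
  have "openin (mtopology_of curve_metric) (freeze s t -` U \<inter> mspace curve_metric)"
    unfolding openin_curve_metric
  proof (intro conjI ballI)
    fix f assume f: "f \<in> freeze s t -` U \<inter> mspace curve_metric"
    then obtain r where r: "r > 0"
      "\<And>g. g \<in> mspace curve_metric \<Longrightarrow> mdist curve_metric (freeze s t f) g < r \<Longrightarrow> g \<in> U"
      using U by (auto simp: openin_curve_metric)
    have "mdist curve_metric (freeze s t f) (freeze s t g) \<le> mdist curve_metric f g"
      if "g \<in> mspace curve_metric" for g
      by (rule mdist_curve_metric_le)
        (use that f assms in \<open>auto simp: freeze_def intro!: mdist_curve_metric_ge\<close>)
    then show "\<exists>r>0. \<forall>g\<in>mspace curve_metric. mdist curve_metric f g < r \<longrightarrow>
        g \<in> freeze s t -` U \<inter> mspace curve_metric"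
      using r freeze_in_mspace[OF assms]
      by (intro exI[of _ r] conjI ballI impI IntI vimageI2) (blast intro: le_less_trans)+
  qed auto
  then show "freeze s t -` U \<inter> space curve_borel \<in> sets curve_borel"
    unfolding space_curve_borel sets_curve_borel by (intro sigma_sets.Basic) auto
qed

text \<open>For fixed i, the time is rounded down to the grid of mesh 1/(i+1), which leaves a
  countable choice among evaluations at fixed times; continuity of the curves gives the limit in i.
  The clamp keeps all times in [0,1], the only place where the curves carry information.\<close>

lemma measurable_curve_eval_pair:
  "(\<lambda>(\<gamma>, t). \<gamma> (max 0 (min 1 t))) \<in> curve_borel \<Otimes>\<^sub>M borel \<rightarrow>\<^sub>M (borel :: 'a::polish_space measure)"
proof (rule borel_measurable_LIMSEQ_metric)
  let ?p = "\<lambda>i t. max 0 (min 1 (real_of_int \<lfloor>t * real (Suc i)\<rfloor> / real (Suc i)))"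
  show "(\<lambda>(\<gamma>, t). \<gamma> (?p i t)) \<in> curve_borel \<Otimes>\<^sub>M borel \<rightarrow>\<^sub>M (borel :: 'a measure)" for i
  proof -
    have "(\<lambda>x. (\<lambda>k x. fst x (max 0 (min 1 (real_of_int k / real (Suc i))))) \<lfloor>snd x * real (Suc i)\<rfloor> x)
        \<in> curve_borel \<Otimes>\<^sub>M borel \<rightarrow>\<^sub>M (borel :: 'a measure)"
    proof (rule measurable_compose_countable[where f = "\<lambda>k x. fst x (max 0 (min 1 (real_of_int k / real (Suc i))))"])
      show "(\<lambda>x::(real\<Rightarrow>'a)\<times>real. fst x (max 0 (min 1 (real_of_int k / real (Suc i)))))
          \<in> curve_borel \<Otimes>\<^sub>M borel \<rightarrow>\<^sub>M borel" for k
        by (rule measurable_compose[OF measurable_fst measurable_curve_eval]) auto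
    qed measurable
    then show ?thesis by (simp add: case_prod_beta')
  qed
  fix x :: "(real \<Rightarrow> 'a) \<times> real" assume "x \<in> space (curve_borel \<Otimes>\<^sub>M borel)"
  then obtain \<gamma> t where x: "x = (\<gamma>, t)" and cont: "continuous_on {0..1} \<gamma>"
    by (auto simp: space_pair_measure space_curve_borel mspace_curve_metric)
  have "(\<lambda>i. real_of_int \<lfloor>t * real (Suc i)\<rfloor> / real (Suc i)) \<longlonglongrightarrow> t"
  proof (rule tendsto_sandwich)
    show "\<forall>\<^sub>F i in sequentially. t - 1 / real (Suc i) \<le> real_of_int \<lfloor>t * real (Suc i)\<rfloor> / real (Suc i)"
    proof (intro always_eventually allI)
      fix i
      have "t * real (Suc i) - 1 \<le> real_of_int \<lfloor>t * real (Suc i)\<rfloor>" by linarith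
      then have "(t * real (Suc i) - 1) / real (Suc i) \<le> real_of_int \<lfloor>t * real (Suc i)\<rfloor> / real (Suc i)"
        by (rule divide_right_mono) simp
      then show "t - 1 / real (Suc i) \<le> real_of_int \<lfloor>t * real (Suc i)\<rfloor> / real (Suc i)"
        by (simp only: diff_divide_distrib) simp
    qed
    show "\<forall>\<^sub>F i in sequentially. real_of_int \<lfloor>t * real (Suc i)\<rfloor> / real (Suc i) \<le> t"
      by (intro always_eventually allI) (simp add: divide_le_eq)
    show "(\<lambda>i. t - 1 / real (Suc i)) \<longlonglongrightarrow> t"
      using tendsto_diff[OF tendsto_const LIMSEQ_inverse_real_of_nat, of t]
      by (simp add: inverse_eq_divide)
  qed simp
  then have "(\<lambda>i. ?p i t) \<longlonglongrightarrow> max 0 (min 1 t)"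
    by (intro tendsto_intros)
  then have "(\<lambda>i. \<gamma> (?p i t)) \<longlonglongrightarrow> \<gamma> (max 0 (min 1 t))"
    by (rule continuous_on_tendsto_compose[OF cont]) auto
  then show "(\<lambda>i. (\<lambda>(\<gamma>, t). \<gamma> (?p i t)) x) \<longlonglongrightarrow> (\<lambda>(\<gamma>, t). \<gamma> (max 0 (min 1 t))) x"
    by (simp add: x)
qed

text \<open>Measurability of the speed needs countably many operations. By continuity of the curve,
  the difference quotient at any s is a limit of quotients at rational times, so rational times and
  radii 1/(n+1) suffice. The default 0 is the least element of \<open>ennreal\<close> and does not
  affect the supremum.\<close>

lemma metric_speed_countable:
  assumes cont: "continuous_on {0..1} \<gamma>" and t: "t \<in> {0..1}"
  shows "metric_speed \<gamma> t = (INF n. SUP q\<in>\<rat> \<inter> {0..1}.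
     if q \<noteq> t \<and> \<bar>q - t\<bar> < inverse (real (Suc n))
     then ennreal (dist (\<gamma> q) (\<gamma> t) / \<bar>q - t\<bar>) else 0)" (is "_ = (INF n. ?S n)")
proof (rule antisym)
  let ?h = "\<lambda>s. ennreal (dist (\<gamma> s) (\<gamma> t) / \<bar>s - t\<bar>)"
  show "metric_speed \<gamma> t \<le> (INF n. ?S n)"
  proof (rule INF_greatest)
    fix n
    let ?e = "inverse (real (Suc n))"
    have "?h s \<le> ?S n" if s: "s \<in> {0..1} \<inter> ball t ?e - {t}" for s
    proof -
      \<comment> \<open>The approximating rationals have to stay in [0,1]: they are taken to the
        right of s, and at s = 1 the point itself is rational.\<close>
      have "\<exists>q\<in>\<rat> \<inter> {0..1}. \<bar>q - s\<bar> < inverse (real (Suc i))" for i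
      proof (cases "s = 1")
        case False
        with s have "s < min 1 (s + inverse (real (Suc i)))" by auto
        then obtain q where "q \<in> \<rat>" "s < q" "q < min 1 (s + inverse (real (Suc i)))"
          using Rats_dense_in_real by blast
        with s show ?thesis by (intro bexI[of _ q]) auto
      qed (auto intro!: bexI[of _ 1])
      then obtain q where q: "\<And>i. q i \<in> \<rat> \<inter> {0..1}" "\<And>i. \<bar>q i - s\<bar> < inverse (real (Suc i))"
        by metis
      have lim: "q \<longlonglongrightarrow> s"
        by (rule LIM_zero_cancel, rule Lim_null_comparison[OF _ LIMSEQ_inverse_real_of_nat])
          (use q(2) in \<open>auto intro!: always_eventually less_imp_le\<close>)
      have "(\<lambda>i. \<gamma> (q i)) \<longlonglongrightarrow> \<gamma> s"
        by (rule continuous_on_tendsto_compose[OF cont lim])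
          (use s q(1) in \<open>auto intro!: always_eventually\<close>)
      then have "(\<lambda>i. ?h (q i)) \<longlonglongrightarrow> ?h s"
        using s lim by (intro tendsto_intros) auto
      moreover have "\<forall>\<^sub>F i in sequentially. q i \<in> ball t ?e - {t}"
        by (rule topological_tendstoD[OF lim]) (use s in \<open>auto intro!: open_Diff\<close>)
      then have "\<forall>\<^sub>F i in sequentially. ?h (q i) \<le> ?S n"
      proof eventually_elim
        case (elim i)
        then show ?case
          using q(1)[of i]
          by (intro SUP_upper2[of "q i"]) (auto simp: dist_real_def abs_minus_commute)
      qed
      ultimately show ?thesis
        by (intro tendsto_upperbound[where F=sequentially]) auto
    qed
    then have "(SUP s\<in>{0..1} \<inter> ball t ?e - {t}. ?h s) \<le> ?S n"
      by (rule SUP_least)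
    then show "metric_speed \<gamma> t \<le> ?S n"
      unfolding metric_speed_def Limsup_within
      by (rule INF_lower2[rotated]) auto
  qed
  show "(INF n. ?S n) \<le> metric_speed \<gamma> t"
    unfolding metric_speed_def Limsup_within
  proof (rule INF_greatest)
    fix e :: real assume "e \<in> {0<..}"
    then obtain n where n: "inverse (real (Suc n)) < e"
      using reals_Archimedean by auto
    have "?S n \<le> (SUP s\<in>{0..1} \<inter> ball t e - {t}. ?h s)"
      by (rule SUP_least) (use n in \<open>auto simp: dist_real_def intro!: SUP_upper2\<close>)
    then show "(INF n. ?S n) \<le> (SUP s\<in>{0..1} \<inter> ball t e - {t}. ?h s)"
      by (rule INF_lower2[rotated]) auto
  qed
qed

lemma measurable_metric_speed:
  "(\<lambda>(\<gamma>, t). metric_speed \<gamma> t * indicator {0..1} t)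
     \<in> borel_measurable ((curve_borel :: (real \<Rightarrow> 'a::polish_space) measure) \<Otimes>\<^sub>M borel)"
proof -
  note [measurable] = measurable_curve_eval_pair
  have [measurable]: "(\<lambda>x. fst x q) \<in> (curve_borel :: (real \<Rightarrow> 'a) measure) \<Otimes>\<^sub>M borel \<rightarrow>\<^sub>M borel"
    if "q \<in> \<rat> \<inter> {0..1}" for q
    by (rule measurable_compose[OF measurable_fst measurable_curve_eval]) (use that in auto)
  have [measurable]: "(\<lambda>x. fst x (max 0 (min 1 (snd x))))
      \<in> (curve_borel :: (real \<Rightarrow> 'a) measure) \<Otimes>\<^sub>M borel \<rightarrow>\<^sub>M borel"
    using measurable_curve_eval_pair by (simp add: case_prod_beta')
  have cq: "countable (\<rat> \<inter> {0..1::real})"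
    using countable_rat by (rule countable_subset[rotated]) auto
  have "(\<lambda>x. (INF n. SUP q\<in>\<rat> \<inter> {0..1}.
     if q \<noteq> snd x \<and> \<bar>q - snd x\<bar> < inverse (real (Suc n))
     then ennreal (dist (fst x q) (fst x (max 0 (min 1 (snd x)))) / \<bar>q - snd x\<bar>) else 0) * indicator {0..1} (snd x))
    \<in> borel_measurable ((curve_borel :: (real \<Rightarrow> 'a) measure) \<Otimes>\<^sub>M borel)" (is "?f \<in> _")
    using cq by (intro borel_measurable_times_ennreal borel_measurable_INF borel_measurable_SUP) measurable
  also have "?this \<longleftrightarrow> ?thesis"
    by (intro measurable_cong)
      (auto simp: space_pair_measure space_curve_borel mspace_curve_metric metric_speed_countable
         split: split_indicator)
  finally show ?thesis .
qed

section \<open>Absolutely continuous curves\<close>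

lemma measurable_curve_speed:
  fixes \<gamma> :: "real \<Rightarrow> 'a::polish_space"
  assumes "\<gamma> \<in> mspace curve_metric"
  shows "(\<lambda>t. metric_speed \<gamma> t * indicator {0..1} t) \<in> borel_measurable borel"
  using measurable_Pair2[OF measurable_metric_speed, of \<gamma>] assms
  by (simp add: space_curve_borel)

text \<open>Passage from the Lebesgue integral to the gauge integral \<open>integral\<close>, in
  whose terms the tagged divisions of the next lemma are phrased.\<close>

lemma set_nn_integral_lborel_finite:
  fixes f :: "real \<Rightarrow> real"
  assumes [measurable]: "f \<in> borel_measurable borel" "A \<in> sets borel"
    and nonneg: "\<And>x. 0 \<le> f x" and fin: "(\<integral>\<^sup>+x\<in>A. ennreal (f x) \<partial>lborel) < \<infinity>"
  shows "set_integrable lborel A f"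
    and "(\<integral>\<^sup>+x\<in>A. ennreal (f x) \<partial>lborel) = ennreal (integral A f)"
proof -
  show "set_integrable lborel A f"
    unfolding set_integrable_def
  proof (rule integrableI_bounded)
    have "(\<integral>\<^sup>+x. ennreal (norm (indicat_real A x *\<^sub>R f x)) \<partial>lborel) = (\<integral>\<^sup>+x\<in>A. ennreal (f x) \<partial>lborel)"
      by (intro nn_integral_cong) (auto simp: nonneg split: split_indicator)
    then show "(\<integral>\<^sup>+x. ennreal (norm (indicat_real A x *\<^sub>R f x)) \<partial>lborel) < \<infinity>"
      using fin by simp
  qed measurable
  have "set_borel_measurable borel A f"
    unfolding set_borel_measurable_def by measurable
  then show "(\<integral>\<^sup>+x\<in>A. ennreal (f x) \<partial>lborel) = ennreal (integral A f)"
    using nonneg fin by (intro set_nn_integral_lborel_eq_integral) auto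
qed

text \<open>The speed controls increments near a time only where it is finite. Such times are
  handled by the gauge definition of the integral of the speed. The remaining times form a null set
  Z, covered by an open set U on which the majorant g from absolute continuity has small integral. A
  tagged division that is fine for both purposes adds up the two bounds.\<close>

lemma abs_cont_curve_dist_le_speed:
  fixes \<gamma> :: "real \<Rightarrow> 'a::polish_space"
  assumes \<gamma>: "\<gamma> \<in> mspace curve_metric" and ac: "abs_cont_curve \<gamma>"
    and fin: "(\<integral>\<^sup>+t\<in>{0..1}. metric_speed \<gamma> t \<partial>lborel) < \<infinity>"
    and ab: "0 \<le> a" "a \<le> b" "b \<le> 1"
  shows "ennreal (dist (\<gamma> a) (\<gamma> b)) \<le> (\<integral>\<^sup>+t\<in>{a..b}. metric_speed \<gamma> t \<partial>lborel)"
proof -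
  obtain g where g: "set_integrable lborel {0..1} g"
    and dg: "\<And>s t. 0 \<le> s \<Longrightarrow> s \<le> t \<Longrightarrow> t \<le> 1 \<Longrightarrow> dist (\<gamma> s) (\<gamma> t) \<le> (LINT r:{s..t}|lborel. g r)"
    using ac unfolding abs_cont_curve_def by blast
  define v where "v t = metric_speed \<gamma> t * indicator {0..1} t" for t
  define h where "h t = enn2real (v t)" for t
  define k0 where "k0 t = \<bar>indicator {0..1} t * g t\<bar>" for t
  define Z where "Z = {t. v t = \<infinity>}"
  have [measurable]: "v \<in> borel_measurable borel"
    unfolding v_def using \<gamma> by (rule measurable_curve_speed)
  have [measurable]: "h \<in> borel_measurable borel" unfolding h_def by measurable
  have gi: "integrable lborel (\<lambda>t. indicator {0..1} t * g t)"
    using g by (simp add: set_integrable_def)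
  have [measurable]: "k0 \<in> borel_measurable borel"
    using borel_measurable_integrable[OF gi] unfolding k0_def by simp
  have [measurable]: "Z \<in> sets borel" unfolding Z_def by measurable
  have vfin: "(\<integral>\<^sup>+t. v t \<partial>lborel) < \<infinity>" using fin unfolding v_def by simp
  have Z0: "emeasure lborel Z = 0"
  proof -
    have "AE t in lborel. v t \<noteq> \<infinity>"
      by (rule nn_integral_noteq_infinite) (use vfin in auto)
    then show ?thesis
      by (subst (asm) AE_iff_measurable[OF _ refl]) (auto simp: Z_def)
  qed
  have h_le: "(\<integral>\<^sup>+t\<in>{a..b}. ennreal (h t) \<partial>lborel) \<le> (\<integral>\<^sup>+t\<in>{a..b}. metric_speed \<gamma> t \<partial>lborel)"
    by (intro nn_integral_mono)
      (use ab in \<open>auto simp: h_def v_def ennreal_enn2real_if split: split_indicator\<close>)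
  have h_fin: "(\<integral>\<^sup>+t\<in>{a..b}. ennreal (h t) \<partial>lborel) < \<infinity>"
  proof -
    have "(\<integral>\<^sup>+t\<in>{a..b}. ennreal (h t) \<partial>lborel) \<le> (\<integral>\<^sup>+t. v t \<partial>lborel)"
      by (intro nn_integral_mono)
        (auto simp: h_def ennreal_enn2real_if split: split_indicator)
    then show ?thesis using vfin by (rule le_less_trans)
  qed
  have h_nonneg: "0 \<le> h t" for t by (simp add: h_def)
  have h_eq: "(\<integral>\<^sup>+t\<in>{a..b}. ennreal (h t) \<partial>lborel) = ennreal (integral {a..b} h)"
    by (rule set_nn_integral_lborel_finite(2)[OF _ _ h_nonneg h_fin]) auto
  have h_int: "h integrable_on {a..b}"
    by (rule set_borel_integral_eq_integral(1)[OF set_nn_integral_lborel_finite(1)[OF _ _ h_nonneg h_fin]]) auto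
  \<comment> \<open>The error has three parts: e for the Riemann sum of h, e for the integral of g
    over the exceptional open set, and e * (b - a) from the slack in the local bound by h r +
    e.\<close>
  have approx: "dist (\<gamma> a) (\<gamma> b) \<le> integral {a..b} h + (2 + (b - a)) * e" if e: "e > 0" for e
  proof -
    \<comment> \<open>A finite measure that does not charge Z, because Z is Lebesgue null. Outer
      regularity then yields an open U containing Z with
      \<open>emeasure \<nu> U < ennreal e\<close>.\<close>
    define \<nu> where "\<nu> = density lborel (\<lambda>t. ennreal (k0 t))"
    have \<nu>: "emeasure \<nu> A = (\<integral>\<^sup>+t. ennreal (k0 t) * indicator A t \<partial>lborel)" if "A \<in> sets borel" for A
      unfolding \<nu>_def by (rule emeasure_density) (use that in auto)
    have "emeasure \<nu> Z = 0"
      using Z0 by (subst \<nu>) (auto intro!: nn_integral_0_iff_AE[THEN iffD2] AE_I'[of Z]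
          simp: null_sets_def indicator_def split: if_splits)
    moreover have "emeasure \<nu> (space \<nu>) \<noteq> \<infinity>"
    proof -
      have "emeasure \<nu> (space \<nu>) = (\<integral>\<^sup>+t. ennreal (norm (indicator {0..1} t * g t)) \<partial>lborel)"
      proof -
        have "space \<nu> = UNIV" by (simp add: \<nu>_def)
        then show ?thesis using \<nu>[of UNIV] by (simp add: k0_def)
      qed
      then show ?thesis using gi by (simp add: integrable_iff_bounded less_top[symmetric])
    qed
    then have "emeasure \<nu> Z = (INF U \<in> {U. Z \<subseteq> U \<and> open U}. emeasure \<nu> U)"
      by (intro outer_regular) (auto simp: \<nu>_def)
    ultimately have "(INF U \<in> {U. Z \<subseteq> U \<and> open U}. emeasure \<nu> U) < ennreal e"
      using e by simp
    then obtain U where U: "Z \<subseteq> U" "open U" "emeasure \<nu> U < ennreal e"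
      by (auto simp: INF_less_iff)
    define k where "k t = k0 t * indicator U t" for t
    have [measurable]: "U \<in> sets borel" using U by simp
    have [measurable]: "k \<in> borel_measurable borel" unfolding k_def by measurable
    have k_le: "(\<integral>\<^sup>+t\<in>{a..b}. ennreal (k t) \<partial>lborel) \<le> emeasure \<nu> U"
      by (subst \<nu>) (auto intro!: nn_integral_mono simp: k_def split: split_indicator)
    then have k_fin: "(\<integral>\<^sup>+t\<in>{a..b}. ennreal (k t) \<partial>lborel) < \<infinity>"
      by (rule le_less_trans) (rule less_trans[OF U(3)], simp)
    have k_nonneg: "0 \<le> k t" for t by (simp add: k_def k0_def)
    have k_eq: "(\<integral>\<^sup>+t\<in>{a..b}. ennreal (k t) \<partial>lborel) = ennreal (integral {a..b} k)"
      by (rule set_nn_integral_lborel_finite(2)[OF _ _ k_nonneg k_fin]) auto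
    then have k_less: "integral {a..b} k < e"
      using le_less_trans[OF k_le U(3)] ennreal_leI leD not_le by metis
    have k_lint: "set_integrable lborel {a..b} k"
      by (rule set_nn_integral_lborel_finite(1)[OF _ _ k_nonneg k_fin]) auto
    then have k_int: "k integrable_on {a..b}" by (rule set_borel_integral_eq_integral)
    have dk: "dist (\<gamma> c) (\<gamma> d) \<le> integral {c..d} k" if cd: "a \<le> c" "c \<le> d" "d \<le> b" "{c..d} \<subseteq> U" for c d
    proof -
      have "dist (\<gamma> c) (\<gamma> d) \<le> (LINT r:{c..d}|lborel. g r)" using cd ab by (intro dg) auto
      also have "\<dots> \<le> (LINT r:{c..d}|lborel. k r)"
        unfolding set_lebesgue_integral_def
      proof (rule integral_mono)
        have "integrable lborel (\<lambda>t. indicator {c..d} t *\<^sub>R (indicator {0..1} t * g t))"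
          by (rule integrable_mult_indicator[OF _ gi]) auto
        then show "integrable lborel (\<lambda>t. indicator {c..d} t *\<^sub>R g t)"
          by (rule Bochner_Integration.integrable_cong[THEN iffD1, rotated 2]) (use cd ab in \<open>auto split: split_indicator\<close>)
        show "integrable lborel (\<lambda>t. indicator {c..d} t *\<^sub>R k t)"
          using set_integrable_subset[OF k_lint, of "{c..d}"] cd by (auto simp: set_integrable_def)
      qed (use cd ab in \<open>auto simp: k_def k0_def split: split_indicator\<close>)
      also have "\<dots> = integral {c..d} k"
        by (rule set_borel_integral_eq_integral(2)[OF set_integrable_subset[OF k_lint]]) (use cd in auto)
      finally show ?thesis .
    qed
    have "\<exists>d>0. (r \<in> Z \<longrightarrow> ball r d \<subseteq> U) \<and> (r \<in> {0..1} - Z \<longrightarrow>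
        (\<forall>s\<in>{0..1}. \<bar>s - r\<bar> < d \<longrightarrow> dist (\<gamma> s) (\<gamma> r) \<le> (h r + e) * \<bar>s - r\<bar>))" for r
    proof (cases "r \<in> Z")
      case True
      then show ?thesis using U by (auto simp: open_contains_ball)
    next
      case rZ: False
      show ?thesis
      proof (cases "r \<in> {0..1}")
        case True
        have "metric_speed \<gamma> r < ennreal (h r + e)"
        proof -
          have "metric_speed \<gamma> r = v r" using True by (simp add: v_def)
          moreover have "v r = ennreal (h r)" using rZ by (simp add: Z_def h_def less_top)
          moreover have "ennreal (h r) < ennreal (h r + e)"
            using e h_nonneg[of r] by (intro ennreal_lessI) auto
          ultimately show ?thesis by simp
        qed
        then have "\<forall>\<^sub>F s in at r within {0..1}. ennreal (dist (\<gamma> s) (\<gamma> r) / \<bar>s - r\<bar>) < ennreal (h r + e)"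
          unfolding metric_speed_def by (rule Limsup_lessD)
        then obtain d where d: "d > 0" "\<And>s. s \<in> {0..1} \<Longrightarrow> s \<noteq> r \<Longrightarrow> \<bar>s - r\<bar> < d \<Longrightarrow>
            ennreal (dist (\<gamma> s) (\<gamma> r) / \<bar>s - r\<bar>) < ennreal (h r + e)"
          unfolding eventually_at dist_real_def by auto
        have "dist (\<gamma> s) (\<gamma> r) \<le> (h r + e) * \<bar>s - r\<bar>" if "s \<in> {0..1}" "\<bar>s - r\<bar> < d" for s
        proof (cases "s = r")
          case False
          then show ?thesis using d(2)[OF that(1) False that(2)]
            by (simp add: ennreal_less_iff divide_less_eq)
        qed simp
        then show ?thesis using d(1) rZ by blast
      qed (use rZ in \<open>auto intro: exI[of _ 1]\<close>)
    qed
    then have "\<exists>\<delta>. \<forall>r. \<delta> r > 0 \<and> (r \<in> Z \<longrightarrow> ball r (\<delta> r) \<subseteq> U) \<and> (r \<in> {0..1} - Z \<longrightarrow>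
        (\<forall>s\<in>{0..1}. \<bar>s - r\<bar> < \<delta> r \<longrightarrow> dist (\<gamma> s) (\<gamma> r) \<le> (h r + e) * \<bar>s - r\<bar>))"
      by (intro choice allI) auto
    then obtain \<delta> where \<delta>: "\<And>r. \<delta> r > 0" "\<And>r. r \<in> Z \<Longrightarrow> ball r (\<delta> r) \<subseteq> U"
      "\<And>r s. r \<in> {0..1} - Z \<Longrightarrow> s \<in> {0..1} \<Longrightarrow> \<bar>s - r\<bar> < \<delta> r \<Longrightarrow>
         dist (\<gamma> s) (\<gamma> r) \<le> (h r + e) * \<bar>s - r\<bar>"
      by blast
    obtain \<Gamma> where "gauge \<Gamma> \<and> (\<forall>D. D tagged_division_of {a..b} \<and> \<Gamma> fine D \<longrightarrow>
        norm ((\<Sum>(x,K)\<in>D. measure lborel K *\<^sub>R h x) - integral {a..b} h) < e)"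
      using has_integral_real[THEN iffD1, OF integrable_integral[OF h_int], THEN spec, THEN mp, OF e] ..
    then have \<Gamma>: "gauge \<Gamma>" "\<And>D. D tagged_division_of {a..b} \<Longrightarrow> \<Gamma> fine D \<Longrightarrow>
        norm ((\<Sum>(x,K)\<in>D. measure lborel K *\<^sub>R h x) - integral {a..b} h) < e"
      by simp_all
    have "gauge (\<lambda>r. \<Gamma> r \<inter> ball r (\<delta> r))"
      using \<Gamma>(1) \<delta>(1) by (intro gauge_Int gauge_ball_dependent) auto
    then obtain D where D: "D tagged_division_of {a..b}" and "(\<lambda>r. \<Gamma> r \<inter> ball r (\<delta> r)) fine D"
      using fine_division_exists_real by blast
    then have fD: "\<Gamma> fine D" "(\<lambda>r. ball r (\<delta> r)) fine D" by (auto simp: fine_Int)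
    \<comment> \<open>The increments of this real function are at most the distances of the curve,
      and being real-valued it telescopes over a tagged division.\<close>
    define \<rho> where "\<rho> t = dist (\<gamma> a) (\<gamma> t)" for t
    have "dist (\<gamma> a) (\<gamma> b) = \<rho> b - \<rho> a" by (simp add: \<rho>_def)
    also have "\<dots> = (\<Sum>(x,K)\<in>D. \<rho> (Sup K) - \<rho> (Inf K))"
      by (rule additive_tagged_division_1[OF ab(2) D, symmetric])
    also have "\<dots> \<le> (\<Sum>(x,K)\<in>D. measure lborel K * (h x + e) + integral K k)"
    proof (rule sum_mono, clarify)
      fix x K assume xK: "(x, K) \<in> D"
      obtain c d where K: "K = {c..d}" using tagged_division_ofD(4)[OF D xK] by auto
      have xin: "x \<in> K" "K \<subseteq> {a..b}" using tagged_division_ofD(2,3)[OF D xK] .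
      have Kb: "K \<subseteq> ball x (\<delta> x)" using fD(2) xK by (auto simp: fine_def)
      have cd: "c \<le> x" "x \<le> d" "a \<le> c" "d \<le> b" using xin unfolding K by auto
      have kpos: "0 \<le> integral K k"
        by (rule integral_nonneg[OF set_borel_integral_eq_integral(1)[OF set_integrable_subset[OF k_lint]]])
          (use xin K k_nonneg in auto)
      have "\<rho> d - \<rho> c \<le> dist (\<gamma> c) (\<gamma> d)"
        unfolding \<rho>_def using dist_triangle[of "\<gamma> a" "\<gamma> d" "\<gamma> c"] by simp
      also have "\<dots> \<le> measure lborel K * (h x + e) + integral K k"
      proof (cases "x \<in> Z")
        case True
        then have "{c..d} \<subseteq> U" using \<delta>(2) Kb K by auto
        then have "dist (\<gamma> c) (\<gamma> d) \<le> integral K k" using dk cd K by auto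
        moreover have "0 \<le> measure lborel K * (h x + e)" using e by (simp add: h_def)
        ultimately show ?thesis by simp
      next
        case False
        have x: "x \<in> {0..1} - Z" using False cd ab by auto
        have "c \<in> K" "d \<in> K" using K cd by auto
        then have "c \<in> ball x (\<delta> x)" "d \<in> ball x (\<delta> x)" using Kb by blast+
        then have "\<bar>c - x\<bar> < \<delta> x" "\<bar>d - x\<bar> < \<delta> x" by (simp_all add: dist_real_def abs_minus_commute)
        then have "dist (\<gamma> c) (\<gamma> x) \<le> (h x + e) * \<bar>c - x\<bar>" "dist (\<gamma> d) (\<gamma> x) \<le> (h x + e) * \<bar>d - x\<bar>"
          using cd ab \<delta>(3)[OF x, of c] \<delta>(3)[OF x, of d] by auto
        moreover have "dist (\<gamma> c) (\<gamma> d) \<le> dist (\<gamma> c) (\<gamma> x) + dist (\<gamma> d) (\<gamma> x)"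
          by (rule dist_triangle2)
        moreover have "measure lborel K * (h x + e) = (h x + e) * \<bar>c - x\<bar> + (h x + e) * \<bar>d - x\<bar>"
          using cd K by (simp add: algebra_simps)
        ultimately show ?thesis using kpos by linarith
      qed
      finally show "\<rho> (Sup K) - \<rho> (Inf K) \<le> measure lborel K * (h x + e) + integral K k"
        using K cd by simp
    qed
    also have "\<dots> = (\<Sum>(x,K)\<in>D. measure lborel K *\<^sub>R h x) + e * (\<Sum>(x,K)\<in>D. measure lborel K) + (\<Sum>(x,K)\<in>D. integral K k)"
      by (simp add: sum.distrib sum_distrib_left case_prod_beta' algebra_simps)
    also have "(\<Sum>(x,K)\<in>D. measure lborel K) = b - a"
      using additive_content_tagged_division[of D a b] D ab by simp
    also have "(\<Sum>(x,K)\<in>D. integral K k) = integral {a..b} k"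
      using integral_combine_tagged_division_topdown[of k a b D] k_int D by simp
    also have "(\<Sum>(x,K)\<in>D. measure lborel K *\<^sub>R h x) \<le> integral {a..b} h + e"
      using \<Gamma>(2)[OF D fD(1)] unfolding real_norm_def by linarith
    finally show ?thesis using k_less by (simp add: algebra_simps)
  qed
  have "dist (\<gamma> a) (\<gamma> b) \<le> integral {a..b} h + e" if "e > 0" for e
    using approx[of "e / (2 + (b - a))"] that ab by simp
  then have "dist (\<gamma> a) (\<gamma> b) \<le> integral {a..b} h"
    by (rule field_le_epsilon)
  then show ?thesis
    using h_le unfolding h_eq by (meson ennreal_leI order_trans)
qed

text \<open>The integral of H along \<gamma> with respect to arc length, over the time interval
  [s, t].\<close>

definition speed_integral :: "('a::metric_space \<Rightarrow> ennreal) \<Rightarrow> (real \<Rightarrow> 'a) \<Rightarrow> real \<Rightarrow> real \<Rightarrow> ennreal" where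
  "speed_integral H \<gamma> s t = (\<integral>\<^sup>+r\<in>{s..t}. H (\<gamma> r) * metric_speed \<gamma> r \<partial>lborel)"

lemma measurable_curve_integrand:
  assumes [measurable]: "H \<in> borel_measurable borel"
  shows "(\<lambda>(\<gamma>, t). H (\<gamma> t) * metric_speed \<gamma> t * indicator {0..1} t)
     \<in> borel_measurable ((curve_borel :: (real \<Rightarrow> 'a::polish_space) measure) \<Otimes>\<^sub>M borel)"
proof -
  note [measurable] = measurable_metric_speed[unfolded case_prod_beta']
    measurable_curve_eval_pair[unfolded case_prod_beta']
  have "(\<lambda>x. H (fst x (max 0 (min 1 (snd x)))) * (metric_speed (fst x) (snd x) * indicator {0..1} (snd x)))
     \<in> borel_measurable ((curve_borel :: (real \<Rightarrow> 'a::polish_space) measure) \<Otimes>\<^sub>M borel)"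
    by measurable
  then show ?thesis
    by (rule measurable_cong[THEN iffD1, rotated]) (auto split: split_indicator)
qed

lemma measurable_curve_integrand1:
  fixes \<gamma> :: "real \<Rightarrow> 'a::polish_space"
  assumes "H \<in> borel_measurable borel" "\<gamma> \<in> mspace curve_metric"
  shows "(\<lambda>t. H (\<gamma> t) * metric_speed \<gamma> t * indicator {0..1} t) \<in> borel_measurable borel"
  using measurable_Pair2[OF measurable_curve_integrand[OF assms(1)], of \<gamma>] assms(2)
  by (simp add: space_curve_borel)

text \<open>The end points are variables because \<open>weak_upper_gradient_nonzero\<close>
  exchanges "almost every curve" with "almost every intermediate time". Clamping them keeps the
  integrand inside [0,1], where its joint measurability is known.\<close>

lemma measurable_speed_integral_pair:
  assumes H: "H \<in> borel_measurable borel"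
  shows "(\<lambda>(\<gamma>, s, t). speed_integral H \<gamma> (max 0 s) (min 1 t))
     \<in> borel_measurable ((curve_borel :: (real \<Rightarrow> 'a::polish_space) measure) \<Otimes>\<^sub>M (borel \<Otimes>\<^sub>M borel))"
proof -
  have [measurable]: "(\<lambda>x. H (fst x (snd x)) * metric_speed (fst x) (snd x) * indicator {0..1} (snd x))
     \<in> borel_measurable ((curve_borel :: (real \<Rightarrow> 'a::polish_space) measure) \<Otimes>\<^sub>M lborel)"
    using measurable_curve_integrand[OF H] by (simp add: case_prod_beta' cong: measurable_cong_sets)
  have 1: "(\<lambda>x. (\<lambda>x. H (fst x (snd x)) * metric_speed (fst x) (snd x) * indicator {0..1} (snd x)) (fst (fst x), snd x)
        * (if max 0 (fst (snd (fst x))) \<le> snd x \<and> snd x \<le> min 1 (snd (snd (fst x))) then 1 else 0))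
     \<in> borel_measurable (((curve_borel :: (real \<Rightarrow> 'a::polish_space) measure) \<Otimes>\<^sub>M (borel \<Otimes>\<^sub>M borel)) \<Otimes>\<^sub>M lborel)"
    by (rule borel_measurable_times_ennreal, rule measurable_compose_rev) measurable
  have "(\<lambda>y. \<integral>\<^sup>+r. H (fst y r) * metric_speed (fst y) r * indicator {0..1} r
        * (if max 0 (fst (snd y)) \<le> r \<and> r \<le> min 1 (snd (snd y)) then 1 else 0) \<partial>lborel)
     \<in> borel_measurable ((curve_borel :: (real \<Rightarrow> 'a::polish_space) measure) \<Otimes>\<^sub>M (borel \<Otimes>\<^sub>M borel))"
    using lborel.borel_measurable_nn_integral_fst[OF 1] by simp
  then show ?thesis
    unfolding speed_integral_def case_prod_beta'
    by (rule measurable_cong[THEN iffD1, rotated]) (auto intro!: nn_integral_cong split: split_indicator)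
qed

lemma measurable_speed_integral:
  assumes H: "H \<in> borel_measurable borel" and st: "0 \<le> s" "t \<le> 1"
  shows "(\<lambda>\<gamma>. speed_integral H \<gamma> s t)
     \<in> borel_measurable (curve_borel :: (real \<Rightarrow> 'a::polish_space) measure)"
proof -
  have "(\<lambda>\<gamma>. (\<lambda>(\<gamma>, s, t). speed_integral H \<gamma> (max 0 s) (min 1 t)) (\<gamma>, s, t))
     \<in> borel_measurable (curve_borel :: (real \<Rightarrow> 'a::polish_space) measure)"
    by (rule measurable_compose[OF _ measurable_speed_integral_pair[OF H]]) simp
  then show ?thesis using st by simp
qed

lemma measurable_speed_square_integral:
  "(\<lambda>\<gamma>. \<integral>\<^sup>+t\<in>{0..1}. (metric_speed \<gamma> t)\<^sup>2 \<partial>lborel)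
     \<in> borel_measurable (curve_borel :: (real \<Rightarrow> 'a::polish_space) measure)"
proof -
  have [measurable]: "(\<lambda>(\<gamma>, t). metric_speed \<gamma> t * indicator {0..1} t)
     \<in> borel_measurable ((curve_borel :: (real \<Rightarrow> 'a::polish_space) measure) \<Otimes>\<^sub>M lborel)"
    using measurable_metric_speed by (simp cong: measurable_cong_sets)
  have "(\<lambda>x. (case x of (\<gamma>, t) \<Rightarrow> metric_speed \<gamma> t * indicator {0..1} t)\<^sup>2)
     \<in> borel_measurable ((curve_borel :: (real \<Rightarrow> 'a::polish_space) measure) \<Otimes>\<^sub>M lborel)"
    by measurable
  from lborel.borel_measurable_nn_integral_fst[OF this] show ?thesis
    by (rule measurable_cong[THEN iffD1, rotated]) (auto intro!: nn_integral_cong split: split_indicator)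
qed

text \<open>
  A Borel set of absolutely continuous curves that carries every test plan.  It replaces
  \<^const>\<open>abs_cont_curve\<close>, whose measurability is not evident, when a plan is pushed forward.
\<close>

definition finite_energy_curves :: "(real \<Rightarrow> 'a::polish_space) set" where
  "finite_energy_curves = {\<gamma> \<in> mspace curve_metric.
     (\<integral>\<^sup>+t\<in>{0..1}. (metric_speed \<gamma> t)\<^sup>2 \<partial>lborel) < \<infinity> \<and>
     (\<forall>s\<in>\<rat> \<inter> {0..1}. \<forall>t\<in>\<rat> \<inter> {0..1}. s \<le> t \<longrightarrow>
        ennreal (dist (\<gamma> s) (\<gamma> t)) \<le> speed_integral (\<lambda>_. 1) \<gamma> s t)}"

text \<open>The distance bounds are imposed at rational times only, so countably many measurable
  conditions cut out the set.\<close>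

lemma sets_finite_energy_curves: "finite_energy_curves \<in> sets curve_borel"
proof -
  have cq: "countable (\<rat> \<inter> {0..1::real})"
    using countable_rat by (rule countable_subset[rotated]) auto
  have [measurable]: "Measurable.pred (curve_borel :: (real \<Rightarrow> 'a) measure)
      (\<lambda>\<gamma>. ennreal (dist (\<gamma> s) (\<gamma> t)) \<le> speed_integral (\<lambda>_. 1) \<gamma> s t)"
    if "s \<in> \<rat> \<inter> {0..1}" "t \<in> \<rat> \<inter> {0..1}" for s t
  proof -
    have [measurable]: "(\<lambda>\<gamma>. \<gamma> s) \<in> (curve_borel :: (real \<Rightarrow> 'a) measure) \<rightarrow>\<^sub>M borel"
      "(\<lambda>\<gamma>. \<gamma> t) \<in> (curve_borel :: (real \<Rightarrow> 'a) measure) \<rightarrow>\<^sub>M borel"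
      "(\<lambda>\<gamma>. speed_integral (\<lambda>_. 1) \<gamma> s t) \<in> borel_measurable (curve_borel :: (real \<Rightarrow> 'a) measure)"
      using that by (auto intro!: measurable_curve_eval measurable_speed_integral)
    show ?thesis
      unfolding pred_def
      by (intro borel_measurable_le measurable_compose[OF borel_measurable_dist measurable_ennreal]) fact+
  qed
  have "{\<gamma> \<in> space curve_borel. (\<integral>\<^sup>+t\<in>{0..1}. (metric_speed \<gamma> t)\<^sup>2 \<partial>lborel) < \<infinity> \<and>
     (\<forall>s\<in>\<rat> \<inter> {0..1}. \<forall>t\<in>\<rat> \<inter> {0..1}. s \<le> t \<longrightarrow>
        ennreal (dist (\<gamma> s) (\<gamma> t)) \<le> speed_integral (\<lambda>_. 1) \<gamma> s t)} \<in> sets (curve_borel :: (real \<Rightarrow> 'a) measure)"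
    using measurable_speed_square_integral cq by measurable
  then show ?thesis
    by (simp add: finite_energy_curves_def space_curve_borel)
qed

lemma ennreal_mult_le_squares: "x * y \<le> x\<^sup>2 + (y::ennreal)\<^sup>2"
proof (cases x y rule: linorder_cases)
  case less
  then have "x * y \<le> y * y" by (intro mult_right_mono) auto
  then show ?thesis by (simp add: power2_eq_square add_increasing)
next
  case greater
  then have "x * y \<le> x * x" by (intro mult_left_mono) auto
  then show ?thesis by (simp add: power2_eq_square add_increasing2)
qed (simp add: power2_eq_square)

lemma speed_integral_finite:
  assumes \<gamma>: "\<gamma> \<in> mspace curve_metric" and "(\<integral>\<^sup>+t\<in>{0..1}. (metric_speed \<gamma> t)\<^sup>2 \<partial>lborel) < \<infinity>"
  shows "(\<integral>\<^sup>+t\<in>{0..1}. metric_speed \<gamma> t \<partial>lborel) < \<infinity>"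
proof -
  have m: "(\<lambda>t. (metric_speed \<gamma> t * indicator {0..1} t)\<^sup>2) \<in> borel_measurable lborel"
    using measurable_curve_speed[OF \<gamma>] by measurable
  have "(\<integral>\<^sup>+t\<in>{0..1}. metric_speed \<gamma> t \<partial>lborel) \<le>
      (\<integral>\<^sup>+t. indicator {0..1} t + (metric_speed \<gamma> t * indicator {0..1} t)\<^sup>2 \<partial>lborel)"
    by (intro nn_integral_mono)
      (use ennreal_mult_le_squares[of 1] in \<open>auto split: split_indicator\<close>)
  also have "\<dots> = 1 + (\<integral>\<^sup>+t. (metric_speed \<gamma> t * indicator {0..1} t)\<^sup>2 \<partial>lborel)"
    using m by (subst nn_integral_add) auto
  also have "(\<integral>\<^sup>+t. (metric_speed \<gamma> t * indicator {0..1} t)\<^sup>2 \<partial>lborel)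
      = (\<integral>\<^sup>+t\<in>{0..1}. (metric_speed \<gamma> t)\<^sup>2 \<partial>lborel)"
    by (intro nn_integral_cong) (auto split: split_indicator)
  also have "1 + \<dots> < \<infinity>" using assms(2) by simp
  finally show ?thesis .
qed

text \<open>Continuity carries the bound from rational times to all times.\<close>

lemma finite_energy_curves_dist:
  assumes \<gamma>: "\<gamma> \<in> finite_energy_curves" and st: "0 \<le> s" "s \<le> t" "t \<le> 1"
  shows "ennreal (dist (\<gamma> s) (\<gamma> t)) \<le> speed_integral (\<lambda>_. 1) \<gamma> s t"
proof (cases "s = t")
  case False
  then have lt: "s < t" using st by simp
  \<comment> \<open>The rational times approach s and t from inside [s, t], so their speed integrals
    stay below the one over [s, t]. The bound (t - s) / 3 guarantees that the two approximations do
    not cross.\<close>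
  define d where "d i = min ((t - s) / 3) (inverse (real (Suc i)))" for i
  have d1: "d i > 0" for i using lt by (simp add: d_def)
  have d2: "d i \<le> (t - s) / 3" for i unfolding d_def by (rule min.cobounded1)
  have d3: "d i \<le> inverse (real (Suc i))" for i unfolding d_def by (rule min.cobounded2)
  note d = d1 d2 d3
  have "\<exists>p\<in>\<rat>. s < p \<and> p < s + d i" "\<exists>q\<in>\<rat>. t - d i < q \<and> q < t" for i
    using d(1)[of i] by (auto intro: Rats_dense_in_real)
  then obtain p q where p: "\<And>i. p i \<in> \<rat>" "\<And>i. s < p i" "\<And>i. p i < s + d i"
    and q: "\<And>i. q i \<in> \<rat>" "\<And>i. q i < t" "\<And>i. t - d i < q i" by metis
  have pq: "p i < q i" "\<bar>p i - s\<bar> \<le> inverse (real (Suc i))" "\<bar>q i - t\<bar> \<le> inverse (real (Suc i))" for i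
    using p(2,3)[of i] q(2,3)[of i] d[of i] by auto
  have lim: "p \<longlonglongrightarrow> s" "q \<longlonglongrightarrow> t"
    by (rule LIM_zero_cancel, rule Lim_null_comparison[OF _ LIMSEQ_inverse_real_of_nat],
        use pq in \<open>auto intro!: always_eventually\<close>)+
  have cont: "continuous_on {0..1} \<gamma>"
    using \<gamma> by (auto simp: finite_energy_curves_def mspace_curve_metric)
  have r01: "p i \<in> {0..1}" "q i \<in> {0..1}" for i
    using st p(2)[of i] q(2)[of i] pq(1)[of i] by auto
  have "(\<lambda>i. \<gamma> (p i)) \<longlonglongrightarrow> \<gamma> s" "(\<lambda>i. \<gamma> (q i)) \<longlonglongrightarrow> \<gamma> t"
    using st r01 by (auto intro!: continuous_on_tendsto_compose[OF cont] lim always_eventually)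
  then have lim_dist: "(\<lambda>i. ennreal (dist (\<gamma> (p i)) (\<gamma> (q i)))) \<longlonglongrightarrow> ennreal (dist (\<gamma> s) (\<gamma> t))"
    by (intro tendsto_intros)
  have "ennreal (dist (\<gamma> (p i)) (\<gamma> (q i))) \<le> speed_integral (\<lambda>_. 1) \<gamma> s t" for i
  proof -
    have "ennreal (dist (\<gamma> (p i)) (\<gamma> (q i))) \<le> speed_integral (\<lambda>_. 1) \<gamma> (p i) (q i)"
      using \<gamma> p(1) q(1) r01 pq(1)[of i] unfolding finite_energy_curves_def by auto
    also have "\<dots> \<le> speed_integral (\<lambda>_. 1) \<gamma> s t"
      unfolding speed_integral_def using p(2)[of i] q(2)[of i]
      by (intro nn_integral_mono) (auto split: split_indicator)
    finally show ?thesis .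
  qed
  then show ?thesis by (intro Lim_bounded[OF lim_dist, of 0]) blast
qed simp

text \<open>The metric speed is itself the integrable majorant that absolute continuity asks for;
  \<open>enn2real\<close> alters it only on the null set where it is infinite.\<close>

lemma finite_energy_curves_abs_cont:
  assumes \<gamma>: "\<gamma> \<in> finite_energy_curves"
  shows "abs_cont_curve \<gamma>"
proof -
  have ms: "\<gamma> \<in> mspace curve_metric" using \<gamma> by (auto simp: finite_energy_curves_def)
  have fin: "(\<integral>\<^sup>+t\<in>{0..1}. metric_speed \<gamma> t \<partial>lborel) < \<infinity>"
    using \<gamma> by (intro speed_integral_finite) (auto simp: finite_energy_curves_def)
  define v where "v t = metric_speed \<gamma> t * indicator {0..1} t" for t
  have [measurable]: "v \<in> borel_measurable borel"
    unfolding v_def using ms by (rule measurable_curve_speed)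
  define g where "g t = enn2real (v t)" for t
  have [measurable]: "g \<in> borel_measurable borel" unfolding g_def by measurable
  have vfin: "(\<integral>\<^sup>+t. v t \<partial>lborel) < \<infinity>" using fin by (simp add: v_def)
  have ae: "AE t in lborel. ennreal (g t) = v t"
  proof -
    have "AE t in lborel. v t \<noteq> \<infinity>"
      by (rule nn_integral_noteq_infinite) (use vfin in auto)
    then show ?thesis by eventually_elim (simp add: g_def less_top)
  qed
  have gi: "integrable lborel g"
  proof (rule integrableI_bounded)
    have "(\<integral>\<^sup>+t. ennreal (norm (g t)) \<partial>lborel) = (\<integral>\<^sup>+t. v t \<partial>lborel)"
      using ae by (intro nn_integral_cong_AE) (auto simp: g_def)
    then show "(\<integral>\<^sup>+t. ennreal (norm (g t)) \<partial>lborel) < \<infinity>" using vfin by simp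
  qed measurable
  show ?thesis
    unfolding abs_cont_curve_def
  proof (intro exI[of _ g] conjI allI impI)
    show "set_integrable lborel {0..1} g"
      unfolding set_integrable_def using gi by (rule integrable_mult_indicator[rotated]) auto
    fix s t :: real assume st: "0 \<le> s" "s \<le> t" "t \<le> 1"
    have "integrable lborel (\<lambda>r. indicator {s..t} r *\<^sub>R g r)"
      using gi by (rule integrable_mult_indicator[rotated]) auto
    then have eq: "(\<integral>\<^sup>+r. ennreal (indicator {s..t} r *\<^sub>R g r) \<partial>lborel) = ennreal (LINT r:{s..t}|lborel. g r)"
      unfolding set_lebesgue_integral_def by (rule nn_integral_eq_integral) (simp add: g_def)
    have "ennreal (dist (\<gamma> s) (\<gamma> t)) \<le> speed_integral (\<lambda>_. 1) \<gamma> s t"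
      using \<gamma> st by (rule finite_energy_curves_dist)
    also have "\<dots> = (\<integral>\<^sup>+r. v r * indicator {s..t} r \<partial>lborel)"
      unfolding speed_integral_def using st
      by (intro nn_integral_cong) (auto simp: v_def split: split_indicator)
    also have "\<dots> = (\<integral>\<^sup>+r. ennreal (indicator {s..t} r *\<^sub>R g r) \<partial>lborel)"
      using ae by (intro nn_integral_cong_AE) (auto split: split_indicator)
    finally have "ennreal (dist (\<gamma> s) (\<gamma> t)) \<le> ennreal (LINT r:{s..t}|lborel. g r)"
      unfolding eq .
    moreover have "0 \<le> (LINT r:{s..t}|lborel. g r)"
      unfolding set_lebesgue_integral_def
      by (rule Bochner_Integration.integral_nonneg) (simp add: g_def)
    ultimately show "dist (\<gamma> s) (\<gamma> t) \<le> (LINT r:{s..t}|lborel. g r)" by simp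
  qed
qed

lemma abs_cont_finite_energy_curves:
  assumes "\<gamma> \<in> mspace curve_metric" "abs_cont_curve \<gamma>"
    and "(\<integral>\<^sup>+t\<in>{0..1}. (metric_speed \<gamma> t)\<^sup>2 \<partial>lborel) < \<infinity>"
  shows "\<gamma> \<in> finite_energy_curves"
  using assms abs_cont_curve_dist_le_speed[OF assms(1,2) speed_integral_finite[OF assms(1,3)]]
  by (auto simp: finite_energy_curves_def speed_integral_def)

section \<open>Speed and energy of curves stopped outside a time interval\<close>

lemma metric_speed_freeze_inside:
  assumes "0 \<le> s" "s < r" "r < t" "t \<le> 1"
  shows "metric_speed (freeze s t \<gamma>) r = metric_speed \<gamma> r"
  unfolding metric_speed_def
proof (rule Limsup_eq)
  have "\<forall>\<^sub>F q in at r within {0..1}. q \<in> {s<..<t}"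
    by (rule topological_tendstoD[OF tendsto_ident_at]) (use assms in auto)
  then show "\<forall>\<^sub>F q in at r within {0..1}. ennreal (dist (freeze s t \<gamma> q) (freeze s t \<gamma> r) / \<bar>q - r\<bar>)
      = ennreal (dist (\<gamma> q) (\<gamma> r) / \<bar>q - r\<bar>)"
    by eventually_elim (use assms in \<open>auto simp: freeze_def\<close>)
qed

lemma metric_speed_freeze_outside:
  assumes "r \<in> {0..1}" "r < s \<or> t < r" "s \<le> t"
  shows "metric_speed (freeze s t \<gamma>) r = 0"
proof -
  have "\<forall>\<^sub>F q in at r within {0..1}. q \<in> - {s..t}"
    by (rule topological_tendstoD[OF tendsto_ident_at]) (use assms in auto)
  moreover have "\<forall>\<^sub>F q in at r within {0..1}. (q < s \<longleftrightarrow> r < s) \<and> q \<in> {0..1}"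
  proof (cases "r < s")
    case True
    have "\<forall>\<^sub>F q in at r within {0..1}. q \<in> {..<s}"
      by (rule topological_tendstoD[OF tendsto_ident_at]) (use True in auto)
    moreover have "\<forall>\<^sub>F q in at r within {0..1}. q \<in> {0..1}"
      by (auto simp: eventually_at_filter)
    ultimately show ?thesis by eventually_elim (use True in auto)
  next
    case False
    have "\<forall>\<^sub>F q in at r within {0..1}. q \<in> {t<..}"
      by (rule topological_tendstoD[OF tendsto_ident_at]) (use False assms in auto)
    moreover have "\<forall>\<^sub>F q in at r within {0..1}. q \<in> {0..1}"
      by (auto simp: eventually_at_filter)
    ultimately show ?thesis by eventually_elim (use False assms in auto)
  qed
  ultimately have "\<forall>\<^sub>F q in at r within {0..1}.
      ennreal (dist (freeze s t \<gamma> q) (freeze s t \<gamma> r) / \<bar>q - r\<bar>) \<le> 0"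
    by eventually_elim (use assms in \<open>auto simp: freeze_def max_def min_def\<close>)
  then have "metric_speed (freeze s t \<gamma>) r \<le> 0"
    unfolding metric_speed_def by (rule Limsup_bounded)
  then show ?thesis by simp
qed

lemma AE_metric_speed_freeze:
  assumes "0 \<le> s" "s \<le> t" "t \<le> 1"
  shows "AE r in lborel. r \<in> {0..1} \<longrightarrow>
    metric_speed (freeze s t \<gamma>) r = metric_speed \<gamma> r * indicator {s..t} r"
  using AE_lborel_singleton[of s] AE_lborel_singleton[of t]
proof eventually_elim
  case (elim r)
  then show ?case
    using assms metric_speed_freeze_inside[of s r t \<gamma>] metric_speed_freeze_outside[of r s t \<gamma>]
    by (cases "s < r \<and> r < t") (auto split: split_indicator)
qed

lemma speed_integral_freeze:
  assumes "0 \<le> s" "s \<le> t" "t \<le> 1"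
  shows "speed_integral H (freeze s t \<gamma>) 0 1 = speed_integral H \<gamma> s t"
  unfolding speed_integral_def
proof (rule nn_integral_cong_AE, use AE_metric_speed_freeze[OF assms, of \<gamma>] in eventually_elim)
  case (elim r)
  then show ?case using assms by (auto simp: freeze_def split: split_indicator)
qed

lemma freeze_finite_energy_curves:
  assumes \<gamma>: "\<gamma> \<in> finite_energy_curves" and st: "0 \<le> s" "s \<le> t" "t \<le> 1"
  shows "freeze s t \<gamma> \<in> finite_energy_curves"
proof -
  have "(\<integral>\<^sup>+r\<in>{0..1}. (metric_speed (freeze s t \<gamma>) r)\<^sup>2 \<partial>lborel)
      \<le> (\<integral>\<^sup>+r\<in>{0..1}. (metric_speed \<gamma> r)\<^sup>2 \<partial>lborel)"
    by (rule nn_integral_mono_AE, use AE_metric_speed_freeze[OF st, of \<gamma>] in eventually_elim)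
      (auto split: split_indicator)
  also have "\<dots> < \<infinity>" using \<gamma> by (simp add: finite_energy_curves_def)
  finally have fin: "(\<integral>\<^sup>+r\<in>{0..1}. (metric_speed (freeze s t \<gamma>) r)\<^sup>2 \<partial>lborel) < \<infinity>" .
  have "ennreal (dist (freeze s t \<gamma> a) (freeze s t \<gamma> b)) \<le> speed_integral (\<lambda>_. 1) (freeze s t \<gamma>) a b"
    if ab: "a \<in> {0..1}" "b \<in> {0..1}" "a \<le> b" for a b
  proof -
    define c d where "c = max s (min t a)" and "d = max s (min t b)"
    have cd: "freeze s t \<gamma> a = \<gamma> c" "freeze s t \<gamma> b = \<gamma> d" "0 \<le> c" "c \<le> d" "d \<le> 1"
      using ab st by (auto simp: freeze_def c_def d_def)
    show ?thesis
    proof (cases "c = d")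
      case False
      \<comment> \<open>If the clamped times differ, then a cannot lie beyond t nor b before s, so
        clamping can only move a to the right and b to the left.\<close>
      then have "a \<le> c" "d \<le> b" "s \<le> c" "d \<le> t"
        using ab st by (auto simp: c_def d_def max_def min_def split: if_splits)
      then have sub: "r \<in> {a..b} \<and> r \<in> {s..t} \<and> r \<in> {0..1}" if "r \<in> {c..d}" for r
        using that st by auto
      have "ennreal (dist (freeze s t \<gamma> a) (freeze s t \<gamma> b)) \<le> speed_integral (\<lambda>_. 1) \<gamma> c d"
        using finite_energy_curves_dist[OF \<gamma>, of c d] cd by simp
      also have "\<dots> \<le> speed_integral (\<lambda>_. 1) (freeze s t \<gamma>) a b"
        unfolding speed_integral_def
      proof (rule nn_integral_mono_AE, use AE_metric_speed_freeze[OF st, of \<gamma>] in eventually_elim)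
        case (elim r)
        then show ?case using sub[of r] by (cases "r \<in> {c..d}") simp_all
      qed
      finally show ?thesis .
    qed (simp add: cd)
  qed
  then show ?thesis
    using fin \<gamma> freeze_in_mspace[OF st, of \<gamma>] by (auto simp: finite_energy_curves_def)
qed

section \<open>Test plans and weak upper gradients\<close>

lemma test_plan_space:
  assumes "test_plan m \<pi>"
  shows "sets \<pi> = sets curve_borel" "space \<pi> = mspace curve_metric" "prob_space \<pi>"
  using assms sets_eq_imp_space_eq[of \<pi> curve_borel] by (auto simp: test_plan_def space_curve_borel)

lemma test_plan_measurable:
  assumes "test_plan m \<pi>"
  shows "measurable \<pi> N = measurable curve_borel N" "measurable (\<pi> \<Otimes>\<^sub>M K) N = measurable (curve_borel \<Otimes>\<^sub>M K) N"
  by (auto intro!: measurable_cong_sets sets_pair_measure_cong simp: test_plan_space(1)[OF assms])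

lemma test_plan_AE_finite_energy:
  assumes "test_plan m \<pi>"
  shows "AE \<gamma> in \<pi>. \<gamma> \<in> finite_energy_curves"
proof -
  have "AE \<gamma> in \<pi>. (\<integral>\<^sup>+t\<in>{0..1}. (metric_speed \<gamma> t)\<^sup>2 \<partial>lborel) \<noteq> \<infinity>"
    using assms measurable_speed_square_integral
    by (intro nn_integral_noteq_infinite) (auto simp: test_plan_def test_plan_measurable[OF assms])
  moreover have "AE \<gamma> in \<pi>. abs_cont_curve \<gamma>" using assms by (simp add: test_plan_def)
  ultimately show ?thesis
    using AE_space
    by eventually_elim
      (auto simp: test_plan_space[OF assms] less_top intro!: abs_cont_finite_energy_curves)
qed

lemma test_planI:
  assumes "prob_space \<pi>" "sets \<pi> = sets curve_borel" "AE \<gamma> in \<pi>. \<gamma> \<in> finite_energy_curves"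
    and "\<And>t A. t \<in> {0..1} \<Longrightarrow> A \<in> sets borel \<Longrightarrow>
      emeasure \<pi> ((\<lambda>\<gamma>. \<gamma> t) -` A \<inter> space \<pi>) \<le> ennreal C * emeasure m A"
    and "(\<integral>\<^sup>+\<gamma>. (\<integral>\<^sup>+t\<in>{0..1}. (metric_speed \<gamma> t)\<^sup>2 \<partial>lborel) \<partial>\<pi>) < \<infinity>"
  shows "test_plan m \<pi>"
proof -
  have "emeasure (distr \<pi> borel (\<lambda>\<gamma>. \<gamma> t)) A \<le> ennreal C * emeasure m A"
    if "t \<in> {0..1}" "A \<in> sets borel" for t A
    using assms(4)[OF that] measurable_curve_eval[OF that(1)] that(2)
    by (subst emeasure_distr) (auto simp: measurable_cong_sets[OF assms(2) refl])
  moreover have "AE \<gamma> in \<pi>. abs_cont_curve \<gamma>"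
    using assms(3) by eventually_elim (rule finite_energy_curves_abs_cont)
  ultimately show ?thesis using assms unfolding test_plan_def by blast
qed

text \<open>The compression constant in the definition may be negative, which \<open>ennreal\<close>
  truncates to 0; taking \<open>max 0 C\<close> makes real arithmetic with it sound later.\<close>

lemma test_plan_compression:
  assumes "test_plan m \<pi>"
  obtains C where "0 \<le> C" "\<And>t A. t \<in> {0..1} \<Longrightarrow> A \<in> sets borel \<Longrightarrow>
      emeasure \<pi> ((\<lambda>\<gamma>. \<gamma> t) -` A \<inter> space \<pi>) \<le> ennreal C * emeasure m A"
proof -
  obtain C where C: "\<And>t A. t \<in> {0..1} \<Longrightarrow> A \<in> sets borel \<Longrightarrow>
      emeasure (distr \<pi> borel (\<lambda>\<gamma>. \<gamma> t)) A \<le> ennreal C * emeasure m A"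
    using assms unfolding test_plan_def by blast
  have "emeasure \<pi> ((\<lambda>\<gamma>. \<gamma> t) -` A \<inter> space \<pi>) \<le> ennreal (max 0 C) * emeasure m A"
    if "t \<in> {0..1}" "A \<in> sets borel" for t A
  proof -
    have "emeasure \<pi> ((\<lambda>\<gamma>. \<gamma> t) -` A \<inter> space \<pi>) = emeasure (distr \<pi> borel (\<lambda>\<gamma>. \<gamma> t)) A"
      using measurable_curve_eval[OF that(1)] that(2)
      by (subst emeasure_distr) (auto simp: test_plan_measurable[OF assms])
    also have "\<dots> \<le> ennreal C * emeasure m A" using that by (rule C)
    also have "ennreal C = ennreal (max 0 C)" by (cases "0 \<le> C") (auto simp: ennreal_neg)
    finally show ?thesis .
  qed
  then show thesis by (intro that[of "max 0 C"]) auto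
qed

text \<open>Conditioning on B divides the compression constant and the kinetic energy by the
  probability of B. This allows an integrated inequality to be tested on an arbitrary non-null set
  of curves.\<close>

lemma test_plan_uniform_measure:
  assumes \<pi>: "test_plan m \<pi>" and B: "B \<in> sets \<pi>" and B0: "emeasure \<pi> B \<noteq> 0"
  shows "test_plan m (uniform_measure \<pi> B)"
proof -
  interpret prob_space \<pi> using \<pi> by (rule test_plan_space)
  obtain C where C: "0 \<le> C" "\<And>t A. t \<in> {0..1} \<Longrightarrow> A \<in> sets borel \<Longrightarrow>
      emeasure \<pi> ((\<lambda>\<gamma>. \<gamma> t) -` A \<inter> space \<pi>) \<le> ennreal C * emeasure m A"
    using test_plan_compression[OF \<pi>] by blast
  define p where "p = measure \<pi> B"
  have p: "emeasure \<pi> B = ennreal p" "p > 0"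
    using B0 by (auto simp: p_def emeasure_eq_measure zero_less_measure_iff)
  show ?thesis
  proof (rule test_planI[where C = "C / p"])
    show "prob_space (uniform_measure \<pi> B)" using B0 by (intro prob_space_uniform_measure) auto
    show "sets (uniform_measure \<pi> B) = sets curve_borel" using test_plan_space[OF \<pi>] by simp
    show "AE \<gamma> in uniform_measure \<pi> B. \<gamma> \<in> finite_energy_curves"
      using test_plan_AE_finite_energy[OF \<pi>] B by (intro AE_uniform_measureI) auto
    fix t :: real and A :: "'a set" assume t: "t \<in> {0..1}" and A: "A \<in> sets borel"
    have m: "(\<lambda>\<gamma>. \<gamma> t) -` A \<inter> space \<pi> \<in> sets \<pi>"
      using measurable_curve_eval[OF t] A
      by (intro measurable_sets[of _ \<pi> borel]) (auto simp: test_plan_measurable[OF \<pi>])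
    have "emeasure (uniform_measure \<pi> B) ((\<lambda>\<gamma>. \<gamma> t) -` A \<inter> space (uniform_measure \<pi> B))
        = emeasure \<pi> (B \<inter> ((\<lambda>\<gamma>. \<gamma> t) -` A \<inter> space \<pi>)) / ennreal p"
      using B m by (simp add: p)
    also have "\<dots> \<le> (ennreal C * emeasure m A) / ennreal p"
      using m by (intro divide_right_mono_ennreal order_trans[OF emeasure_mono C(2)[OF t A]]) auto
    also have "\<dots> = ennreal (C / p) * emeasure m A"
      using C(1) p(2) by (simp add: divide_ennreal[symmetric] ennreal_times_divide mult.commute)
    finally show "emeasure (uniform_measure \<pi> B) ((\<lambda>\<gamma>. \<gamma> t) -` A \<inter> space (uniform_measure \<pi> B))
        \<le> ennreal (C / p) * emeasure m A" .
  next
    have [measurable]: "(\<lambda>\<gamma>. \<integral>\<^sup>+t\<in>{0..1}. (metric_speed \<gamma> t)\<^sup>2 \<partial>lborel) \<in> borel_measurable \<pi>"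
      using measurable_speed_square_integral by (simp add: test_plan_measurable[OF \<pi>])
    let ?E = "\<integral>\<^sup>+\<gamma>. (\<integral>\<^sup>+t\<in>{0..1}. (metric_speed \<gamma> t)\<^sup>2 \<partial>lborel) * indicator B \<gamma> \<partial>\<pi>"
    have "?E \<le> (\<integral>\<^sup>+\<gamma>. (\<integral>\<^sup>+t\<in>{0..1}. (metric_speed \<gamma> t)\<^sup>2 \<partial>lborel) \<partial>\<pi>)"
      by (intro nn_integral_mono) (auto split: split_indicator)
    also have "\<dots> < \<infinity>" using \<pi> by (simp add: test_plan_def)
    finally have "?E / ennreal p < \<infinity>"
      using p(2) by (simp add: less_top[symmetric] ennreal_divide_eq_top_iff)
    then show "(\<integral>\<^sup>+\<gamma>. (\<integral>\<^sup>+t\<in>{0..1}. (metric_speed \<gamma> t)\<^sup>2 \<partial>lborel) \<partial>uniform_measure \<pi> B) < \<infinity>"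
      using B by (subst nn_integral_uniform_measure) (auto simp: p)
  qed
qed

lemma test_plan_freeze:
  assumes \<pi>: "test_plan m \<pi>" and st: "0 \<le> s" "s \<le> t" "t \<le> 1"
  shows "test_plan m (distr \<pi> curve_borel (freeze s t))"
proof -
  interpret prob_space \<pi> using \<pi> by (rule test_plan_space)
  obtain C where C: "0 \<le> C" "\<And>t A. t \<in> {0..1} \<Longrightarrow> A \<in> sets borel \<Longrightarrow>
      emeasure \<pi> ((\<lambda>\<gamma>. \<gamma> t) -` A \<inter> space \<pi>) \<le> ennreal C * emeasure m A"
    using test_plan_compression[OF \<pi>] by blast
  have fm [measurable]: "freeze s t \<in> \<pi> \<rightarrow>\<^sub>M curve_borel"
    using measurable_freeze[OF st] by (simp add: test_plan_measurable[OF \<pi>])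
  show ?thesis
  proof (rule test_planI[where C = C])
    show "prob_space (distr \<pi> curve_borel (freeze s t))" by (rule prob_space_distr) simp
    have "{\<gamma> \<in> space (curve_borel :: (real \<Rightarrow> 'a) measure). \<gamma> \<in> finite_energy_curves} = finite_energy_curves"
      by (auto simp: space_curve_borel finite_energy_curves_def)
    then have "{\<gamma> \<in> space curve_borel. \<gamma> \<in> finite_energy_curves} \<in> sets (curve_borel :: (real \<Rightarrow> 'a) measure)"
      using sets_finite_energy_curves by simp
    then show "AE \<gamma> in distr \<pi> curve_borel (freeze s t). \<gamma> \<in> finite_energy_curves"
      using test_plan_AE_finite_energy[OF \<pi>] freeze_finite_energy_curves[OF _ st]
      by (subst AE_distr_iff) auto
    fix r :: real and A :: "'a set" assume r: "r \<in> {0..1}" and A: "A \<in> sets borel"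
    have "(\<lambda>\<gamma>. \<gamma> r) -` A \<inter> space curve_borel \<in> sets (curve_borel :: (real \<Rightarrow> 'a) measure)"
      by (rule measurable_sets[OF measurable_curve_eval[OF r] A])
    then have "emeasure (distr \<pi> curve_borel (freeze s t)) ((\<lambda>\<gamma>. \<gamma> r) -` A \<inter> space (distr \<pi> curve_borel (freeze s t)))
      = emeasure \<pi> (freeze s t -` ((\<lambda>\<gamma>. \<gamma> r) -` A \<inter> space curve_borel) \<inter> space \<pi>)"
      by (subst space_distr, subst emeasure_distr) auto
    also have "freeze s t -` ((\<lambda>\<gamma>. \<gamma> r) -` A \<inter> space curve_borel) \<inter> space \<pi>
      = (\<lambda>\<gamma>. \<gamma> (max s (min t r))) -` A \<inter> space \<pi>"
      using measurable_space[OF fm] r by (auto simp: freeze_def)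
    also have "emeasure \<pi> \<dots> \<le> ennreal C * emeasure m A"
      using st r A by (intro C) auto
    finally show "emeasure (distr \<pi> curve_borel (freeze s t)) ((\<lambda>\<gamma>. \<gamma> r) -` A \<inter> space (distr \<pi> curve_borel (freeze s t)))
      \<le> ennreal C * emeasure m A" .
  next
    have "(\<integral>\<^sup>+\<gamma>. (\<integral>\<^sup>+t\<in>{0..1}. (metric_speed \<gamma> t)\<^sup>2 \<partial>lborel) \<partial>distr \<pi> curve_borel (freeze s t))
      = (\<integral>\<^sup>+\<gamma>. (\<integral>\<^sup>+r\<in>{0..1}. (metric_speed (freeze s t \<gamma>) r)\<^sup>2 \<partial>lborel) \<partial>\<pi>)"
      using measurable_speed_square_integral by (intro nn_integral_distr) auto
    also have "\<dots> \<le> (\<integral>\<^sup>+\<gamma>. (\<integral>\<^sup>+t\<in>{0..1}. (metric_speed \<gamma> t)\<^sup>2 \<partial>lborel) \<partial>\<pi>)"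
    proof (rule nn_integral_mono, rule nn_integral_mono_AE)
      fix \<gamma> :: "real \<Rightarrow> 'a"
      show "AE r in lborel. (metric_speed (freeze s t \<gamma>) r)\<^sup>2 * indicator {0..1} r
          \<le> (metric_speed \<gamma> r)\<^sup>2 * indicator {0..1} r"
        using AE_metric_speed_freeze[OF st, of \<gamma>] by eventually_elim (auto split: split_indicator)
    qed
    also have "\<dots> < \<infinity>" using \<pi> by (simp add: test_plan_def)
    finally show "(\<integral>\<^sup>+\<gamma>. (\<integral>\<^sup>+t\<in>{0..1}. (metric_speed \<gamma> t)\<^sup>2 \<partial>lborel) \<partial>distr \<pi> curve_borel (freeze s t)) < \<infinity>" .
  qed simp
qed

lemma curve_time_integral_clamp:
  "(\<lambda>\<gamma>. \<integral>\<^sup>+t\<in>{0..1::real}. H (\<gamma> t) \<partial>lborel) = (\<lambda>\<gamma>. \<integral>\<^sup>+t. H (\<gamma> (max 0 (min 1 t))) * indicator {0..1} t \<partial>lborel)"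
  by (intro ext nn_integral_cong) (auto split: split_indicator)

text \<open>By Fubini the times can be treated one by one, and at a fixed time compression bounds
  the mean of H by C times its integral over X.\<close>

lemma test_plan_occupation:
  assumes \<pi>: "test_plan m \<pi>" and m: "sets m = sets borel" and H: "H \<in> borel_measurable borel"
    and fin: "(\<integral>\<^sup>+x. H x \<partial>m) < \<infinity>"
  shows "(\<integral>\<^sup>+\<gamma>. (\<integral>\<^sup>+t\<in>{0..1}. H (\<gamma> t) \<partial>lborel) \<partial>\<pi>) < \<infinity>"
proof -
  interpret prob_space \<pi> using \<pi> by (rule test_plan_space)
  interpret pair_sigma_finite \<pi> lborel ..
  obtain C where C: "0 \<le> C" "\<And>t A. t \<in> {0..1} \<Longrightarrow> A \<in> sets borel \<Longrightarrow>
      emeasure \<pi> ((\<lambda>\<gamma>. \<gamma> t) -` A \<inter> space \<pi>) \<le> ennreal C * emeasure m A"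
    using test_plan_compression[OF \<pi>] by blast
  have e: "(\<integral>\<^sup>+\<gamma>. H (\<gamma> t) \<partial>\<pi>) \<le> ennreal C * (\<integral>\<^sup>+x. H x \<partial>m)" if t: "t \<in> {0..1}" for t
  proof -
    have em: "(\<lambda>\<gamma>. \<gamma> t) \<in> \<pi> \<rightarrow>\<^sub>M borel"
      using measurable_curve_eval[OF t] by (simp add: test_plan_measurable[OF \<pi>])
    have "distr \<pi> borel (\<lambda>\<gamma>. \<gamma> t) \<le> scale_measure (ennreal C) m"
      using C(2)[OF t] em m by (subst le_measure) (auto simp: emeasure_distr)
    then have "(\<integral>\<^sup>+x. H x \<partial>distr \<pi> borel (\<lambda>\<gamma>. \<gamma> t)) \<le> (\<integral>\<^sup>+x. H x \<partial>scale_measure (ennreal C) m)"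
      using m by (intro nn_integral_mono_measure) auto
    then show ?thesis
      using em H m by (simp add: nn_integral_distr nn_integral_scale_measure cong: measurable_cong_sets)
  qed
  have "(\<lambda>(\<gamma>, t). H (\<gamma> (max 0 (min 1 t))) * indicator {0..1} t) \<in> borel_measurable (curve_borel \<Otimes>\<^sub>M borel)"
    using measurable_compose[OF measurable_curve_eval_pair H] by (simp add: case_prod_beta')
  then have "(\<lambda>(\<gamma>, t). H (\<gamma> (max 0 (min 1 t))) * indicator {0..1} t) \<in> borel_measurable (\<pi> \<Otimes>\<^sub>M lborel)"
    by (simp add: test_plan_measurable[OF \<pi>] cong: measurable_cong_sets)
  from Fubini[OF this]
  have "(\<integral>\<^sup>+\<gamma>. (\<integral>\<^sup>+t\<in>{0..1}. H (\<gamma> t) \<partial>lborel) \<partial>\<pi>)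
      = (\<integral>\<^sup>+t. (\<integral>\<^sup>+\<gamma>. H (\<gamma> (max 0 (min 1 t))) * indicator {0..1} t \<partial>\<pi>) \<partial>lborel)"
    unfolding curve_time_integral_clamp[of H] by simp
  also have "\<dots> \<le> (\<integral>\<^sup>+t. ennreal C * (\<integral>\<^sup>+x. H x \<partial>m) * indicator {0..1::real} t \<partial>lborel)"
    by (intro nn_integral_mono) (use e in \<open>auto split: split_indicator\<close>)
  also have "\<dots> < \<infinity>"
    using fin by (simp add: nn_integral_cmult_indicator ennreal_mult_less_top)
  finally show ?thesis .
qed

section \<open>Weak upper gradients along almost every curve\<close>

lemma weak_upper_gradient_iff:
  "weak_upper_gradient m f G \<longleftrightarrow> G \<in> L2_fun m \<and> (AE x in m. 0 \<le> G x) \<and>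
     (\<forall>\<pi>. test_plan m \<pi> \<longrightarrow> (\<integral>\<^sup>+\<gamma>. ennreal \<bar>f (\<gamma> 1) - f (\<gamma> 0)\<bar> \<partial>\<pi>)
        \<le> (\<integral>\<^sup>+\<gamma>. speed_integral (\<lambda>x. ennreal (G x)) \<gamma> 0 1 \<partial>\<pi>))"
  unfolding weak_upper_gradient_def speed_integral_def ..

lemma L2_fun_borel:
  assumes "sets m = sets borel" "f \<in> L2_fun m"
  shows "f \<in> borel_measurable borel"
  using assms by (auto simp: L2_fun_def cong: measurable_cong_sets)

text \<open>The product of G and the speed is at most the sum of their squares: the square of G is
  integrable along the plan by compression, the square of the speed by the definition of a test
  plan.\<close>

lemma L2_fun_speed_integral_finite:
  assumes \<pi>: "test_plan m \<pi>" and m: "sets m = sets borel" and G: "G \<in> L2_fun m"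
  shows "(\<integral>\<^sup>+\<gamma>. speed_integral (\<lambda>x. ennreal (G x)) \<gamma> 0 1 \<partial>\<pi>) < \<infinity>"
proof -
  have [measurable]: "G \<in> borel_measurable borel" by (rule L2_fun_borel[OF m G])
  let ?A = "\<lambda>\<gamma>. \<integral>\<^sup>+t\<in>{0..1}. ennreal ((G (\<gamma> t))\<^sup>2) \<partial>lborel"
  let ?B = "\<lambda>\<gamma>. \<integral>\<^sup>+t\<in>{0..1}. (metric_speed \<gamma> t)\<^sup>2 \<partial>lborel"
  have A: "?A \<in> borel_measurable \<pi>"
  proof -
    have "(\<lambda>(\<gamma>, t). ennreal ((G (\<gamma> (max 0 (min 1 t))))\<^sup>2) * indicator {0..1} t) \<in> borel_measurable (curve_borel \<Otimes>\<^sub>M borel)"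
      using measurable_compose[OF measurable_curve_eval_pair, of "\<lambda>x. ennreal ((G x)\<^sup>2)"]
      by (simp add: case_prod_beta')
    then have "(\<lambda>(\<gamma>, t). ennreal ((G (\<gamma> (max 0 (min 1 t))))\<^sup>2) * indicator {0..1} t) \<in> borel_measurable (\<pi> \<Otimes>\<^sub>M lborel)"
      by (simp add: test_plan_measurable[OF \<pi>] cong: measurable_cong_sets)
    from lborel.borel_measurable_nn_integral_fst[OF this]
    show ?thesis unfolding curve_time_integral_clamp[of "\<lambda>x. ennreal ((G x)\<^sup>2)"] by simp
  qed
  have B: "?B \<in> borel_measurable \<pi>"
    using measurable_speed_square_integral by (simp add: test_plan_measurable[OF \<pi>])
  have "(\<integral>\<^sup>+\<gamma>. speed_integral (\<lambda>x. ennreal (G x)) \<gamma> 0 1 \<partial>\<pi>) \<le> (\<integral>\<^sup>+\<gamma>. ?A \<gamma> + ?B \<gamma> \<partial>\<pi>)"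
  proof (rule nn_integral_mono)
    fix \<gamma> assume "\<gamma> \<in> space \<pi>"
    then have ms: "\<gamma> \<in> mspace curve_metric" by (simp add: test_plan_space[OF \<pi>])
    have m1: "(\<lambda>t. ennreal ((G (\<gamma> t))\<^sup>2) * indicator {0..1} t) \<in> borel_measurable lborel"
    proof -
      have "(\<lambda>t. \<gamma> (max 0 (min 1 t))) \<in> borel_measurable borel"
        using measurable_Pair2[OF measurable_curve_eval_pair, of \<gamma>] ms by (simp add: space_curve_borel)
      then have "(\<lambda>t. ennreal ((G (\<gamma> (max 0 (min 1 t))))\<^sup>2) * indicator {0..1} t) \<in> borel_measurable lborel"
        by measurable
      then show ?thesis by (rule measurable_cong[THEN iffD1, rotated]) (auto split: split_indicator)
    qed
    have m2: "(\<lambda>t. (metric_speed \<gamma> t)\<^sup>2 * indicator {0..1} t) \<in> borel_measurable lborel"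
    proof -
      have "(\<lambda>t. (metric_speed \<gamma> t * indicator {0..1} t)\<^sup>2) \<in> borel_measurable lborel"
        using measurable_curve_speed[OF ms] by measurable
      then show ?thesis by (rule measurable_cong[THEN iffD1, rotated]) (auto split: split_indicator)
    qed
    have sq: "(ennreal x)\<^sup>2 \<le> ennreal (x\<^sup>2)" for x
      by (cases "0 \<le> x") (auto simp: ennreal_power ennreal_neg)
    have "ennreal x * y \<le> ennreal (x\<^sup>2) + y\<^sup>2" for x y
      using ennreal_mult_le_squares[of "ennreal x" y] sq[of x] by (meson add_right_mono order_trans)
    then have "speed_integral (\<lambda>x. ennreal (G x)) \<gamma> 0 1 \<le>
      (\<integral>\<^sup>+t. ennreal ((G (\<gamma> t))\<^sup>2) * indicator {0..1} t + (metric_speed \<gamma> t)\<^sup>2 * indicator {0..1} t \<partial>lborel)"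
      unfolding speed_integral_def by (intro nn_integral_mono) (auto split: split_indicator)
    also have "\<dots> = ?A \<gamma> + ?B \<gamma>" using m1 m2 by (rule nn_integral_add)
    finally show "speed_integral (\<lambda>x. ennreal (G x)) \<gamma> 0 1 \<le> ?A \<gamma> + ?B \<gamma>" .
  qed
  also have "\<dots> = (\<integral>\<^sup>+\<gamma>. ?A \<gamma> \<partial>\<pi>) + (\<integral>\<^sup>+\<gamma>. ?B \<gamma> \<partial>\<pi>)" using A B by (rule nn_integral_add)
  also have "\<dots> < \<infinity>"
  proof -
    have "(\<integral>\<^sup>+x. ennreal ((G x)\<^sup>2) \<partial>m) < \<infinity>"
      using G by (simp add: L2_fun_def integrable_iff_bounded)
    then have "(\<integral>\<^sup>+\<gamma>. ?A \<gamma> \<partial>\<pi>) < \<infinity>" by (intro test_plan_occupation[OF \<pi> m]) auto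
    moreover have "(\<integral>\<^sup>+\<gamma>. ?B \<gamma> \<partial>\<pi>) < \<infinity>" using \<pi> by (simp add: test_plan_def)
    ultimately show ?thesis by simp
  qed
  finally show ?thesis .
qed

lemma AE_speed_integral_finite:
  assumes \<pi>: "test_plan m \<pi>" and m: "sets m = sets borel" and G: "G \<in> L2_fun m"
  shows "AE \<gamma> in \<pi>. speed_integral (\<lambda>x. ennreal (G x)) \<gamma> 0 1 < \<infinity>"
proof -
  have "(\<lambda>\<gamma>. speed_integral (\<lambda>x. ennreal (G x)) \<gamma> 0 1) \<in> borel_measurable \<pi>"
    unfolding test_plan_measurable[OF \<pi>] using L2_fun_borel[OF m G]
    by (intro measurable_speed_integral) auto
  from nn_integral_noteq_infinite[OF this] L2_fun_speed_integral_finite[OF assms] show ?thesis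
    by (simp add: less_top)
qed

text \<open>If the bound failed on a set B of positive probability, conditioning the plan on B and
  freezing its curves outside [s, t] would give a test plan violating the integrated inequality. The
  strict comparison of integrals relies on the finiteness of the right-hand side, which comes from G
  being square integrable. The null set depends on s and t.\<close>

lemma weak_upper_gradient_AE_curve:
  assumes wug: "weak_upper_gradient m f G" and m: "sets m = sets borel" and f: "f \<in> borel_measurable borel"
    and \<pi>: "test_plan m \<pi>" and st: "0 \<le> s" "s \<le> t" "t \<le> 1"
  shows "AE \<gamma> in \<pi>. ennreal \<bar>f (\<gamma> t) - f (\<gamma> s)\<bar> \<le> speed_integral (\<lambda>x. ennreal (G x)) \<gamma> s t"
proof -
  interpret prob_space \<pi> using \<pi> by (rule test_plan_space)
  have G: "G \<in> L2_fun m" using wug by (simp add: weak_upper_gradient_def)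
  have [measurable]: "G \<in> borel_measurable borel" by (rule L2_fun_borel[OF m G])
  note [measurable] = f
  define l where "l \<gamma> = ennreal \<bar>f (\<gamma> t) - f (\<gamma> s)\<bar>" for \<gamma>
  define r where "r \<gamma> = speed_integral (\<lambda>x. ennreal (G x)) \<gamma> s t" for \<gamma>
  have ev: "(\<lambda>\<gamma>. \<gamma> a) \<in> \<pi> \<rightarrow>\<^sub>M borel" if "a \<in> {0..1}" for a
    using measurable_curve_eval[OF that] by (simp add: test_plan_measurable[OF \<pi>])
  have [measurable]: "(\<lambda>\<gamma>. \<gamma> t) \<in> \<pi> \<rightarrow>\<^sub>M borel" "(\<lambda>\<gamma>. \<gamma> s) \<in> \<pi> \<rightarrow>\<^sub>M borel"
    using st by (auto intro!: ev)
  have [measurable]: "l \<in> borel_measurable \<pi>" unfolding l_def by measurable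
  have [measurable]: "r \<in> borel_measurable \<pi>"
    unfolding r_def test_plan_measurable[OF \<pi>] using st by (intro measurable_speed_integral) auto
  define B where "B = {\<gamma> \<in> space \<pi>. r \<gamma> < l \<gamma>}"
  have [measurable]: "B \<in> sets \<pi>" unfolding B_def by measurable
  have "emeasure \<pi> B = 0"
  proof (rule ccontr)
    assume B0: "emeasure \<pi> B \<noteq> 0"
    have \<pi>B: "test_plan m (uniform_measure \<pi> B)"
      by (rule test_plan_uniform_measure[OF \<pi> _ B0]) simp
    note pl = test_plan_freeze[OF \<pi>B st]
    have fm: "freeze s t \<in> uniform_measure \<pi> B \<rightarrow>\<^sub>M curve_borel"
      using measurable_freeze[OF st] by (simp add: test_plan_measurable[OF \<pi>B])
    have [measurable]: "(\<lambda>\<gamma>. \<gamma> 1) \<in> (curve_borel :: (real \<Rightarrow> 'a) measure) \<rightarrow>\<^sub>M borel"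
      "(\<lambda>\<gamma>. \<gamma> 0) \<in> (curve_borel :: (real \<Rightarrow> 'a) measure) \<rightarrow>\<^sub>M borel"
      by (auto intro!: measurable_curve_eval)
    have "(\<lambda>\<gamma>. ennreal \<bar>f (\<gamma> 1) - f (\<gamma> 0)\<bar>) \<in> borel_measurable (curve_borel :: (real \<Rightarrow> 'a) measure)"
      by measurable
    then have "(\<integral>\<^sup>+\<gamma>. l \<gamma> \<partial>uniform_measure \<pi> B)
       = (\<integral>\<^sup>+\<gamma>. ennreal \<bar>f (\<gamma> 1) - f (\<gamma> 0)\<bar> \<partial>distr (uniform_measure \<pi> B) curve_borel (freeze s t))"
      using st by (subst nn_integral_distr[OF fm]) (auto intro!: nn_integral_cong simp: l_def freeze_def)
    also have "\<dots> \<le> (\<integral>\<^sup>+\<gamma>. speed_integral (\<lambda>x. ennreal (G x)) \<gamma> 0 1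
        \<partial>distr (uniform_measure \<pi> B) curve_borel (freeze s t))"
      using wug pl by (simp add: weak_upper_gradient_iff)
    also have "\<dots> = (\<integral>\<^sup>+\<gamma>. r \<gamma> \<partial>uniform_measure \<pi> B)"
      by (subst nn_integral_distr[OF fm])
        (auto intro!: measurable_speed_integral simp: r_def[abs_def] speed_integral_freeze[OF st])
    finally have "(\<integral>\<^sup>+\<gamma>. l \<gamma> \<partial>uniform_measure \<pi> B) \<le> (\<integral>\<^sup>+\<gamma>. r \<gamma> \<partial>uniform_measure \<pi> B)" .
    moreover have "(\<integral>\<^sup>+\<gamma>. r \<gamma> \<partial>uniform_measure \<pi> B) < (\<integral>\<^sup>+\<gamma>. l \<gamma> \<partial>uniform_measure \<pi> B)"
    proof (rule nn_integral_less)
      have "(\<integral>\<^sup>+\<gamma>. r \<gamma> \<partial>uniform_measure \<pi> B) \<le>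
          (\<integral>\<^sup>+\<gamma>. speed_integral (\<lambda>x. ennreal (G x)) \<gamma> 0 1 \<partial>uniform_measure \<pi> B)"
        unfolding r_def speed_integral_def using st
        by (intro nn_integral_mono) (auto split: split_indicator)
      also have "\<dots> < \<infinity>" using \<pi>B m G by (rule L2_fun_speed_integral_finite)
      finally show "(\<integral>\<^sup>+\<gamma>. r \<gamma> \<partial>uniform_measure \<pi> B) \<noteq> \<infinity>" by simp
      have *: "AE \<gamma> in uniform_measure \<pi> B. r \<gamma> < l \<gamma>"
        by (rule AE_uniform_measureI) (auto simp: B_def)
      then show "AE \<gamma> in uniform_measure \<pi> B. r \<gamma> \<le> l \<gamma>" by eventually_elim simp
      show "\<not> (AE \<gamma> in uniform_measure \<pi> B. l \<gamma> \<le> r \<gamma>)"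
      proof
        assume "AE \<gamma> in uniform_measure \<pi> B. l \<gamma> \<le> r \<gamma>"
        with * have "AE \<gamma> in uniform_measure \<pi> B. False" by eventually_elim simp
        then show False
          using prob_space.AE_False[OF test_plan_space(3)[OF \<pi>B]] by simp
      qed
    qed auto
    ultimately show False by simp
  qed
  then have "AE \<gamma> in \<pi>. \<not> r \<gamma> < l \<gamma>"
    by (subst AE_iff_measurable[OF _ refl]) (auto simp: B_def)
  then show ?thesis by eventually_elim (simp add: l_def r_def not_less)
qed

section \<open>Calculus of weak upper gradients\<close>

lemma L2_fun_bound:
  assumes f: "f \<in> L2_fun m" and g: "g \<in> L2_fun m" and h: "h \<in> borel_measurable m"
    and le: "\<And>x. \<bar>h x\<bar> \<le> a * \<bar>f x\<bar> + b * \<bar>g x\<bar>"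
  shows "h \<in> L2_fun m"
proof -
  have "integrable m (\<lambda>x. 2 * a\<^sup>2 * (f x)\<^sup>2 + 2 * b\<^sup>2 * (g x)\<^sup>2)"
    using f g by (auto simp: L2_fun_def)
  then have "integrable m (\<lambda>x. (h x)\<^sup>2)"
  proof (rule Bochner_Integration.integrable_bound)
    show "(\<lambda>x. (h x)\<^sup>2) \<in> borel_measurable m" using h by measurable
    have "(h x)\<^sup>2 \<le> 2 * a\<^sup>2 * (f x)\<^sup>2 + 2 * b\<^sup>2 * (g x)\<^sup>2" for x
    proof -
      have "(h x)\<^sup>2 \<le> (a * \<bar>f x\<bar> + b * \<bar>g x\<bar>)\<^sup>2"
        using le[of x] by (metis abs_ge_zero abs_le_square_iff abs_of_nonneg order_trans)
      also have "\<dots> \<le> (a * \<bar>f x\<bar> + b * \<bar>g x\<bar>)\<^sup>2 + (a * \<bar>f x\<bar> - b * \<bar>g x\<bar>)\<^sup>2" by simp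
      also have "\<dots> = 2 * a\<^sup>2 * (f x)\<^sup>2 + 2 * b\<^sup>2 * (g x)\<^sup>2"
        by (simp add: power2_sum power2_diff power_mult_distrib)
      finally show ?thesis .
    qed
    then show "AE x in m. norm ((h x)\<^sup>2) \<le> norm (2 * a\<^sup>2 * (f x)\<^sup>2 + 2 * b\<^sup>2 * (g x)\<^sup>2)"
      by (auto intro!: AE_I2 order_trans[OF _ abs_ge_self])
  qed
  then show ?thesis using h by (simp add: L2_fun_def)
qed

lemma speed_integral_combine:
  fixes \<gamma> :: "real \<Rightarrow> 'a::polish_space"
  assumes H1: "H1 \<in> borel_measurable borel" and H2: "H2 \<in> borel_measurable borel"
    and \<gamma>: "\<gamma> \<in> mspace curve_metric"
  shows "speed_integral (\<lambda>x. a * H1 x + b * H2 x) \<gamma> 0 1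
    = a * speed_integral H1 \<gamma> 0 1 + b * speed_integral H2 \<gamma> 0 1"
proof -
  note m = measurable_curve_integrand1[OF H1 \<gamma>] measurable_curve_integrand1[OF H2 \<gamma>]
  have "speed_integral (\<lambda>x. a * H1 x + b * H2 x) \<gamma> 0 1 =
      (\<integral>\<^sup>+t. a * (H1 (\<gamma> t) * metric_speed \<gamma> t * indicator {0..1} t)
         + b * (H2 (\<gamma> t) * metric_speed \<gamma> t * indicator {0..1} t) \<partial>lborel)"
    unfolding speed_integral_def by (intro nn_integral_cong) (simp add: algebra_simps)
  also have "\<dots> = a * speed_integral H1 \<gamma> 0 1 + b * speed_integral H2 \<gamma> 0 1"
    unfolding speed_integral_def using m by (simp add: nn_integral_add nn_integral_cmult)
  finally show ?thesis .
qed

text \<open>The comparison of increments of h with those of f and g covers linear combinations,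
  maxima, minima and truncations at once. Gradients are nonnegative only almost everywhere;
  truncating them at 0 leaves \<open>ennreal (F x)\<close> unchanged and makes
  \<open>ennreal\<close> additive on the combination.\<close>

lemma weak_upper_gradient_combine:
  assumes m: "sets m = sets borel"
    and f: "f \<in> L2_fun m" "weak_upper_gradient m f F" and g: "g \<in> L2_fun m" "weak_upper_gradient m g G"
    and ab: "0 \<le> a" "0 \<le> b"
    and le: "\<And>x y. \<bar>h x - h y\<bar> \<le> a * \<bar>f x - f y\<bar> + b * \<bar>g x - g y\<bar>"
  shows "weak_upper_gradient m h (\<lambda>x. a * max 0 (F x) + b * max 0 (G x))"
proof -
  have L2: "F \<in> L2_fun m" "G \<in> L2_fun m" using f g by (auto simp: weak_upper_gradient_def)
  note [measurable] = L2_fun_borel[OF m f(1)] L2_fun_borel[OF m g(1)] L2_fun_borel[OF m L2(1)] L2_fun_borel[OF m L2(2)]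
  show ?thesis
    unfolding weak_upper_gradient_iff
  proof (intro conjI allI impI)
    show "(\<lambda>x. a * max 0 (F x) + b * max 0 (G x)) \<in> L2_fun m"
    proof (rule L2_fun_bound[OF L2])
      have "(\<lambda>x. a * max 0 (F x) + b * max 0 (G x)) \<in> borel_measurable borel" by measurable
      then show "(\<lambda>x. a * max 0 (F x) + b * max 0 (G x)) \<in> borel_measurable m"
        using m by (simp cong: measurable_cong_sets)
      have "a * max 0 (F x) \<le> a * \<bar>F x\<bar>" "b * max 0 (G x) \<le> b * \<bar>G x\<bar>"
           "0 \<le> a * max 0 (F x)" "0 \<le> b * max 0 (G x)" for x
        using ab by (auto intro!: mult_left_mono mult_nonneg_nonneg)
      then show "\<bar>a * max 0 (F x) + b * max 0 (G x)\<bar> \<le> a * \<bar>F x\<bar> + b * \<bar>G x\<bar>" for x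
        by (smt (verit, best))
    qed
    show "AE x in m. 0 \<le> a * max 0 (F x) + b * max 0 (G x)"
      using ab by (auto intro!: AE_I2 add_nonneg_nonneg mult_nonneg_nonneg)
    fix \<pi> assume \<pi>: "test_plan m \<pi>"
    have [measurable]: "(\<lambda>\<gamma>. \<gamma> 1) \<in> \<pi> \<rightarrow>\<^sub>M borel" "(\<lambda>\<gamma>. \<gamma> 0) \<in> \<pi> \<rightarrow>\<^sub>M borel"
      unfolding test_plan_measurable[OF \<pi>] by (auto intro!: measurable_curve_eval)
    have [measurable]: "(\<lambda>\<gamma>. speed_integral (\<lambda>x. ennreal (F x)) \<gamma> 0 1) \<in> borel_measurable \<pi>"
      "(\<lambda>\<gamma>. speed_integral (\<lambda>x. ennreal (G x)) \<gamma> 0 1) \<in> borel_measurable \<pi>"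
      unfolding test_plan_measurable[OF \<pi>] by (auto intro!: measurable_speed_integral)
    have "(\<integral>\<^sup>+\<gamma>. ennreal \<bar>h (\<gamma> 1) - h (\<gamma> 0)\<bar> \<partial>\<pi>) \<le>
      (\<integral>\<^sup>+\<gamma>. ennreal a * ennreal \<bar>f (\<gamma> 1) - f (\<gamma> 0)\<bar> + ennreal b * ennreal \<bar>g (\<gamma> 1) - g (\<gamma> 0)\<bar> \<partial>\<pi>)"
      using ab by (intro nn_integral_mono)
        (simp add: ennreal_mult[symmetric] ennreal_plus[symmetric] le del: ennreal_plus)
    also have "\<dots> = ennreal a * (\<integral>\<^sup>+\<gamma>. ennreal \<bar>f (\<gamma> 1) - f (\<gamma> 0)\<bar> \<partial>\<pi>)
        + ennreal b * (\<integral>\<^sup>+\<gamma>. ennreal \<bar>g (\<gamma> 1) - g (\<gamma> 0)\<bar> \<partial>\<pi>)"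
      by (simp add: nn_integral_add nn_integral_cmult)
    also have "\<dots> \<le> ennreal a * (\<integral>\<^sup>+\<gamma>. speed_integral (\<lambda>x. ennreal (F x)) \<gamma> 0 1 \<partial>\<pi>)
        + ennreal b * (\<integral>\<^sup>+\<gamma>. speed_integral (\<lambda>x. ennreal (G x)) \<gamma> 0 1 \<partial>\<pi>)"
      using f(2) g(2) \<pi> by (intro add_mono mult_left_mono) (auto simp: weak_upper_gradient_iff)
    also have "\<dots> = (\<integral>\<^sup>+\<gamma>. ennreal a * speed_integral (\<lambda>x. ennreal (F x)) \<gamma> 0 1
        + ennreal b * speed_integral (\<lambda>x. ennreal (G x)) \<gamma> 0 1 \<partial>\<pi>)"
      by (simp add: nn_integral_add nn_integral_cmult)
    also have "\<dots> = (\<integral>\<^sup>+\<gamma>. speed_integral (\<lambda>x. ennreal a * ennreal (F x) + ennreal b * ennreal (G x)) \<gamma> 0 1 \<partial>\<pi>)"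
      by (intro nn_integral_cong speed_integral_combine[symmetric]) (auto simp: test_plan_space[OF \<pi>])
    also have "(\<lambda>x. ennreal a * ennreal (F x) + ennreal b * ennreal (G x))
        = (\<lambda>x. ennreal (a * max 0 (F x) + b * max 0 (G x)))"
    proof
      fix x
      have "ennreal (F x) = ennreal (max 0 (F x))" "ennreal (G x) = ennreal (max 0 (G x))"
        by (auto simp: max_def ennreal_neg)
      then show "ennreal a * ennreal (F x) + ennreal b * ennreal (G x)
          = ennreal (a * max 0 (F x) + b * max 0 (G x))"
        using ab by (simp add: ennreal_mult)
    qed
    finally show "(\<integral>\<^sup>+\<gamma>. ennreal \<bar>h (\<gamma> 1) - h (\<gamma> 0)\<bar> \<partial>\<pi>)
      \<le> (\<integral>\<^sup>+\<gamma>. speed_integral (\<lambda>x. ennreal (a * max 0 (F x) + b * max 0 (G x))) \<gamma> 0 1 \<partial>\<pi>)" .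
  qed
qed

section \<open>Increments of a real function of time bounded by integrals\<close>

lemma nn_integral_Icc_combine:
  fixes w :: "real \<Rightarrow> ennreal"
  assumes w: "w \<in> borel_measurable borel" and ab: "a \<le> b" "b \<le> c"
  shows "(\<integral>\<^sup>+t\<in>{a..b}. w t \<partial>lborel) + (\<integral>\<^sup>+t\<in>{b..c}. w t \<partial>lborel) = (\<integral>\<^sup>+t\<in>{a..c}. w t \<partial>lborel)"
proof -
  have "(\<integral>\<^sup>+t\<in>{a..b}. w t \<partial>lborel) + (\<integral>\<^sup>+t\<in>{b..c}. w t \<partial>lborel)
      = (\<integral>\<^sup>+t. w t * indicator {a..b} t + w t * indicator {b..c} t \<partial>lborel)"
    using w by (subst nn_integral_add) auto
  also have "\<dots> = (\<integral>\<^sup>+t\<in>{a..c}. w t \<partial>lborel)"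
    by (rule nn_integral_cong_AE, use AE_lborel_singleton[of b] in eventually_elim)
      (use ab in \<open>auto split: split_indicator\<close>)
  finally show ?thesis .
qed

lemma increment_le_nn_integral_partition:
  fixes w :: "real \<Rightarrow> ennreal" and F :: "real \<Rightarrow> real"
  assumes w: "w \<in> borel_measurable borel"
    and le: "\<And>k. k < n \<Longrightarrow>
      ennreal \<bar>F (real (Suc k) / real n) - F (real k / real n)\<bar> \<le> (\<integral>\<^sup>+t\<in>{real k / real n..real (Suc k) / real n}. w t \<partial>lborel)"
    and n: "n > 0"
  shows "ennreal \<bar>F 1 - F 0\<bar> \<le> (\<integral>\<^sup>+t\<in>{0..1}. w t \<partial>lborel)"
proof -
  have "ennreal \<bar>F (real k / real n) - F 0\<bar> \<le> (\<integral>\<^sup>+t\<in>{0..real k / real n}. w t \<partial>lborel)" if "k \<le> n" for k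
    using that
  proof (induction k)
    case (Suc k)
    have "ennreal \<bar>F (real (Suc k) / real n) - F 0\<bar>
        \<le> ennreal \<bar>F (real k / real n) - F 0\<bar> + ennreal \<bar>F (real (Suc k) / real n) - F (real k / real n)\<bar>"
    proof -
      have "\<bar>F (real (Suc k) / real n) - F 0\<bar>
          \<le> \<bar>F (real k / real n) - F 0\<bar> + \<bar>F (real (Suc k) / real n) - F (real k / real n)\<bar>"
        by linarith
      from ennreal_leI[OF this] show ?thesis by (simp del: of_nat_Suc)
    qed
    also have "\<dots> \<le> (\<integral>\<^sup>+t\<in>{0..real k / real n}. w t \<partial>lborel)
        + (\<integral>\<^sup>+t\<in>{real k / real n..real (Suc k) / real n}. w t \<partial>lborel)"
      using Suc by (intro add_mono le) auto
    also have "\<dots> = (\<integral>\<^sup>+t\<in>{0..real (Suc k) / real n}. w t \<partial>lborel)"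
      using w n by (intro nn_integral_Icc_combine) (auto simp: divide_right_mono)
    finally show ?case .
  qed simp
  from this[of n] show ?thesis using n by simp
qed

text \<open>On the grid of mesh 1/(i+1), cells meeting K use g1 and all others g2. Cells meeting K
  lie in a neighbourhood \<open>W i\<close> of K which shrinks to K, because K is closed, so
  dominated convergence removes the surplus.\<close>

lemma increment_le_nn_integral_compact:
  fixes g1 g2 :: "real \<Rightarrow> ennreal" and F :: "real \<Rightarrow> real"
  assumes [measurable]: "g1 \<in> borel_measurable borel" "g2 \<in> borel_measurable borel"
    and fin: "(\<integral>\<^sup>+t\<in>{0..1}. g1 t \<partial>lborel) < \<infinity>" "(\<integral>\<^sup>+t\<in>{0..1}. g2 t \<partial>lborel) < \<infinity>"
    and le: "\<And>n k. k < n \<Longrightarrow> ennreal \<bar>F (real (Suc k) / real n) - F (real k / real n)\<bar>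
        \<le> (\<integral>\<^sup>+t\<in>{real k / real n..real (Suc k) / real n}. g1 t \<partial>lborel)"
      "\<And>n k. k < n \<Longrightarrow> ennreal \<bar>F (real (Suc k) / real n) - F (real k / real n)\<bar>
        \<le> (\<integral>\<^sup>+t\<in>{real k / real n..real (Suc k) / real n}. g2 t \<partial>lborel)"
    and K: "compact K"
  shows "ennreal \<bar>F 1 - F 0\<bar> \<le> (\<integral>\<^sup>+t\<in>{0..1}. (g1 t * indicator K t + g2 t * indicator (- K) t) \<partial>lborel)"
proof -
  \<comment> \<open>The radius is twice the mesh, so a closed cell meeting K is contained in the
    union of open balls.\<close>
  define W where "W i = (\<Union>x\<in>K. ball x (2 / real (Suc i)))" for i
  define w where "w i t = g1 t * indicator (W i) t + g2 t * indicator (- K) t" for i t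
  have [measurable]: "W i \<in> sets borel" "K \<in> sets borel" for i
    using K by (simp_all add: W_def borel_compact borel_open open_UN)
  have wm [measurable]: "w i \<in> borel_measurable borel" for i unfolding w_def by measurable
  have "ennreal \<bar>F 1 - F 0\<bar> \<le> (\<integral>\<^sup>+t\<in>{0..1}. w i t \<partial>lborel)" for i
  proof (rule increment_le_nn_integral_partition[where n = "Suc i"])
    fix k assume k: "k < Suc i"
    let ?I = "{real k / real (Suc i)..real (Suc k) / real (Suc i)}"
    have len: "\<bar>s - t\<bar> < 2 / real (Suc i)" if "s \<in> ?I" "t \<in> ?I" for s t
    proof -
      have "real (Suc k) / real (Suc i) - real k / real (Suc i) < 2 / real (Suc i)"
        by (simp add: diff_divide_distrib[symmetric] divide_strict_right_mono)
      then show ?thesis using that by (auto simp: abs_real_def)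
    qed
    show "ennreal \<bar>F (real (Suc k) / real (Suc i)) - F (real k / real (Suc i))\<bar> \<le> (\<integral>\<^sup>+t\<in>?I. w i t \<partial>lborel)"
    proof (cases "?I \<inter> K = {}")
      case True
      have "(\<integral>\<^sup>+t\<in>?I. g2 t \<partial>lborel) \<le> (\<integral>\<^sup>+t\<in>?I. w i t \<partial>lborel)"
        by (intro nn_integral_mono) (use True in \<open>auto simp: w_def split: split_indicator\<close>)
      with le(2)[OF k] show ?thesis by (rule order_trans)
    next
      case False
      then obtain x where x: "x \<in> ?I" "x \<in> K" by blast
      then have "t \<in> W i" if "t \<in> ?I" for t
        using len[OF x(1) that] by (auto simp: W_def dist_real_def)
      then have "(\<integral>\<^sup>+t\<in>?I. g1 t \<partial>lborel) \<le> (\<integral>\<^sup>+t\<in>?I. w i t \<partial>lborel)"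
        by (intro nn_integral_mono) (simp add: w_def indicator_def)
      with le(1)[OF k] show ?thesis by (rule order_trans)
    qed
  qed simp_all
  moreover have "(\<lambda>i. \<integral>\<^sup>+t. w i t * indicator {0..1} t \<partial>lborel)
      \<longlonglongrightarrow> (\<integral>\<^sup>+t. (g1 t * indicator K t + g2 t * indicator (- K) t) * indicator {0..1} t \<partial>lborel)"
  proof (rule nn_integral_dominated_convergence[where w = "\<lambda>t. (g1 t + g2 t) * indicator {0..1} t"])
    show "AE t in lborel. w j t * indicator {0..1} t \<le> (g1 t + g2 t) * indicator {0..1} t" for j
      by (intro AE_I2) (auto simp: w_def split: split_indicator)
    have "(\<integral>\<^sup>+t. (g1 t + g2 t) * indicator {0..1} t \<partial>lborel)
        = (\<integral>\<^sup>+t\<in>{0..1}. g1 t \<partial>lborel) + (\<integral>\<^sup>+t\<in>{0..1}. g2 t \<partial>lborel)"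
      by (simp add: distrib_right nn_integral_add)
    then show "(\<integral>\<^sup>+t. (g1 t + g2 t) * indicator {0..1} t \<partial>lborel) < \<infinity>" using fin by simp
    show "AE t in lborel. (\<lambda>i. w i t * indicator {0..1} t)
       \<longlonglongrightarrow> (g1 t * indicator K t + g2 t * indicator (- K) t) * indicator {0..1} t"
    proof (intro AE_I2 tendsto_eventually)
      fix t
      have "\<forall>\<^sub>F i in sequentially. (t \<in> W i \<longleftrightarrow> t \<in> K)"
      proof (cases "t \<in> K")
        case True
        then have "t \<in> W i" for i by (auto simp: W_def intro!: bexI[of _ t])
        then show ?thesis using True by simp
      next
        case False
        have "open (- K)" using K compact_imp_closed by blast
        then obtain e where e: "e > 0" "ball t e \<subseteq> - K" using False open_contains_ball by blast
        have "(\<lambda>i. 2 / real (Suc i)) \<longlonglongrightarrow> 0"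
          using tendsto_mult_right_zero[OF LIMSEQ_inverse_real_of_nat, of 2] by (simp add: divide_inverse)
        then have "\<forall>\<^sub>F i in sequentially. 2 / real (Suc i) < e"
          using e(1) by (rule order_tendstoD)
        then show ?thesis
        proof eventually_elim
          case (elim i)
          have "t \<notin> W i"
          proof
            assume "t \<in> W i"
            then obtain x where "x \<in> K" "dist x t < 2 / real (Suc i)" by (auto simp: W_def)
            then have "x \<in> ball t e" using elim by (simp add: dist_commute)
            with e(2) \<open>x \<in> K\<close> show False by blast
          qed
          then show ?case using False by simp
        qed
      qed
      then show "\<forall>\<^sub>F i in sequentially. w i t * indicator {0..1} t
          = (g1 t * indicator K t + g2 t * indicator (- K) t) * indicator {0..1} t"
        by eventually_elim (auto simp: w_def indicator_def)
    qed
  qed measurable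
  ultimately show ?thesis
    by (intro tendsto_lowerbound[where F = sequentially]) (auto intro!: always_eventually)
qed

text \<open>Inner regularity reduces the optimal choice between the two bounds to a compact set of times.\<close>

lemma increment_le_nn_integral_min:
  fixes g1 g2 :: "real \<Rightarrow> ennreal" and F :: "real \<Rightarrow> real"
  assumes [measurable]: "g1 \<in> borel_measurable borel" "g2 \<in> borel_measurable borel"
    and fin: "(\<integral>\<^sup>+t\<in>{0..1}. g1 t \<partial>lborel) < \<infinity>" "(\<integral>\<^sup>+t\<in>{0..1}. g2 t \<partial>lborel) < \<infinity>"
    and le: "\<And>n k. k < n \<Longrightarrow> ennreal \<bar>F (real (Suc k) / real n) - F (real k / real n)\<bar>
        \<le> (\<integral>\<^sup>+t\<in>{real k / real n..real (Suc k) / real n}. g1 t \<partial>lborel)"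
      "\<And>n k. k < n \<Longrightarrow> ennreal \<bar>F (real (Suc k) / real n) - F (real k / real n)\<bar>
        \<le> (\<integral>\<^sup>+t\<in>{real k / real n..real (Suc k) / real n}. g2 t \<partial>lborel)"
  shows "ennreal \<bar>F 1 - F 0\<bar> \<le> (\<integral>\<^sup>+t\<in>{0..1}. min (g1 t) (g2 t) \<partial>lborel)"
proof -
  \<comment> \<open>One finite measure dominating both bounds, to which inner regularity of A, the
    set of times where g1 is the better bound, is applied.\<close>
  define \<nu> where "\<nu> = density lborel (\<lambda>t. (g1 t + g2 t) * indicator {0..1} t)"
  define A where "A = {t. g1 t \<le> g2 t}"
  have A [measurable]: "A \<in> sets borel" unfolding A_def by measurable
  have \<nu>: "emeasure \<nu> B = (\<integral>\<^sup>+t. (g1 t + g2 t) * indicator {0..1} t * indicator B t \<partial>lborel)"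
    if "B \<in> sets borel" for B
    unfolding \<nu>_def using that by (intro emeasure_density) auto
  have sp: "space \<nu> = UNIV" "sets \<nu> = sets borel" by (auto simp: \<nu>_def)
  have "emeasure \<nu> UNIV = (\<integral>\<^sup>+t\<in>{0..1}. g1 t \<partial>lborel) + (\<integral>\<^sup>+t\<in>{0..1}. g2 t \<partial>lborel)"
    by (subst \<nu>) (simp_all add: distrib_right nn_integral_add)
  then have fin\<nu>: "emeasure \<nu> UNIV < \<infinity>" using fin by simp
  have finA: "emeasure \<nu> A \<noteq> \<infinity>"
    using emeasure_mono[of A UNIV \<nu>] sp fin\<nu> by (auto simp: top_unique)
  have ir: "emeasure \<nu> A = (SUP K \<in> {K. K \<subseteq> A \<and> compact K}. emeasure \<nu> K)"
    using fin\<nu> sp A by (intro inner_regular) auto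
  let ?m = "\<integral>\<^sup>+t\<in>{0..1}. min (g1 t) (g2 t) \<partial>lborel"
  \<comment> \<open>Using g1 on K and g2 elsewhere exceeds the optimum only on A - K, and there by
    at most g1 + g2, that is, by at most the \<nu>-measure of A - K in total. The estimate is
    written additively, and \<open>emeasure \<nu> A\<close>, which is finite, is cancelled after the
    supremum over K.\<close>
  have "emeasure \<nu> K + ennreal \<bar>F 1 - F 0\<bar> \<le> ?m + emeasure \<nu> A" if K: "K \<subseteq> A" "compact K" for K
  proof -
    have [measurable]: "K \<in> sets borel" using K(2) by (rule borel_compact)
    have "emeasure \<nu> K + ennreal \<bar>F 1 - F 0\<bar> \<le> emeasure \<nu> K
      + (\<integral>\<^sup>+t\<in>{0..1}. (g1 t * indicator K t + g2 t * indicator (- K) t) \<partial>lborel)"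
      using K(2) by (intro add_left_mono increment_le_nn_integral_compact fin le) auto
    also have "\<dots> = (\<integral>\<^sup>+t. (g1 t + g2 t) * indicator {0..1} t * indicator K t
      + (g1 t * indicator K t + g2 t * indicator (- K) t) * indicator {0..1} t \<partial>lborel)"
      by (subst \<nu>) (auto intro!: nn_integral_add[symmetric])
    also have "\<dots> \<le> (\<integral>\<^sup>+t. min (g1 t) (g2 t) * indicator {0..1} t
      + (g1 t + g2 t) * indicator {0..1} t * indicator A t \<partial>lborel)"
      using K(1) by (intro nn_integral_mono)
        (auto simp: A_def add_ac min_def add_increasing2 subset_iff split: split_indicator)
    also have "\<dots> = ?m + emeasure \<nu> A"
      by (subst \<nu>) (auto intro!: nn_integral_add)
    finally show ?thesis .
  qed
  then have "(SUP K \<in> {K. K \<subseteq> A \<and> compact K}. emeasure \<nu> K + ennreal \<bar>F 1 - F 0\<bar>) \<le> ?m + emeasure \<nu> A"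
    by (intro SUP_least) auto
  also have "(SUP K \<in> {K. K \<subseteq> A \<and> compact K}. emeasure \<nu> K + ennreal \<bar>F 1 - F 0\<bar>)
      = (SUP K \<in> {K. K \<subseteq> A \<and> compact K}. emeasure \<nu> K) + ennreal \<bar>F 1 - F 0\<bar>"
    by (rule ennreal_SUP_add_left) (auto intro: exI[of _ "{}"])
  finally have "emeasure \<nu> A + ennreal \<bar>F 1 - F 0\<bar> \<le> emeasure \<nu> A + ?m"
    using ir by (simp add: add.commute)
  then show ?thesis using finA by (simp add: ennreal_add_left_cancel_le)
qed

text \<open>The grid cells are countably many, so outside a single null set of curves both gradients
  bound all grid increments; \<open>increment_le_nn_integral_min\<close> then applies to f along the
  curve.\<close>

lemma weak_upper_gradient_min:
  assumes m: "sets m = sets borel" and f: "f \<in> borel_measurable borel"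
    and wug: "weak_upper_gradient m f G1" "weak_upper_gradient m f G2"
  shows "weak_upper_gradient m f (\<lambda>x. min (G1 x) (G2 x))"
  unfolding weak_upper_gradient_iff
proof (intro conjI allI impI)
  have L2: "G1 \<in> L2_fun m" "G2 \<in> L2_fun m" using wug by (auto simp: weak_upper_gradient_def)
  note [measurable] = L2_fun_borel[OF m L2(1)] L2_fun_borel[OF m L2(2)]
  have b: "G1 \<in> borel_measurable m" "G2 \<in> borel_measurable m" using L2 by (auto simp: L2_fun_def)
  show "(\<lambda>x. min (G1 x) (G2 x)) \<in> L2_fun m"
    by (rule L2_fun_bound[OF L2, of _ 1 1]) (use b in \<open>auto simp: min_def\<close>)
  show "AE x in m. 0 \<le> min (G1 x) (G2 x)"
    using wug unfolding weak_upper_gradient_iff by auto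
  fix \<pi> assume \<pi>: "test_plan m \<pi>"
  have "AE \<gamma> in \<pi>. k < n \<longrightarrow> ennreal \<bar>f (\<gamma> (real (Suc k) / real n)) - f (\<gamma> (real k / real n))\<bar>
      \<le> speed_integral (\<lambda>x. ennreal (G x)) \<gamma> (real k / real n) (real (Suc k) / real n)"
    if "weak_upper_gradient m f G" for G and n k :: nat
  proof (cases "k < n")
    case True
    then have "AE \<gamma> in \<pi>. ennreal \<bar>f (\<gamma> (real (Suc k) / real n)) - f (\<gamma> (real k / real n))\<bar>
      \<le> speed_integral (\<lambda>x. ennreal (G x)) \<gamma> (real k / real n) (real (Suc k) / real n)"
      by (intro weak_upper_gradient_AE_curve[OF that m f \<pi>]) (auto simp: divide_right_mono)
    then show ?thesis by eventually_elim simp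
  qed simp
  then have "AE \<gamma> in \<pi>. \<forall>n k. k < n \<longrightarrow> ennreal \<bar>f (\<gamma> (real (Suc k) / real n)) - f (\<gamma> (real k / real n))\<bar>
      \<le> speed_integral (\<lambda>x. ennreal (G x)) \<gamma> (real k / real n) (real (Suc k) / real n)"
    if "weak_upper_gradient m f G" for G
    using that by (simp add: AE_all_countable)
  from this[OF wug(1)] this[OF wug(2)]
    AE_speed_integral_finite[OF \<pi> m L2(1)] AE_speed_integral_finite[OF \<pi> m L2(2)] AE_space
  have "AE \<gamma> in \<pi>. ennreal \<bar>f (\<gamma> 1) - f (\<gamma> 0)\<bar>
      \<le> speed_integral (\<lambda>x. ennreal (min (G1 x) (G2 x))) \<gamma> 0 1"
  proof eventually_elim
    case (elim \<gamma>)
    define g where "g G t = ennreal (G (\<gamma> t)) * metric_speed \<gamma> t * indicator {0..1} t" for G t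
    have gm: "g G1 \<in> borel_measurable borel" "g G2 \<in> borel_measurable borel"
      unfolding g_def using elim(5)
      by (auto intro!: measurable_curve_integrand1 simp: test_plan_space[OF \<pi>])
    have si: "speed_integral (\<lambda>x. ennreal (G x)) \<gamma> a b = (\<integral>\<^sup>+t\<in>{a..b}. g G t \<partial>lborel)"
      if "0 \<le> a" "b \<le> 1" for G a b
      unfolding speed_integral_def g_def using that
      by (intro nn_integral_cong) (auto split: split_indicator)
    have "ennreal \<bar>(f \<circ> \<gamma>) 1 - (f \<circ> \<gamma>) 0\<bar> \<le> (\<integral>\<^sup>+t\<in>{0..1}. min (g G1 t) (g G2 t) \<partial>lborel)"
    proof (rule increment_le_nn_integral_min[OF gm])
      show "(\<integral>\<^sup>+t\<in>{0..1}. g G1 t \<partial>lborel) < \<infinity>" "(\<integral>\<^sup>+t\<in>{0..1}. g G2 t \<partial>lborel) < \<infinity>"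
        using elim(3,4) by (simp_all add: si)
      fix n k :: nat assume "k < n"
      then show "ennreal \<bar>(f \<circ> \<gamma>) (real (Suc k) / real n) - (f \<circ> \<gamma>) (real k / real n)\<bar>
        \<le> (\<integral>\<^sup>+t\<in>{real k / real n..real (Suc k) / real n}. g G1 t \<partial>lborel)"
        "ennreal \<bar>(f \<circ> \<gamma>) (real (Suc k) / real n) - (f \<circ> \<gamma>) (real k / real n)\<bar>
        \<le> (\<integral>\<^sup>+t\<in>{real k / real n..real (Suc k) / real n}. g G2 t \<partial>lborel)"
        using elim(1,2) by (simp_all add: si[symmetric] del: of_nat_Suc)
    qed
    also have "\<dots> = speed_integral (\<lambda>x. ennreal (min (G1 x) (G2 x))) \<gamma> 0 1"
      unfolding speed_integral_def
    proof (rule nn_integral_cong)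
      fix t
      have "min (ennreal a * v) (ennreal b * v) = ennreal (min a b) * v" for a b and v :: ennreal
        by (cases "a \<le> b") (auto simp: min_def ennreal_leI mult_right_mono antisym not_le)
      then show "min (g G1 t) (g G2 t) * indicator {0..1} t
          = ennreal (min (G1 (\<gamma> t)) (G2 (\<gamma> t))) * metric_speed \<gamma> t * indicator {0..1} t"
        by (simp add: g_def split: split_indicator)
    qed
    finally show ?case by simp
  qed
  then show "(\<integral>\<^sup>+\<gamma>. ennreal \<bar>f (\<gamma> 1) - f (\<gamma> 0)\<bar> \<partial>\<pi>)
      \<le> (\<integral>\<^sup>+\<gamma>. speed_integral (\<lambda>x. ennreal (min (G1 x) (G2 x))) \<gamma> 0 1 \<partial>\<pi>)"
    by (rule nn_integral_mono_AE)
qed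

lemma tendsto_nn_integral_Icc:
  fixes g :: "real \<Rightarrow> ennreal"
  assumes [measurable]: "g \<in> borel_measurable borel"
    and fin: "(\<integral>\<^sup>+t\<in>{0..1}. g t \<partial>lborel) < \<infinity>"
    and a: "a \<longlonglongrightarrow> a'" "\<And>i. a i \<in> {0..1}"
  shows "(\<lambda>i. \<integral>\<^sup>+t\<in>{0..a i}. g t \<partial>lborel) \<longlonglongrightarrow> (\<integral>\<^sup>+t\<in>{0..a'}. g t \<partial>lborel)"
    and "(\<lambda>i. \<integral>\<^sup>+t\<in>{a i..1}. g t \<partial>lborel) \<longlonglongrightarrow> (\<integral>\<^sup>+t\<in>{a'..1}. g t \<partial>lborel)"
proof -
  have ev: "\<forall>\<^sub>F i in sequentially. (a i < t \<longleftrightarrow> a' < t) \<and> (t < a i \<longleftrightarrow> t < a')" if "t \<noteq> a'" for t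
  proof (cases "t < a'")
    case True
    from order_tendstoD(1)[OF a(1) this] show ?thesis by eventually_elim (use True in auto)
  next
    case False
    then have "a' < t" using that by simp
    from order_tendstoD(2)[OF a(1) this] show ?thesis by eventually_elim (use False that in auto)
  qed
  show "(\<lambda>i. \<integral>\<^sup>+t\<in>{0..a i}. g t \<partial>lborel) \<longlonglongrightarrow> (\<integral>\<^sup>+t\<in>{0..a'}. g t \<partial>lborel)"
  proof (rule nn_integral_dominated_convergence[where w = "\<lambda>t. g t * indicator {0..1} t"])
    show "AE t in lborel. (\<lambda>i. g t * indicator {0..a i} t) \<longlonglongrightarrow> g t * indicator {0..a'} t"
      using AE_lborel_singleton[of a']
    proof eventually_elim
      case (elim t)
      from ev[OF elim] show ?case
        by (intro tendsto_eventually, eventually_elim) (auto simp: indicator_def not_less[symmetric])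
    qed
    show "AE t in lborel. g t * indicator {0..a i} t \<le> g t * indicator {0..1} t" for i
      using a(2)[of i] by (intro AE_I2) (auto split: split_indicator)
  qed (use fin in measurable)
  show "(\<lambda>i. \<integral>\<^sup>+t\<in>{a i..1}. g t \<partial>lborel) \<longlonglongrightarrow> (\<integral>\<^sup>+t\<in>{a'..1}. g t \<partial>lborel)"
  proof (rule nn_integral_dominated_convergence[where w = "\<lambda>t. g t * indicator {0..1} t"])
    show "AE t in lborel. (\<lambda>i. g t * indicator {a i..1} t) \<longlonglongrightarrow> g t * indicator {a'..1} t"
      using AE_lborel_singleton[of a']
    proof eventually_elim
      case (elim t)
      from ev[OF elim] show ?case
        by (intro tendsto_eventually, eventually_elim) (auto simp: indicator_def not_less[symmetric])
    qed
    show "AE t in lborel. g t * indicator {a i..1} t \<le> g t * indicator {0..1} t" for i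
      using a(2)[of i] by (intro AE_I2) (auto split: split_indicator)
  qed (use fin in measurable)
qed

text \<open>
  If \<open>a\<close> and \<open>b\<close> are the first and the last zero of \<open>F\<close>, the increment of \<open>F\<close> over \<open>[a, b]\<close>
  vanishes, and outside \<open>[a, b]\<close> there are no zeros.
\<close>

lemma increment_le_nn_integral_nonzero:
  fixes g :: "real \<Rightarrow> ennreal" and F :: "real \<Rightarrow> real"
  assumes g [measurable]: "g \<in> borel_measurable borel"
    and fin: "(\<integral>\<^sup>+t\<in>{0..1}. g t \<partial>lborel) < \<infinity>"
    and le: "ennreal \<bar>F 1 - F 0\<bar> \<le> (\<integral>\<^sup>+t\<in>{0..1}. g t \<partial>lborel)"
    and ae: "AE t in lborel. t \<in> {0..1} \<longrightarrow> ennreal \<bar>F t - F 0\<bar> \<le> (\<integral>\<^sup>+r\<in>{0..t}. g r \<partial>lborel) \<and>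
        ennreal \<bar>F 1 - F t\<bar> \<le> (\<integral>\<^sup>+r\<in>{t..1}. g r \<partial>lborel)"
  shows "ennreal \<bar>F 1 - F 0\<bar> \<le> (\<integral>\<^sup>+t\<in>{0..1}. (if F t = 0 then 0 else g t) \<partial>lborel)"
proof -
  \<comment> \<open>Only zeros at which the increment bounds hold are collected; by the
    almost-everywhere hypothesis all other zeros form a null set of times.\<close>
  define N where "N = {t \<in> {0..1}. F t = 0 \<and> ennreal \<bar>F t - F 0\<bar> \<le> (\<integral>\<^sup>+r\<in>{0..t}. g r \<partial>lborel) \<and>
        ennreal \<bar>F 1 - F t\<bar> \<le> (\<integral>\<^sup>+r\<in>{t..1}. g r \<partial>lborel)}"
  have aeN: "AE t in lborel. t \<in> {0..1} \<longrightarrow> F t = 0 \<longrightarrow> t \<in> N"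
    using ae by eventually_elim (auto simp: N_def)
  show ?thesis
  proof (cases "N = {}")
    case True
    have "(\<integral>\<^sup>+t\<in>{0..1}. g t \<partial>lborel) \<le> (\<integral>\<^sup>+t\<in>{0..1}. (if F t = 0 then 0 else g t) \<partial>lborel)"
      by (rule nn_integral_mono_AE, use aeN in eventually_elim) (use True in \<open>auto split: split_indicator\<close>)
    with le show ?thesis by (rule order_trans)
  next
    case False
    have bdd: "bdd_below N" "bdd_above N" "N \<subseteq> {0..1}" by (auto simp: N_def intro!: bdd_belowI[of _ 0] bdd_aboveI[of _ 1])
    \<comment> \<open>The extreme points need not belong to N, since F may be discontinuous. Zeros
      in N converging to them suffice, as the integrals depend continuously on their end
      points.\<close>
    have "Inf N \<in> closure N" "Sup N \<in> closure N"
      using closure_contains_Inf[OF False bdd(1)] closure_contains_Sup[OF False bdd(2)] .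
    then obtain a b where ab: "\<And>i. a i \<in> N" "a \<longlonglongrightarrow> Inf N" "\<And>i. b i \<in> N" "b \<longlonglongrightarrow> Sup N"
      unfolding closure_sequential by blast
    have "ennreal \<bar>F 1 - F 0\<bar> \<le> (\<integral>\<^sup>+r\<in>{0..a i}. g r \<partial>lborel) + (\<integral>\<^sup>+r\<in>{b i..1}. g r \<partial>lborel)" for i
    proof -
      have "ennreal \<bar>F 1 - F 0\<bar> \<le> ennreal (\<bar>F (a i) - F 0\<bar> + \<bar>F 1 - F (b i)\<bar>)"
        using ab(1)[of i] ab(3)[of i] by (intro ennreal_leI) (auto simp: N_def)
      also have "\<dots> = ennreal \<bar>F (a i) - F 0\<bar> + ennreal \<bar>F 1 - F (b i)\<bar>" by simp
      also have "\<dots> \<le> (\<integral>\<^sup>+r\<in>{0..a i}. g r \<partial>lborel) + (\<integral>\<^sup>+r\<in>{b i..1}. g r \<partial>lborel)"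
        using ab(1)[of i] ab(3)[of i] by (intro add_mono) (auto simp: N_def)
      finally show ?thesis .
    qed
    moreover have "(\<lambda>i. (\<integral>\<^sup>+r\<in>{0..a i}. g r \<partial>lborel) + (\<integral>\<^sup>+r\<in>{b i..1}. g r \<partial>lborel))
        \<longlonglongrightarrow> (\<integral>\<^sup>+r\<in>{0..Inf N}. g r \<partial>lborel) + (\<integral>\<^sup>+r\<in>{Sup N..1}. g r \<partial>lborel)"
      using ab bdd(3) by (intro tendsto_add tendsto_nn_integral_Icc[OF g fin]) blast+
    ultimately have "ennreal \<bar>F 1 - F 0\<bar> \<le> (\<integral>\<^sup>+r\<in>{0..Inf N}. g r \<partial>lborel) + (\<integral>\<^sup>+r\<in>{Sup N..1}. g r \<partial>lborel)"
      by (intro tendsto_lowerbound[where F = sequentially]) (auto intro!: always_eventually)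
    also have "\<dots> = (\<integral>\<^sup>+r. g r * indicator {0..Inf N} r + g r * indicator {Sup N..1} r \<partial>lborel)"
      by (intro nn_integral_add[symmetric]) auto
    also have "\<dots> \<le> (\<integral>\<^sup>+t\<in>{0..1}. (if F t = 0 then 0 else g t) \<partial>lborel)"
    proof (rule nn_integral_mono_AE, use aeN AE_lborel_singleton[of "Inf N"] AE_lborel_singleton[of "Sup N"] in eventually_elim)
      case (elim t)
      have IS: "0 \<le> Inf N" "Inf N \<le> Sup N" "Sup N \<le> 1"
        using False bdd by (auto intro!: cInf_greatest cSup_least cInf_le_cSup)
      have "F t \<noteq> 0" if t: "t \<in> {0..1}" "t < Inf N \<or> Sup N < t"
      proof
        assume "F t = 0"
        with elim(1) t have "t \<in> N" by simp
        then have "Inf N \<le> t" "t \<le> Sup N" using bdd by (auto intro: cInf_lower cSup_upper)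
        with t show False by auto
      qed
      then show ?case using elim(2,3) IS by (auto split: split_indicator)
    qed
    finally show ?thesis .
  qed
qed

text \<open>Each fixed intermediate time is good for almost every curve; Fubini turns this into
  almost every curve being good at almost every time, which is what
  \<open>increment_le_nn_integral_nonzero\<close> asks for. This is the source of locality.\<close>

lemma weak_upper_gradient_nonzero:
  assumes m: "sets m = sets borel" and h: "h \<in> borel_measurable borel"
    and wug: "weak_upper_gradient m h G"
  shows "weak_upper_gradient m h (\<lambda>x. if h x = 0 then 0 else G x)"
  unfolding weak_upper_gradient_iff
proof (intro conjI allI impI)
  have L2: "G \<in> L2_fun m" using wug by (auto simp: weak_upper_gradient_def)
  note [measurable] = L2_fun_borel[OF m L2] h
  have "(\<lambda>x. if h x = 0 then 0 else G x) \<in> borel_measurable borel" by measurable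
  then have "(\<lambda>x. if h x = 0 then 0 else G x) \<in> borel_measurable m"
    using m by (simp cong: measurable_cong_sets)
  then show "(\<lambda>x. if h x = 0 then 0 else G x) \<in> L2_fun m"
    by (rule L2_fun_bound[OF L2 L2, of _ 1 1]) auto
  show "AE x in m. 0 \<le> (if h x = 0 then 0 else G x)"
    using wug unfolding weak_upper_gradient_iff by auto
  fix \<pi> assume \<pi>: "test_plan m \<pi>"
  interpret prob_space \<pi> using \<pi> by (rule test_plan_space)
  interpret pair_sigma_finite \<pi> lborel ..
  define c where "c t = max 0 (min 1 t)" for t :: real
  define SI where "SI = speed_integral (\<lambda>x. ennreal (G x))"
  define P where "P \<gamma> t \<longleftrightarrow> ennreal \<bar>h (\<gamma> (c t)) - h (\<gamma> 0)\<bar> \<le> SI \<gamma> 0 (c t) \<and>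
      ennreal \<bar>h (\<gamma> 1) - h (\<gamma> (c t))\<bar> \<le> SI \<gamma> (c t) 1" for \<gamma> t
  have c: "0 \<le> c t" "c t \<le> 1" for t by (auto simp: c_def)
  have "AE \<gamma> in \<pi>. P \<gamma> t" for t
    unfolding P_def SI_def using c[of t]
    by (intro AE_conjI weak_upper_gradient_AE_curve[OF wug m h \<pi>]) auto
  then have "AE t in lborel. AE \<gamma> in \<pi>. P \<gamma> t" by simp
  \<comment> \<open>Joint measurability of the good pairs of curve and time, the condition for
    exchanging the two quantifiers with \<open>AE_commute\<close>.\<close>
  moreover have "{x \<in> space (\<pi> \<Otimes>\<^sub>M lborel). P (fst x) (snd x)} \<in> sets (\<pi> \<Otimes>\<^sub>M lborel)"
  proof -
    have eq: "measurable (\<pi> \<Otimes>\<^sub>M lborel) N = measurable (curve_borel \<Otimes>\<^sub>M borel) N" for N :: "'z measure"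
      by (simp add: test_plan_measurable[OF \<pi>] cong: measurable_cong_sets)
    have [measurable]: "(\<lambda>x. fst x (c (snd x))) \<in> \<pi> \<Otimes>\<^sub>M lborel \<rightarrow>\<^sub>M borel"
      using measurable_curve_eval_pair unfolding c_def eq by (simp add: case_prod_beta')
    have [measurable]: "(\<lambda>x. fst x 0) \<in> \<pi> \<Otimes>\<^sub>M lborel \<rightarrow>\<^sub>M borel" "(\<lambda>x. fst x 1) \<in> \<pi> \<Otimes>\<^sub>M lborel \<rightarrow>\<^sub>M borel"
      unfolding eq by (rule measurable_compose[OF measurable_fst measurable_curve_eval], simp)+
    have [measurable]: "(\<lambda>x. SI (fst x) 0 (c (snd x))) \<in> borel_measurable (\<pi> \<Otimes>\<^sub>M lborel)"
    proof -
      have "(\<lambda>x. (fst x, 0, c (snd x))) \<in> curve_borel \<Otimes>\<^sub>M borel \<rightarrow>\<^sub>M (curve_borel :: (real \<Rightarrow> 'a) measure) \<Otimes>\<^sub>M (borel \<Otimes>\<^sub>M borel)"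
        unfolding c_def by measurable
      from measurable_compose[OF this measurable_speed_integral_pair[of "\<lambda>x. ennreal (G x)"]]
      show ?thesis using c by (simp add: SI_def eq)
    qed
    have [measurable]: "(\<lambda>x. SI (fst x) (c (snd x)) 1) \<in> borel_measurable (\<pi> \<Otimes>\<^sub>M lborel)"
    proof -
      have "(\<lambda>x. (fst x, c (snd x), 1)) \<in> curve_borel \<Otimes>\<^sub>M borel \<rightarrow>\<^sub>M (curve_borel :: (real \<Rightarrow> 'a) measure) \<Otimes>\<^sub>M (borel \<Otimes>\<^sub>M borel)"
        unfolding c_def by measurable
      from measurable_compose[OF this measurable_speed_integral_pair[of "\<lambda>x. ennreal (G x)"]]
      show ?thesis using c by (simp add: SI_def eq)
    qed
    show ?thesis unfolding P_def by measurable
  qed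
  ultimately have "AE \<gamma> in \<pi>. AE t in lborel. P \<gamma> t" by (subst AE_commute)
  moreover have "AE \<gamma> in \<pi>. ennreal \<bar>h (\<gamma> 1) - h (\<gamma> 0)\<bar> \<le> SI \<gamma> 0 1"
    unfolding SI_def by (intro weak_upper_gradient_AE_curve[OF wug m h \<pi>]) auto
  moreover have "AE \<gamma> in \<pi>. SI \<gamma> 0 1 < \<infinity>"
    unfolding SI_def by (rule AE_speed_integral_finite[OF \<pi> m L2])
  ultimately have "AE \<gamma> in \<pi>. ennreal \<bar>h (\<gamma> 1) - h (\<gamma> 0)\<bar>
      \<le> speed_integral (\<lambda>x. ennreal (if h x = 0 then 0 else G x)) \<gamma> 0 1"
    using AE_space
  proof eventually_elim
    case (elim \<gamma>)
    define g where "g t = ennreal (G (\<gamma> t)) * metric_speed \<gamma> t * indicator {0..1} t" for t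
    have gm: "g \<in> borel_measurable borel"
      unfolding g_def using elim(4)
      by (auto intro!: measurable_curve_integrand1 simp: test_plan_space[OF \<pi>])
    have si: "SI \<gamma> a b = (\<integral>\<^sup>+t\<in>{a..b}. g t \<partial>lborel)" if "0 \<le> a" "b \<le> 1" for a b
      unfolding SI_def speed_integral_def g_def using that
      by (intro nn_integral_cong) (auto split: split_indicator)
    have "ennreal \<bar>(h \<circ> \<gamma>) 1 - (h \<circ> \<gamma>) 0\<bar> \<le> (\<integral>\<^sup>+t\<in>{0..1}. (if (h \<circ> \<gamma>) t = 0 then 0 else g t) \<partial>lborel)"
    proof (rule increment_le_nn_integral_nonzero[OF gm])
      show "(\<integral>\<^sup>+t\<in>{0..1}. g t \<partial>lborel) < \<infinity>" "ennreal \<bar>(h \<circ> \<gamma>) 1 - (h \<circ> \<gamma>) 0\<bar> \<le> (\<integral>\<^sup>+t\<in>{0..1}. g t \<partial>lborel)"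
        using elim(2,3) by (simp_all add: si)
      show "AE t in lborel. t \<in> {0..1} \<longrightarrow> ennreal \<bar>(h \<circ> \<gamma>) t - (h \<circ> \<gamma>) 0\<bar> \<le> (\<integral>\<^sup>+r\<in>{0..t}. g r \<partial>lborel) \<and>
        ennreal \<bar>(h \<circ> \<gamma>) 1 - (h \<circ> \<gamma>) t\<bar> \<le> (\<integral>\<^sup>+r\<in>{t..1}. g r \<partial>lborel)"
        using elim(1) by eventually_elim (auto simp: P_def c_def si)
    qed
    also have "\<dots> = speed_integral (\<lambda>x. ennreal (if h x = 0 then 0 else G x)) \<gamma> 0 1"
      unfolding speed_integral_def by (intro nn_integral_cong) (auto simp: g_def split: split_indicator)
    finally show ?case by simp
  qed
  then show "(\<integral>\<^sup>+\<gamma>. ennreal \<bar>h (\<gamma> 1) - h (\<gamma> 0)\<bar> \<partial>\<pi>)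
      \<le> (\<integral>\<^sup>+\<gamma>. speed_integral (\<lambda>x. ennreal (if h x = 0 then 0 else G x)) \<gamma> 0 1 \<partial>\<pi>)"
    by (rule nn_integral_mono_AE)
qed

text \<open>Almost every curve satisfies the increment bounds for all n simultaneously and has a
  finite integral of \<open>H 0\<close>, so dominated convergence along the curve passes to the
  limit.\<close>

lemma weak_upper_gradient_INF:
  assumes m: "sets m = sets borel" and f: "f \<in> borel_measurable borel"
    and wug: "\<And>n. weak_upper_gradient m f (H n)"
    and pos: "\<And>n x. 0 \<le> H n x" and dec: "\<And>n x. H (Suc n) x \<le> H n x"
  shows "weak_upper_gradient m f (\<lambda>x. INF n. H n x)"
  unfolding weak_upper_gradient_iff
proof (intro conjI allI impI)
  let ?G = "\<lambda>x. INF n. H n x"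
  have L2: "H n \<in> L2_fun m" for n using wug by (auto simp: weak_upper_gradient_def)
  note [measurable] = L2_fun_borel[OF m L2]
  have bdd: "bdd_below (range (\<lambda>n. H n x))" for x using pos by (intro bdd_belowI[of _ 0]) auto
  have dec': "decseq (\<lambda>n. H n x)" for x using dec by (intro decseq_SucI)
  have lim: "(\<lambda>n. H n x) \<longlonglongrightarrow> ?G x" for x using bdd dec' by (rule LIMSEQ_decseq_INF)
  have le: "?G x \<le> H n x" "0 \<le> ?G x" for x n
    using bdd pos by (auto intro!: cINF_lower cINF_greatest)
  have gb: "?G \<in> borel_measurable borel"
    by (rule borel_measurable_LIMSEQ_real[OF lim]) measurable
  then have "?G \<in> borel_measurable m" using m by (simp cong: measurable_cong_sets)
  then show "?G \<in> L2_fun m"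
    by (rule L2_fun_bound[OF L2[of 0] L2[of 0], of _ 1 0]) (use le pos in auto)
  show "AE x in m. 0 \<le> ?G x" using le by simp
  fix \<pi> assume \<pi>: "test_plan m \<pi>"
  have "AE \<gamma> in \<pi>. \<forall>n. ennreal \<bar>f (\<gamma> 1) - f (\<gamma> 0)\<bar> \<le> speed_integral (\<lambda>x. ennreal (H n x)) \<gamma> 0 1"
    unfolding AE_all_countable by (intro allI weak_upper_gradient_AE_curve[OF wug m f \<pi>]) auto
  with AE_speed_integral_finite[OF \<pi> m L2[of 0]] AE_space
  have "AE \<gamma> in \<pi>. ennreal \<bar>f (\<gamma> 1) - f (\<gamma> 0)\<bar> \<le> speed_integral (\<lambda>x. ennreal (?G x)) \<gamma> 0 1"
  proof eventually_elim
    case (elim \<gamma>)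
    have ms: "\<gamma> \<in> mspace curve_metric" using elim(2) by (simp add: test_plan_space[OF \<pi>])
    let ?w = "\<lambda>G t. ennreal (G (\<gamma> t)) * metric_speed \<gamma> t * indicator {0..1} t"
    have meas: "?w (H n) \<in> borel_measurable lborel" "?w ?G \<in> borel_measurable lborel" for n
      using gb ms by (auto intro!: measurable_curve_integrand1 simp del: INF_apply)
    have fin: "(\<integral>\<^sup>+t. ?w (H 0) t \<partial>lborel) < \<infinity>" using elim(1) by (simp add: speed_integral_def)
    have "(\<lambda>n. \<integral>\<^sup>+t. ?w (H n) t \<partial>lborel) \<longlonglongrightarrow> (\<integral>\<^sup>+t. ?w ?G t \<partial>lborel)"
    proof (rule nn_integral_dominated_convergence[where w = "?w (H 0)"])
      have "H n x \<le> H 0 x" for n x using decseqD[OF dec'[of x], of 0 n] by simp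
      then show "AE t in lborel. ?w (H n) t \<le> ?w (H 0) t" for n
        by (intro AE_I2 mult_right_mono ennreal_leI) auto
      have "AE t in lborel. ?w (H 0) t \<noteq> \<infinity>"
        using meas(1) fin by (intro nn_integral_noteq_infinite) auto
      then show "AE t in lborel. (\<lambda>n. ?w (H n) t) \<longlonglongrightarrow> ?w ?G t"
      proof eventually_elim
        case (elim t)
        \<comment> \<open>Multiplication by infinity is discontinuous at 0. At times of infinite
          speed, finiteness of the product with \<open>H 0\<close> forces \<open>H 0\<close> and
          hence every term of the sequence to vanish, so the products are constantly 0.\<close>
        show ?case
        proof (cases "metric_speed \<gamma> t * indicator {0..1} t = \<infinity>")
          case True
          then have "H 0 (\<gamma> t) \<le> 0"
            using elim by (auto simp: mult.assoc ennreal_mult_eq_top_iff ennreal_eq_0_iff)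
          then have "H n (\<gamma> t) \<le> 0" for n using decseqD[OF dec'[of "\<gamma> t"], of 0 n] by simp
          moreover have "?G (\<gamma> t) \<le> 0" using le(1)[of "\<gamma> t" 0] \<open>H 0 (\<gamma> t) \<le> 0\<close> by simp
          ultimately show ?thesis by (simp add: ennreal_neg)
        next
          case False
          then show ?thesis
            unfolding mult.assoc by (intro tendsto_mult_ennreal tendsto_ennrealI lim tendsto_const) auto
        qed
      qed
    qed (use meas fin in auto)
    then show ?case
      using elim(3) by (intro tendsto_lowerbound[where F = sequentially])
        (auto intro!: always_eventually simp: speed_integral_def)
  qed
  then show "(\<integral>\<^sup>+\<gamma>. ennreal \<bar>f (\<gamma> 1) - f (\<gamma> 0)\<bar> \<partial>\<pi>) \<le> (\<integral>\<^sup>+\<gamma>. speed_integral (\<lambda>x. ennreal (?G x)) \<gamma> 0 1 \<partial>\<pi>)"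
    by (rule nn_integral_mono_AE)
qed

text \<open>A gradient K of least square integral is pointwise minimal: for any other gradient M,
  the minimum of K and M is again a gradient, so its square integral is not smaller; being below K,
  it equals K almost everywhere.\<close>

lemma ex_minimal_weak_upper_gradient:
  assumes m: "sets m = sets borel" and f: "f \<in> sobolev m"
  shows "\<exists>G. weak_upper_gradient m f G \<and>
    (\<forall>H. weak_upper_gradient m f H \<longrightarrow> (AE x in m. G x \<le> H x))"
proof -
  have fL: "f \<in> L2_fun m" and "\<exists>G. weak_upper_gradient m f G" using f by (auto simp: sobolev_def)
  then have ne: "{G. weak_upper_gradient m f G} \<noteq> {}" by blast
  have fb: "f \<in> borel_measurable borel" by (rule L2_fun_borel[OF m fL])
  define J where "J G = (LINT x|m. (G x)\<^sup>2)" for G :: "'a \<Rightarrow> real"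
  define I where "I = (INF G\<in>{G. weak_upper_gradient m f G}. J G)"
  have Jpos: "0 \<le> J G" for G unfolding J_def by simp
  then have bdd: "bdd_below (J ` {G. weak_upper_gradient m f G})" by (intro bdd_belowI[of _ 0]) auto
  have I_le: "I \<le> J G" if "weak_upper_gradient m f G" for G
    unfolding I_def using bdd that by (intro cINF_lower) auto
  have "\<exists>G. weak_upper_gradient m f G \<and> J G < I + inverse (real (Suc n))" for n
  proof -
    have "I < I + inverse (real (Suc n))" by simp
    then show ?thesis
      using cINF_less_iff[OF ne bdd, of "I + inverse (real (Suc n))"] unfolding I_def[symmetric] by auto
  qed
  then obtain G where G: "\<And>n. weak_upper_gradient m f (G n)" "\<And>n. J (G n) < I + inverse (real (Suc n))"
    by metis
  \<comment> \<open>Running minima of a minimizing sequence: they remain gradients and decrease, so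
    their infimum is a gradient. Truncation at 0 makes them nonnegative everywhere and not just
    almost everywhere.\<close>
  define H where "H = rec_nat (\<lambda>x. max 0 (G 0 x)) (\<lambda>n h x. min (h x) (max 0 (G (Suc n) x)))"
  have H0: "H 0 = (\<lambda>x. max 0 (G 0 x))" and HS: "H (Suc n) = (\<lambda>x. min (H n x) (max 0 (G (Suc n) x)))" for n
    by (auto simp: H_def)
  have wmax: "weak_upper_gradient m f (\<lambda>x. max 0 (K x))" if "weak_upper_gradient m f K" for K
    using weak_upper_gradient_combine[OF m fL that fL that, of 1 0 f] by simp
  have wH: "weak_upper_gradient m f (H n)" for n
    by (induction n) (auto simp: H0 HS intro!: wmax G weak_upper_gradient_min[OF m fb])
  have Hpos: "0 \<le> H n x" for n x by (induction n) (auto simp: H0 HS)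
  have HG: "H n x \<le> max 0 (G n x)" for n x by (cases n) (auto simp: H0 HS)
  define K where "K x = (INF n. H n x)" for x
  have wK: "weak_upper_gradient m f K"
    unfolding K_def[abs_def] by (rule weak_upper_gradient_INF[OF m fb wH Hpos]) (simp add: HS)
  have sq: "integrable m (\<lambda>x. (M x)\<^sup>2)" if "weak_upper_gradient m f M" for M
    using that by (auto simp: weak_upper_gradient_def L2_fun_def)
  have KH: "0 \<le> K x" "K x \<le> H n x" for n x
    unfolding K_def using Hpos by (auto intro!: cINF_greatest cINF_lower bdd_belowI[of _ 0])
  have "J K \<le> I + inverse (real (Suc n))" for n
  proof -
    have "J K \<le> J (G n)"
      unfolding J_def
    proof (rule integral_mono[OF sq[OF wK] sq[OF G(1)]])
      fix x
      have "K x \<le> \<bar>G n x\<bar>" using KH(2)[of x n] HG[of n x] by linarith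
      then show "(K x)\<^sup>2 \<le> (G n x)\<^sup>2" using KH(1)[of x] abs_le_square_iff[of "K x" "G n x"] by simp
    qed
    then show ?thesis using G(2)[of n] by simp
  qed
  moreover have "(\<lambda>n. I + inverse (real (Suc n))) \<longlonglongrightarrow> I"
    using tendsto_add[OF tendsto_const LIMSEQ_inverse_real_of_nat, of I] by simp
  ultimately have JK: "J K \<le> I"
    by (intro tendsto_lowerbound[where F = sequentially]) (auto intro!: always_eventually)
  show ?thesis
  proof (intro exI[of _ K] conjI allI impI wK)
    fix M assume wM: "weak_upper_gradient m f M"
    define L where "L x = min (K x) (M x)" for x
    have wL: "weak_upper_gradient m f L"
      unfolding L_def[abs_def] by (rule weak_upper_gradient_min[OF m fb wK wM])
    have Lpos: "AE x in m. 0 \<le> L x" using wL by (simp add: weak_upper_gradient_def)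
    have nn: "AE x in m. 0 \<le> (K x)\<^sup>2 - (L x)\<^sup>2"
      using Lpos by eventually_elim (simp add: L_def power_mono)
    have int: "integrable m (\<lambda>x. (K x)\<^sup>2 - (L x)\<^sup>2)" using sq[OF wK] sq[OF wL] by simp
    have "(LINT x|m. (K x)\<^sup>2 - (L x)\<^sup>2) = J K - J L"
      unfolding J_def using sq[OF wK] sq[OF wL] by simp
    also have "\<dots> \<le> 0" using JK I_le[OF wL] by simp
    finally have "(LINT x|m. (K x)\<^sup>2 - (L x)\<^sup>2) = 0"
      using integral_nonneg_AE[OF nn] by simp
    then have "AE x in m. (K x)\<^sup>2 - (L x)\<^sup>2 = 0"
      using integral_nonneg_eq_0_iff_AE[OF int nn] by simp
    with Lpos show "AE x in m. K x \<le> M x"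
    proof eventually_elim
      case (elim x)
      then have "K x = L x" using KH(1)[of x] by (simp add: power2_eq_iff_nonneg)
      then show ?case by (simp add: L_def)
    qed
  qed
qed

section \<open>Minimal weak upper gradients\<close>

lemma min_wug:
  assumes "sets m = sets borel" "f \<in> sobolev m"
  shows "weak_upper_gradient m f (min_wug m f)"
    and "weak_upper_gradient m f H \<Longrightarrow> AE x in m. min_wug m f x \<le> H x"
  using someI_ex[OF ex_minimal_weak_upper_gradient[OF assms]] unfolding min_wug_def[symmetric] by blast+

lemma min_wug_nonneg:
  assumes "sets m = sets borel" "f \<in> sobolev m"
  shows "AE x in m. 0 \<le> min_wug m f x"
  using min_wug(1)[OF assms] by (simp add: weak_upper_gradient_def)

lemma min_wug_L2:
  assumes "sets m = sets borel" "f \<in> sobolev m"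
  shows "min_wug m f \<in> borel_measurable m" "integrable m (\<lambda>x. (min_wug m f x)\<^sup>2)"
  using min_wug(1)[OF assms] by (auto simp: weak_upper_gradient_def L2_fun_def)

section \<open>The Sobolev functions as a vector lattice\<close>

lemma sobolev_combine:
  assumes m: "sets m = sets borel" and f: "f \<in> sobolev m" and g: "g \<in> sobolev m"
    and h: "h \<in> borel_measurable m" and ab: "0 \<le> a" "0 \<le> b"
    and bound: "\<And>x. \<bar>h x\<bar> \<le> a * \<bar>f x\<bar> + b * \<bar>g x\<bar>"
    and lip: "\<And>x y. \<bar>h x - h y\<bar> \<le> a * \<bar>f x - f y\<bar> + b * \<bar>g x - g y\<bar>"
  shows "h \<in> sobolev m" "AE x in m. min_wug m h x \<le> a * min_wug m f x + b * min_wug m g x"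
proof -
  have L2: "f \<in> L2_fun m" "g \<in> L2_fun m" using f g by (auto simp: sobolev_def)
  have w: "weak_upper_gradient m h (\<lambda>x. a * max 0 (min_wug m f x) + b * max 0 (min_wug m g x))"
    by (rule weak_upper_gradient_combine[OF m L2(1) min_wug(1)[OF m f] L2(2) min_wug(1)[OF m g] ab lip])
  have "h \<in> L2_fun m" by (rule L2_fun_bound[OF L2 h bound])
  then show hs: "h \<in> sobolev m" using w by (auto simp: sobolev_def)
  show "AE x in m. min_wug m h x \<le> a * min_wug m f x + b * min_wug m g x"
    using min_wug(2)[OF m hs w] min_wug_nonneg[OF m f] min_wug_nonneg[OF m g]
    by eventually_elim (simp add: max_def)
qed

lemma sobolev_measurable: "f \<in> sobolev m \<Longrightarrow> f \<in> borel_measurable m"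
  by (simp add: sobolev_def L2_fun_def)

lemma sobolev_linear_combination:
  assumes "sets m = sets borel" "f \<in> sobolev m" "g \<in> sobolev m"
  shows "(\<lambda>x. a * f x + b * g x) \<in> sobolev m"
    and "AE x in m. min_wug m (\<lambda>x. a * f x + b * g x) x \<le> \<bar>a\<bar> * min_wug m f x + \<bar>b\<bar> * min_wug m g x"
proof -
  have 1: "\<bar>a * p + b * q\<bar> \<le> \<bar>a\<bar> * \<bar>p\<bar> + \<bar>b\<bar> * \<bar>q\<bar>" for p q
    using abs_triangle_ineq[of "a * p" "b * q"] by (simp add: abs_mult)
  have 2: "\<bar>a * p + b * q - (a * p' + b * q')\<bar> \<le> \<bar>a\<bar> * \<bar>p - p'\<bar> + \<bar>b\<bar> * \<bar>q - q'\<bar>" for p q p' q'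
    using 1[of "p - p'" "q - q'"] by (simp add: algebra_simps)
  have m: "(\<lambda>x. a * f x + b * g x) \<in> borel_measurable m"
    using sobolev_measurable assms by measurable
  show "(\<lambda>x. a * f x + b * g x) \<in> sobolev m"
    by (rule sobolev_combine(1)[OF assms m abs_ge_zero abs_ge_zero 1 2])
  show "AE x in m. min_wug m (\<lambda>x. a * f x + b * g x) x \<le> \<bar>a\<bar> * min_wug m f x + \<bar>b\<bar> * min_wug m g x"
    by (rule sobolev_combine(2)[OF assms m abs_ge_zero abs_ge_zero 1 2])
qed

lemma sobolev_max_min:
  assumes "sets m = sets borel" "f \<in> sobolev m" "g \<in> sobolev m"
  shows "(\<lambda>x. max (f x) (g x)) \<in> sobolev m" "(\<lambda>x. min (f x) (g x)) \<in> sobolev m"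
proof -
  have "f \<in> borel_measurable m" "g \<in> borel_measurable m"
    using assms by (auto intro: sobolev_measurable)
  note [measurable] = this
  show "(\<lambda>x. max (f x) (g x)) \<in> sobolev m"
  proof (rule sobolev_combine(1)[OF assms])
    show "\<bar>max (f x) (g x)\<bar> \<le> 1 * \<bar>f x\<bar> + 1 * \<bar>g x\<bar>"
      and "\<bar>max (f x) (g x) - max (f y) (g y)\<bar> \<le> 1 * \<bar>f x - f y\<bar> + 1 * \<bar>g x - g y\<bar>" for x y
      by (auto simp: max_def)
  qed auto
  show "(\<lambda>x. min (f x) (g x)) \<in> sobolev m"
  proof (rule sobolev_combine(1)[OF assms])
    show "\<bar>min (f x) (g x)\<bar> \<le> 1 * \<bar>f x\<bar> + 1 * \<bar>g x\<bar>"
      and "\<bar>min (f x) (g x) - min (f y) (g y)\<bar> \<le> 1 * \<bar>f x - f y\<bar> + 1 * \<bar>g x - g y\<bar>" for x y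
      by (auto simp: min_def)
  qed auto
qed

lemma sobolev0_subset: "f \<in> sobolev0 m \<Omega> \<Longrightarrow> f \<in> sobolev m"
  by (simp add: sobolev0_def)

lemma sobolev0_UNIV: "sobolev0 m UNIV = sobolev m"
  by (simp add: sobolev0_def)

lemma sobolev0_linear_combination:
  assumes "sets m = sets borel" "f \<in> sobolev0 m \<Omega>" "g \<in> sobolev0 m \<Omega>"
  shows "(\<lambda>x. a * f x + b * g x) \<in> sobolev0 m \<Omega>"
proof -
  have "AE x in m. x \<notin> \<Omega> \<longrightarrow> f x = 0" "AE x in m. x \<notin> \<Omega> \<longrightarrow> g x = 0"
    using assms by (auto simp: sobolev0_def)
  then have "AE x in m. x \<notin> \<Omega> \<longrightarrow> a * f x + b * g x = 0" by eventually_elim simp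
  then show ?thesis
    using assms sobolev_linear_combination(1)[OF assms(1)] by (auto simp: sobolev0_def)
qed

lemma sobolev0_max_min:
  assumes "sets m = sets borel" "f \<in> sobolev0 m \<Omega>" "g \<in> sobolev0 m \<Omega>"
  shows "(\<lambda>x. max (f x) (g x)) \<in> sobolev0 m \<Omega>" "(\<lambda>x. min (f x) (g x)) \<in> sobolev0 m \<Omega>"
proof -
  have 0: "AE x in m. x \<notin> \<Omega> \<longrightarrow> f x = 0" "AE x in m. x \<notin> \<Omega> \<longrightarrow> g x = 0"
    using assms by (auto simp: sobolev0_def)
  from 0 have "AE x in m. x \<notin> \<Omega> \<longrightarrow> max (f x) (g x) = 0" by eventually_elim simp
  moreover from 0 have "AE x in m. x \<notin> \<Omega> \<longrightarrow> min (f x) (g x) = 0" by eventually_elim simp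
  ultimately show "(\<lambda>x. max (f x) (g x)) \<in> sobolev0 m \<Omega>" "(\<lambda>x. min (f x) (g x)) \<in> sobolev0 m \<Omega>"
    using assms sobolev_max_min[OF assms(1)] by (auto simp: sobolev0_def)
qed

lemma sobolev0_cmult:
  assumes "sets m = sets borel" "f \<in> sobolev0 m \<Omega>"
  shows "(\<lambda>x. c * f x) \<in> sobolev0 m \<Omega>"
  using sobolev0_linear_combination[OF assms(1,2,2), of c 0] by simp

lemma sobolev0_add:
  assumes "sets m = sets borel" "f \<in> sobolev0 m \<Omega>" "g \<in> sobolev0 m \<Omega>"
  shows "(\<lambda>x. f x + g x) \<in> sobolev0 m \<Omega>"
  using sobolev0_linear_combination[OF assms, of 1 1] by simp

lemma sobolev0_diff:
  assumes "sets m = sets borel" "f \<in> sobolev0 m \<Omega>" "g \<in> sobolev0 m \<Omega>"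
  shows "(\<lambda>x. f x - g x) \<in> sobolev0 m \<Omega>"
  using sobolev0_linear_combination[OF assms, of 1 "- 1"] by simp

lemma sobolev0_pos_neg_part:
  assumes "sets m = sets borel" "f \<in> sobolev0 m \<Omega>"
  shows "(\<lambda>x. max (f x) 0) \<in> sobolev0 m \<Omega>" "(\<lambda>x. max (- f x) 0) \<in> sobolev0 m \<Omega>"
  using sobolev0_max_min(1)[OF assms sobolev0_cmult[OF assms, of 0]]
    sobolev0_max_min(1)[OF assms(1) sobolev0_cmult[OF assms, of "- 1"] sobolev0_cmult[OF assms, of 0]]
  by simp_all

text \<open>The minimal gradient is compared with its own cut-off to the set where f does not
  vanish, which is still a weak upper gradient.\<close>

lemma min_wug_eq_0:
  assumes m: "sets m = sets borel" and f: "f \<in> sobolev m"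
  shows "AE x in m. f x = 0 \<longrightarrow> min_wug m f x = 0"
proof -
  have "f \<in> borel_measurable borel"
    using L2_fun_borel[OF m] f by (simp add: sobolev_def)
  from min_wug(2)[OF m f weak_upper_gradient_nonzero[OF m this min_wug(1)[OF m f]]] min_wug_nonneg[OF m f]
  show ?thesis by eventually_elim auto
qed

text \<open>The gradient of d = f - g vanishes where f = g. Subadditivity for f = d + g and for g =
  f - d then gives both inequalities there.\<close>

lemma min_wug_local:
  assumes m: "sets m = sets borel" and f: "f \<in> sobolev m" and g: "g \<in> sobolev m"
  shows "AE x in m. f x = g x \<longrightarrow> min_wug m f x = min_wug m g x"
proof -
  define d where "d x = 1 * f x + (- 1) * g x" for x
  have d: "d \<in> sobolev m" unfolding d_def by (rule sobolev_linear_combination(1)[OF m f g])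
  have "f = (\<lambda>x. 1 * d x + 1 * g x)" "g = (\<lambda>x. 1 * f x + (- 1) * d x)" by (auto simp: d_def)
  then have "AE x in m. min_wug m f x \<le> min_wug m d x + min_wug m g x"
    "AE x in m. min_wug m g x \<le> min_wug m f x + min_wug m d x"
    using sobolev_linear_combination(2)[OF m d g, of 1 1]
      sobolev_linear_combination(2)[OF m f d, of 1 "- 1"] by simp_all
  with min_wug_eq_0[OF m d] show ?thesis
    by eventually_elim (auto simp: d_def)
qed

text \<open>The sum f + g vanishes outside \<Omega>, hence so does its gradient, and integrating
  over \<Omega> or over X gives the same. The subdifferential of the local energy can thus be
  computed from the global energy.\<close>

lemma local_energy_eq:
  assumes m: "sets m = sets borel" and \<Omega>: "open \<Omega>" and fg: "f \<in> sobolev0 m \<Omega>" "g \<in> sobolev0 m \<Omega>"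
  shows "local_energy m \<Omega> f g = energy m (\<lambda>x. f x + g x)"
proof -
  define h where "h x = f x + g x" for x
  have h: "h \<in> sobolev0 m \<Omega>" unfolding h_def by (rule sobolev0_add[OF m fg])
  have h': "h \<in> sobolev m" using h by (rule sobolev0_subset)
  have [measurable]: "min_wug m h \<in> borel_measurable m" by (rule min_wug_L2[OF m h'])
  have [measurable]: "\<Omega> \<in> sets m" using m \<Omega> by simp
  have "AE x in m. x \<notin> \<Omega> \<longrightarrow> h x = 0" using h by (simp add: sobolev0_def)
  with min_wug_eq_0[OF m h'] have "AE x in m. indicator \<Omega> x *\<^sub>R (min_wug m h x)\<^sup>2 = (min_wug m h x)\<^sup>2"
    by eventually_elim (auto split: split_indicator)
  then have "(LINT x:\<Omega>|m. (min_wug m h x)\<^sup>2) = (LINT x|m. (min_wug m h x)\<^sup>2)"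
    unfolding set_lebesgue_integral_def by (intro integral_cong_AE) auto
  then show ?thesis
    unfolding local_energy_def energy_def h_def[abs_def] by simp
qed

text \<open>The minimal gradient is subadditive and absolutely homogeneous up to inequality;
  convexity of the square does the rest.\<close>

lemma energy_convex:
  assumes m: "sets m = sets borel" and f: "f \<in> sobolev m" and g: "g \<in> sobolev m" and t: "0 \<le> t" "t \<le> 1"
  shows "energy m (\<lambda>x. (1 - t) * f x + t * g x) \<le> (1 - t) * energy m f + t * energy m g"
proof -
  define h where "h x = (1 - t) * f x + t * g x" for x
  have h: "h \<in> sobolev m" unfolding h_def by (rule sobolev_linear_combination(1)[OF m f g])
  have "AE x in m. min_wug m h x \<le> (1 - t) * min_wug m f x + t * min_wug m g x"
    using sobolev_linear_combination(2)[OF m f g, of "1 - t" t] t unfolding h_def[abs_def] by simp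
  with min_wug_nonneg[OF m h]
  have "AE x in m. (min_wug m h x)\<^sup>2 \<le> (1 - t) * (min_wug m f x)\<^sup>2 + t * (min_wug m g x)\<^sup>2"
  proof eventually_elim
    case (elim x)
    define p q where "p = min_wug m f x" and "q = min_wug m g x"
    have "(min_wug m h x)\<^sup>2 \<le> ((1 - t) * p + t * q)\<^sup>2"
      using elim by (intro power_mono) (auto simp: p_def q_def)
    also have "\<dots> = (1 - t) * p\<^sup>2 + t * q\<^sup>2 - t * (1 - t) * (p - q)\<^sup>2"
      by (simp add: power2_eq_square algebra_simps)
    also have "\<dots> \<le> (1 - t) * p\<^sup>2 + t * q\<^sup>2" using t by simp
    finally show ?case by (simp add: p_def q_def)
  qed
  then have "(LINT x|m. (min_wug m h x)\<^sup>2) \<le> (LINT x|m. (1 - t) * (min_wug m f x)\<^sup>2 + t * (min_wug m g x)\<^sup>2)"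
    using min_wug_L2[OF m h] min_wug_L2[OF m f] min_wug_L2[OF m g] by (intro integral_mono_AE) auto
  also have "\<dots> = (1 - t) * (LINT x|m. (min_wug m f x)\<^sup>2) + t * (LINT x|m. (min_wug m g x)\<^sup>2)"
    using min_wug_L2[OF m f] min_wug_L2[OF m g] by simp
  finally have "(1/2) * (LINT x|m. (min_wug m h x)\<^sup>2) \<le>
      (1/2) * ((1 - t) * (LINT x|m. (min_wug m f x)\<^sup>2) + t * (LINT x|m. (min_wug m g x)\<^sup>2))"
    by (rule mult_left_mono) simp
  also have "\<dots> = (1 - t) * energy m f + t * energy m g"
    unfolding energy_def by (simp add: field_simps)
  finally show ?thesis unfolding energy_def h_def[abs_def] .
qed

text \<open>At almost every point the gradients of the maximum and the minimum are, by locality,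
  those of f and g in one order or the other, so the sums of squares agree pointwise.\<close>

lemma energy_max_min:
  assumes m: "sets m = sets borel" and f: "f \<in> sobolev m" and g: "g \<in> sobolev m"
  shows "energy m (\<lambda>x. max (f x) (g x)) + energy m (\<lambda>x. min (f x) (g x)) = energy m f + energy m g"
proof -
  define p q where "p x = max (f x) (g x)" and "q x = min (f x) (g x)" for x
  have pq: "p \<in> sobolev m" "q \<in> sobolev m"
    unfolding p_def q_def by (rule sobolev_max_min[OF m f g])+
  have ae: "AE x in m. (min_wug m p x)\<^sup>2 + (min_wug m q x)\<^sup>2 = (min_wug m f x)\<^sup>2 + (min_wug m g x)\<^sup>2"
    using min_wug_local[OF m pq(1) f] min_wug_local[OF m pq(1) g]
      min_wug_local[OF m pq(2) f] min_wug_local[OF m pq(2) g]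
    by eventually_elim (auto simp: p_def q_def max_def min_def split: if_splits)
  note L2 = min_wug_L2[OF m pq(1)] min_wug_L2[OF m pq(2)] min_wug_L2[OF m f] min_wug_L2[OF m g]
  have "(LINT x|m. (min_wug m p x)\<^sup>2) + (LINT x|m. (min_wug m q x)\<^sup>2)
      = (LINT x|m. (min_wug m p x)\<^sup>2 + (min_wug m q x)\<^sup>2)" using L2 by simp
  also have "\<dots> = (LINT x|m. (min_wug m f x)\<^sup>2 + (min_wug m g x)\<^sup>2)"
    using L2 ae by (intro integral_cong_AE) auto
  also have "\<dots> = (LINT x|m. (min_wug m f x)\<^sup>2) + (LINT x|m. (min_wug m g x)\<^sup>2)" using L2 by simp
  finally show ?thesis unfolding energy_def p_def[abs_def] q_def[abs_def] by (simp add: algebra_simps)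
qed

text \<open>Contractions do not increase the norm. Applied to positive and negative parts, this
  gives the norm bound for \<open>dual_sup\<close>.\<close>

lemma sobolev_norm_mono:
  assumes m: "sets m = sets borel" and f: "f \<in> sobolev m" and h: "h \<in> borel_measurable m"
    and bound: "\<And>x. \<bar>h x\<bar> \<le> \<bar>f x\<bar>" and lip: "\<And>x y. \<bar>h x - h y\<bar> \<le> \<bar>f x - f y\<bar>"
  shows "sobolev_norm m h \<le> sobolev_norm m f"
proof -
  have hs: "h \<in> sobolev m" and "AE x in m. min_wug m h x \<le> 1 * min_wug m f x + 0 * min_wug m f x"
    using sobolev_combine[OF m f f h, of 1 0] bound lip by simp_all
  with min_wug_nonneg[OF m hs] have "AE x in m. (min_wug m h x)\<^sup>2 \<le> (min_wug m f x)\<^sup>2"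
    by (auto elim!: eventually_elim2 intro!: power_mono)
  then have 1: "(LINT x|m. (min_wug m h x)\<^sup>2) \<le> (LINT x|m. (min_wug m f x)\<^sup>2)"
    using min_wug_L2[OF m hs] min_wug_L2[OF m f] by (intro integral_mono_AE) auto
  have "integrable m (\<lambda>x. (h x)\<^sup>2)" "integrable m (\<lambda>x. (f x)\<^sup>2)"
    using hs f by (auto simp: sobolev_def L2_fun_def)
  then have 2: "(LINT x|m. (h x)\<^sup>2) \<le> (LINT x|m. (f x)\<^sup>2)"
    using bound by (intro integral_mono) (auto simp: abs_le_square_iff)
  show ?thesis unfolding sobolev_norm_def using 1 2 by (intro real_sqrt_le_mono add_mono)
qed

lemma sobolev_norm_eq_0:
  assumes m: "sets m = sets borel" and f: "f \<in> sobolev m" and 0: "AE x in m. f x = 0"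
  shows "sobolev_norm m f = 0"
proof -
  have "AE x in m. (f x)\<^sup>2 = 0" "AE x in m. (min_wug m f x)\<^sup>2 = 0"
    using 0 min_wug_eq_0[OF m f] by auto
  then have "(LINT x|m. (f x)\<^sup>2) = 0" "(LINT x|m. (min_wug m f x)\<^sup>2) = 0"
    by (simp_all add: integral_eq_zero_AE)
  then show ?thesis by (simp add: sobolev_norm_def)
qed

section \<open>The order dual\<close>

definition nonneg_cone :: "'a::polish_space measure \<Rightarrow> 'a set \<Rightarrow> ('a \<Rightarrow> real) set" where
  "nonneg_cone m \<Omega> = {v \<in> sobolev0 m \<Omega>. AE x in m. 0 \<le> v x}"

lemma dual_add:
  "L \<in> sobolev0_dual m \<Omega> \<Longrightarrow> f \<in> sobolev0 m \<Omega> \<Longrightarrow> g \<in> sobolev0 m \<Omega> \<Longrightarrow> L (\<lambda>x. f x + g x) = L f + L g"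
  by (simp add: sobolev0_dual_def)

lemma dual_cmult:
  "L \<in> sobolev0_dual m \<Omega> \<Longrightarrow> f \<in> sobolev0 m \<Omega> \<Longrightarrow> L (\<lambda>x. c * f x) = c * L f"
  by (simp add: sobolev0_dual_def)

lemma dual_bound:
  assumes "L \<in> sobolev0_dual m \<Omega>"
  obtains C where "0 \<le> C" "\<And>f. f \<in> sobolev0 m \<Omega> \<Longrightarrow> \<bar>L f\<bar> \<le> C * sobolev_norm m f"
proof -
  obtain C where C: "\<forall>f\<in>sobolev0 m \<Omega>. \<bar>L f\<bar> \<le> C * sobolev_norm m f"
    using assms unfolding sobolev0_dual_def by blast
  have "\<bar>L f\<bar> \<le> \<bar>C\<bar> * sobolev_norm m f" if "f \<in> sobolev0 m \<Omega>" for f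
  proof -
    have "0 \<le> sobolev_norm m f" by (simp add: sobolev_norm_def)
    then have "C * sobolev_norm m f \<le> \<bar>C\<bar> * sobolev_norm m f" by (intro mult_right_mono) auto
    with C that show ?thesis by force
  qed
  then show thesis by (intro that[of "\<bar>C\<bar>"]) auto
qed

lemma dual_null:
  assumes m: "sets m = sets borel" and L: "L \<in> sobolev0_dual m \<Omega>"
    and f: "f \<in> sobolev0 m \<Omega>" "AE x in m. f x = 0"
  shows "L f = 0"
proof -
  obtain C where "\<bar>L f\<bar> \<le> C * sobolev_norm m f" using dual_bound[OF L] f by blast
  then show ?thesis using sobolev_norm_eq_0[OF m sobolev0_subset[OF f(1)] f(2)] by simp
qed

lemma dual_linear_combination:
  assumes L: "L \<in> sobolev0_dual m \<Omega>" and M: "M \<in> sobolev0_dual m \<Omega>"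
  shows "(\<lambda>v. a * L v + b * M v) \<in> sobolev0_dual m \<Omega>"
proof -
  obtain C where C: "0 \<le> C" "\<And>f. f \<in> sobolev0 m \<Omega> \<Longrightarrow> \<bar>L f\<bar> \<le> C * sobolev_norm m f"
    using dual_bound[OF L] by blast
  obtain D where D: "0 \<le> D" "\<And>f. f \<in> sobolev0 m \<Omega> \<Longrightarrow> \<bar>M f\<bar> \<le> D * sobolev_norm m f"
    using dual_bound[OF M] by blast
  have "\<bar>a * L f + b * M f\<bar> \<le> (\<bar>a\<bar> * C + \<bar>b\<bar> * D) * sobolev_norm m f" if f: "f \<in> sobolev0 m \<Omega>" for f
  proof -
    have "\<bar>a * L f + b * M f\<bar> \<le> \<bar>a\<bar> * \<bar>L f\<bar> + \<bar>b\<bar> * \<bar>M f\<bar>"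
      using abs_triangle_ineq[of "a * L f" "b * M f"] by (simp add: abs_mult)
    also have "\<dots> \<le> \<bar>a\<bar> * (C * sobolev_norm m f) + \<bar>b\<bar> * (D * sobolev_norm m f)"
      using C(2)[OF f] D(2)[OF f] by (intro add_mono mult_left_mono) auto
    finally show ?thesis by (simp add: algebra_simps)
  qed
  then have "\<exists>C. \<forall>f\<in>sobolev0 m \<Omega>. \<bar>a * L f + b * M f\<bar> \<le> C * sobolev_norm m f" by blast
  then show ?thesis
    using L M unfolding sobolev0_dual_def by (simp add: algebra_simps)
qed

lemma dual_pos_cone_mono:
  assumes m: "sets m = sets borel" and P: "P \<in> dual_pos_cone m \<Omega>"
    and fg: "f \<in> sobolev0 m \<Omega>" "g \<in> sobolev0 m \<Omega>" "AE x in m. f x \<le> g x"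
  shows "P f \<le> P g"
proof -
  have L: "P \<in> sobolev0_dual m \<Omega>" using P by (simp add: dual_pos_cone_def)
  have d: "(\<lambda>x. g x - f x) \<in> sobolev0 m \<Omega>" by (rule sobolev0_diff[OF m fg(2,1)])
  have "0 \<le> P (\<lambda>x. g x - f x)"
    using P d fg(3) by (auto simp: dual_pos_cone_def)
  moreover have "P g = P f + P (\<lambda>x. g x - f x)"
    using dual_add[OF L fg(1) d] by simp
  ultimately show ?thesis by simp
qed

text \<open>The Riesz-Kantorovich construction of the positive part of L. The chosen decomposition
  matters through P: it dominates L on the cone, so the suprema are finite and the result inherits
  the norm bound of P.\<close>

locale order_dual_element =
  fixes m :: "'a::polish_space measure" and \<Omega> :: "'a set" and L P Q :: "('a \<Rightarrow> real) \<Rightarrow> real"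
  assumes m: "sets m = sets borel"
    and P: "P \<in> dual_pos_cone m \<Omega>" and Q: "Q \<in> dual_pos_cone m \<Omega>"
    and L_eq: "L = (\<lambda>v. P v - Q v)"
begin

abbreviation seg where "seg v \<equiv> order_segment m \<Omega> (\<lambda>_. 0) v"

text \<open>The supremum from \<open>dual_sup\<close> with second argument 0, before its extension
  from the cone to all of W0.\<close>

definition S where "S v = (SUP z\<in>seg v. L z)"

lemma P_dual: "P \<in> sobolev0_dual m \<Omega>" and Q_dual: "Q \<in> sobolev0_dual m \<Omega>"
  using P Q by (simp_all add: dual_pos_cone_def)

lemma L_dual: "L \<in> sobolev0_dual m \<Omega>"
  using dual_linear_combination[OF P_dual Q_dual, of 1 "- 1"] by (simp add: L_eq)

lemma zero_in: "v \<in> sobolev0 m \<Omega> \<Longrightarrow> (\<lambda>_. 0) \<in> sobolev0 m \<Omega>"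
  using sobolev0_cmult[OF m, of v \<Omega> 0] by simp

lemma seg_D:
  assumes "z \<in> seg v"
  shows "z \<in> sobolev0 m \<Omega>" "AE x in m. 0 \<le> z x" "AE x in m. z x \<le> v x"
  using assms by (auto simp: order_segment_def)

lemma L_le_P:
  assumes "v \<in> nonneg_cone m \<Omega>" "z \<in> seg v"
  shows "L z \<le> P v"
proof -
  have "0 \<le> Q z" using Q seg_D[OF assms(2)] by (simp add: dual_pos_cone_def)
  moreover have "P z \<le> P v"
    using assms seg_D[OF assms(2)] by (intro dual_pos_cone_mono[OF m P]) (auto simp: nonneg_cone_def)
  ultimately show ?thesis by (simp add: L_eq)
qed

lemma bdd: "v \<in> nonneg_cone m \<Omega> \<Longrightarrow> bdd_above (L ` seg v)"
  using L_le_P by (intro bdd_aboveI2)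

lemma zero_seg: "v \<in> nonneg_cone m \<Omega> \<Longrightarrow> (\<lambda>_. 0) \<in> seg v"
  using zero_in by (auto simp: order_segment_def nonneg_cone_def)

lemma L_le_S: "v \<in> nonneg_cone m \<Omega> \<Longrightarrow> z \<in> seg v \<Longrightarrow> L z \<le> S v"
  unfolding S_def using bdd by (intro cSUP_upper)

lemma S_least: "v \<in> nonneg_cone m \<Omega> \<Longrightarrow> (\<And>z. z \<in> seg v \<Longrightarrow> L z \<le> c) \<Longrightarrow> S v \<le> c"
  unfolding S_def using zero_seg by (intro cSUP_least) auto

lemma S_le_P: "v \<in> nonneg_cone m \<Omega> \<Longrightarrow> S v \<le> P v"
  by (rule S_least) (auto intro: L_le_P)

lemma S_nonneg: "v \<in> nonneg_cone m \<Omega> \<Longrightarrow> 0 \<le> S v"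
  using L_le_S[OF _ zero_seg] dual_null[OF m L_dual zero_in] by (fastforce simp: nonneg_cone_def)

text \<open>The Riesz decomposition property: any 0 \<le> z \<le> v + w splits into min z v, which
  lies below v, and the remainder, which lies below w. The converse inequality adds competitors for
  v and w.\<close>

lemma S_add:
  assumes v: "v \<in> nonneg_cone m \<Omega>" and w: "w \<in> nonneg_cone m \<Omega>"
  shows "S (\<lambda>x. v x + w x) = S v + S w"
proof (rule antisym)
  have vw0: "v \<in> sobolev0 m \<Omega>" "w \<in> sobolev0 m \<Omega>" "AE x in m. 0 \<le> v x" "AE x in m. 0 \<le> w x"
    using v w by (auto simp: nonneg_cone_def)
  have vw: "(\<lambda>x. v x + w x) \<in> nonneg_cone m \<Omega>"
    using vw0 sobolev0_add[OF m] by (auto simp: nonneg_cone_def)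
  show "S (\<lambda>x. v x + w x) \<le> S v + S w"
  proof (rule S_least[OF vw])
    fix z assume z: "z \<in> seg (\<lambda>x. v x + w x)"
    define z1 z2 where "z1 x = min (z x) (v x)" and "z2 x = z x - z1 x" for x
    have z1: "z1 \<in> sobolev0 m \<Omega>" unfolding z1_def by (rule sobolev0_max_min[OF m seg_D(1)[OF z] vw0(1)])
    have z2: "z2 \<in> sobolev0 m \<Omega>" unfolding z2_def by (rule sobolev0_diff[OF m seg_D(1)[OF z] z1])
    have "AE x in m. 0 \<le> z1 x \<and> z1 x \<le> v x" "AE x in m. 0 \<le> z2 x \<and> z2 x \<le> w x"
      using seg_D(2,3)[OF z] vw0(3,4) by (eventually_elim, auto simp: z1_def z2_def)+
    then have "z1 \<in> seg v" "z2 \<in> seg w" using z1 z2 by (auto simp: order_segment_def)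
    moreover have "L z = L z1 + L z2"
      using dual_add[OF L_dual z1 z2] by (simp add: z2_def)
    ultimately show "L z \<le> S v + S w" using L_le_S[OF v] L_le_S[OF w] by (simp add: add_mono)
  qed
  have "L z1 + L z2 \<le> S (\<lambda>x. v x + w x)" if z: "z1 \<in> seg v" "z2 \<in> seg w" for z1 z2
  proof -
    have "AE x in m. 0 \<le> z1 x + z2 x \<and> z1 x + z2 x \<le> v x + w x"
      using seg_D(2,3)[OF z(1)] seg_D(2,3)[OF z(2)] by eventually_elim auto
    then have "(\<lambda>x. z1 x + z2 x) \<in> seg (\<lambda>x. v x + w x)"
      using sobolev0_add[OF m seg_D(1)[OF z(1)] seg_D(1)[OF z(2)]] by (simp add: order_segment_def)
    from L_le_S[OF vw this] show ?thesis
      using dual_add[OF L_dual seg_D(1)[OF z(1)] seg_D(1)[OF z(2)]] by simp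
  qed
  then have "L z1 \<le> S (\<lambda>x. v x + w x) - L z2" if "z1 \<in> seg v" "z2 \<in> seg w" for z1 z2
    using that by (simp add: le_diff_eq)
  then have "S v \<le> S (\<lambda>x. v x + w x) - L z2" if "z2 \<in> seg w" for z2
    using that by (intro S_least[OF v]) auto
  then have "L z2 \<le> S (\<lambda>x. v x + w x) - S v" if "z2 \<in> seg w" for z2
    using that by (simp add: le_diff_eq add.commute)
  then have "S w \<le> S (\<lambda>x. v x + w x) - S v"
    by (intro S_least[OF w]) auto
  then show "S v + S w \<le> S (\<lambda>x. v x + w x)" by simp
qed

lemma S_null:
  assumes v: "v \<in> sobolev0 m \<Omega>" "AE x in m. v x = 0"
  shows "S v = 0"
proof -
  have c: "v \<in> nonneg_cone m \<Omega>" using v by (auto simp: nonneg_cone_def)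
  then show ?thesis using S_le_P[OF c] S_nonneg[OF c] dual_null[OF m P_dual v] by simp
qed

lemma cone_cmult: "v \<in> nonneg_cone m \<Omega> \<Longrightarrow> 0 \<le> c \<Longrightarrow> (\<lambda>x. c * v x) \<in> nonneg_cone m \<Omega>"
  using sobolev0_cmult[OF m, of v \<Omega> c] by (auto simp: nonneg_cone_def)

lemma S_cmult_le:
  assumes v: "v \<in> nonneg_cone m \<Omega>" and c: "0 < c"
  shows "S (\<lambda>x. c * v x) \<le> c * S v"
proof (rule S_least)
  show "(\<lambda>x. c * v x) \<in> nonneg_cone m \<Omega>" using v c by (intro cone_cmult) auto
  fix z assume z: "z \<in> seg (\<lambda>x. c * v x)"
  define y where "y x = (1 / c) * z x" for x
  have y: "y \<in> sobolev0 m \<Omega>" unfolding y_def by (rule sobolev0_cmult[OF m seg_D(1)[OF z]])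
  have "AE x in m. 0 \<le> y x \<and> y x \<le> v x"
    using seg_D(2,3)[OF z] by eventually_elim (use c in \<open>auto simp: y_def field_simps\<close>)
  then have "y \<in> seg v" using y by (simp add: order_segment_def)
  moreover have "L z = c * L y"
    using dual_cmult[OF L_dual y, of c] c by (simp add: y_def)
  ultimately show "L z \<le> c * S v" using L_le_S[OF v] c by simp
qed

text \<open>For positive c, the one-sided bound is used with c and then with 1/c.\<close>

lemma S_cmult:
  assumes v: "v \<in> nonneg_cone m \<Omega>" and c: "0 \<le> c"
  shows "S (\<lambda>x. c * v x) = c * S v"
proof (cases "c = 0")
  case True
  moreover have "(\<lambda>_. 0) \<in> sobolev0 m \<Omega>" using v by (intro zero_in[of v]) (simp add: nonneg_cone_def)
  ultimately show ?thesis using S_null[of "\<lambda>_. 0"] by simp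
next
  case False
  with c have c: "0 < c" by simp
  have "S v \<le> (1 / c) * S (\<lambda>x. c * v x)"
    using S_cmult_le[OF cone_cmult[OF v, of c], of "1 / c"] c by simp
  then have "c * S v \<le> S (\<lambda>x. c * v x)" using c by (simp add: field_simps)
  with S_cmult_le[OF v c] show ?thesis by simp
qed

lemma pos_neg_cone:
  assumes "v \<in> sobolev0 m \<Omega>"
  shows "(\<lambda>x. max (v x) 0) \<in> nonneg_cone m \<Omega>" "(\<lambda>x. max (- v x) 0) \<in> nonneg_cone m \<Omega>"
  using sobolev0_pos_neg_part[OF m assms] by (auto simp: nonneg_cone_def)

lemma dual_sup_eq:
  "dual_sup m \<Omega> L (\<lambda>_. 0) v =
    (if v \<in> sobolev0 m \<Omega> then S (\<lambda>x. max (v x) 0) - S (\<lambda>x. max (- v x) 0) else 0)"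
  by (simp add: dual_sup_def cone_extension_def S_def)

lemma dual_sup_ge:
  assumes v: "v \<in> nonneg_cone m \<Omega>" and z: "z \<in> seg v"
  shows "L z \<le> dual_sup m \<Omega> L (\<lambda>_. 0) v"
proof -
  have v0: "v \<in> sobolev0 m \<Omega>" "AE x in m. 0 \<le> v x" using v by (auto simp: nonneg_cone_def)
  \<comment> \<open>A member of the cone is nonnegative only almost everywhere, so its negative part
    is a null function rather than 0; \<open>S_null\<close> discards it.\<close>
  have "AE x in m. max (- v x) 0 = 0" using v0(2) by eventually_elim simp
  then have "S (\<lambda>x. max (- v x) 0) = 0" by (rule S_null[OF sobolev0_pos_neg_part(2)[OF m v0(1)]])
  moreover have "z \<in> seg (\<lambda>x. max (v x) 0)" using z by (auto simp: order_segment_def)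
  then have "L z \<le> S (\<lambda>x. max (v x) 0)" by (rule L_le_S[OF pos_neg_cone(1)[OF v0(1)]])
  ultimately show ?thesis using v0 by (simp add: dual_sup_eq)
qed

lemma dual_sup_in_dual: "dual_sup m \<Omega> L (\<lambda>_. 0) \<in> sobolev0_dual m \<Omega>"
proof -
  let ?p = "\<lambda>v x. max (v x) (0::real)" and ?n = "\<lambda>v x. max (- v x) (0::real)"
  have add: "dual_sup m \<Omega> L (\<lambda>_. 0) (\<lambda>x. f x + g x)
      = dual_sup m \<Omega> L (\<lambda>_. 0) f + dual_sup m \<Omega> L (\<lambda>_. 0) g"
    if f: "f \<in> sobolev0 m \<Omega>" and g: "g \<in> sobolev0 m \<Omega>" for f g
  proof -
    define h where "h x = f x + g x" for x
    have h: "h \<in> sobolev0 m \<Omega>" unfolding h_def by (rule sobolev0_add[OF m f g])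
    note cone = pos_neg_cone[OF f] pos_neg_cone[OF g] pos_neg_cone[OF h]
    have sum: "(\<lambda>x. v x + w x) \<in> nonneg_cone m \<Omega>"
      if "v \<in> nonneg_cone m \<Omega>" "w \<in> nonneg_cone m \<Omega>" for v w
      using that sobolev0_add[OF m, of v \<Omega> w] by (auto simp: nonneg_cone_def)
    \<comment> \<open>Moving all negative parts to the other side leaves an identity between members
      of the cone, where S is additive; rearranging the real values gives additivity of the
      extension.\<close>
    have "(\<lambda>x. ?p h x + (?n f x + ?n g x)) = (\<lambda>x. ?n h x + (?p f x + ?p g x))"
      by (auto simp: h_def max_def)
    then have "S (\<lambda>x. ?p h x + (?n f x + ?n g x)) = S (\<lambda>x. ?n h x + (?p f x + ?p g x))" by simp
    then have "S (?p h) + (S (?n f) + S (?n g)) = S (?n h) + (S (?p f) + S (?p g))"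
      using cone by (simp add: S_add sum)
    then show ?thesis using f g sobolev0_add[OF m f g] by (simp add: dual_sup_eq h_def)
  qed
  have cmult: "dual_sup m \<Omega> L (\<lambda>_. 0) (\<lambda>x. c * f x) = c * dual_sup m \<Omega> L (\<lambda>_. 0) f"
    if f: "f \<in> sobolev0 m \<Omega>" for c f
  proof (cases "0 \<le> c")
    case True
    then have "(\<lambda>x. max (c * f x) 0) = (\<lambda>x. c * ?p f x)" "(\<lambda>x. max (- (c * f x)) 0) = (\<lambda>x. c * ?n f x)"
      by (auto simp: max_mult_distrib_left fun_eq_iff)
    then show ?thesis
      using S_cmult[OF _ True] pos_neg_cone[OF f] sobolev0_cmult[OF m f, of c] f
      by (simp add: dual_sup_eq right_diff_distrib)
  next
    case False
    then have c: "0 \<le> - c" by simp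
    have "(\<lambda>x. max (c * f x) 0) = (\<lambda>x. (- c) * ?n f x)" "(\<lambda>x. max (- (c * f x)) 0) = (\<lambda>x. (- c) * ?p f x)"
      using c by (auto simp: max_mult_distrib_left fun_eq_iff)
    then have "dual_sup m \<Omega> L (\<lambda>_. 0) (\<lambda>x. c * f x) = (- c) * S (?n f) - (- c) * S (?p f)"
      using S_cmult[OF pos_neg_cone(1)[OF f] c] S_cmult[OF pos_neg_cone(2)[OF f] c] sobolev0_cmult[OF m f, of c]
      by (simp add: dual_sup_eq)
    then show ?thesis using f by (simp add: dual_sup_eq algebra_simps)
  qed
  obtain C where C: "0 \<le> C" "\<And>f. f \<in> sobolev0 m \<Omega> \<Longrightarrow> \<bar>P f\<bar> \<le> C * sobolev_norm m f"
    using dual_bound[OF P_dual] by blast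
  \<comment> \<open>Each of the two parts contributes C, because S is at most P on the cone and
    taking parts does not increase the norm.\<close>
  have "\<bar>dual_sup m \<Omega> L (\<lambda>_. 0) f\<bar> \<le> (2 * C) * sobolev_norm m f" if f: "f \<in> sobolev0 m \<Omega>" for f
  proof -
    have fs: "f \<in> sobolev m" "f \<in> borel_measurable m"
      using f by (auto simp: sobolev0_def intro: sobolev_measurable)
    have "sobolev_norm m (?p f) \<le> sobolev_norm m f" "sobolev_norm m (?n f) \<le> sobolev_norm m f"
      using fs by (auto intro!: sobolev_norm_mono[OF m fs(1)] simp: max_def)
    then have "C * sobolev_norm m (?p f) \<le> C * sobolev_norm m f" "C * sobolev_norm m (?n f) \<le> C * sobolev_norm m f"
      using C(1) by (auto intro: mult_left_mono)
    moreover have "S (?p f) \<le> C * sobolev_norm m (?p f)" "S (?n f) \<le> C * sobolev_norm m (?n f)"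
      using S_le_P[OF pos_neg_cone(1)[OF f]] S_le_P[OF pos_neg_cone(2)[OF f]]
        C(2)[OF sobolev0_pos_neg_part(1)[OF m f]] C(2)[OF sobolev0_pos_neg_part(2)[OF m f]] by linarith+
    ultimately show ?thesis
      using S_nonneg[OF pos_neg_cone(1)[OF f]] S_nonneg[OF pos_neg_cone(2)[OF f]] f
      by (simp add: dual_sup_eq abs_le_iff)
  qed
  then have "\<exists>C. \<forall>f\<in>sobolev0 m \<Omega>. \<bar>dual_sup m \<Omega> L (\<lambda>_. 0) f\<bar> \<le> C * sobolev_norm m f" by blast
  then show ?thesis
    unfolding sobolev0_dual_def using add cmult by (auto simp: dual_sup_eq)
qed

end

lemma order_dual_sup:
  assumes m: "sets m = sets borel" and L: "L \<in> order_dual m \<Omega>"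
  shows "dual_sup m \<Omega> L (\<lambda>_. 0) \<in> sobolev0_dual m \<Omega>"
    and "v \<in> nonneg_cone m \<Omega> \<Longrightarrow> z \<in> order_segment m \<Omega> (\<lambda>_. 0) v \<Longrightarrow> L z \<le> dual_sup m \<Omega> L (\<lambda>_. 0) v"
    and "L \<in> sobolev0_dual m \<Omega>"
proof -
  obtain P Q where "P \<in> dual_pos_cone m \<Omega>" "Q \<in> dual_pos_cone m \<Omega>" "L = (\<lambda>v. P v - Q v)"
    using L by (auto simp: order_dual_def)
  then interpret order_dual_element m \<Omega> L P Q by unfold_locales (use m in auto)
  show "dual_sup m \<Omega> L (\<lambda>_. 0) \<in> sobolev0_dual m \<Omega>" by (rule dual_sup_in_dual)
  show "v \<in> nonneg_cone m \<Omega> \<Longrightarrow> z \<in> order_segment m \<Omega> (\<lambda>_. 0) v \<Longrightarrow> L z \<le> dual_sup m \<Omega> L (\<lambda>_. 0) v"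
    by (rule dual_sup_ge)
  show "L \<in> sobolev0_dual m \<Omega>" by (rule L_dual)
qed

text \<open>Testing the supremum with z = 0 gives nonnegativity.\<close>

lemma dual_sup_pos:
  assumes m: "sets m = sets borel" and L: "L \<in> order_dual m \<Omega>"
  shows "dual_sup m \<Omega> L (\<lambda>_. 0) \<in> dual_pos_cone m \<Omega>"
proof -
  have "0 \<le> dual_sup m \<Omega> L (\<lambda>_. 0) v" if v: "v \<in> sobolev0 m \<Omega>" "AE x in m. 0 \<le> v x" for v
  proof -
    have 0: "(\<lambda>_. 0) \<in> sobolev0 m \<Omega>" using sobolev0_cmult[OF m v(1), of 0] by simp
    have "L (\<lambda>_. 0) \<le> dual_sup m \<Omega> L (\<lambda>_. 0) v"
      using v 0 by (intro order_dual_sup(2)[OF m L]) (auto simp: nonneg_cone_def order_segment_def)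
    then show ?thesis using dual_null[OF m order_dual_sup(3)[OF m L] 0] by simp
  qed
  then show ?thesis using order_dual_sup(1)[OF m L] by (simp add: dual_pos_cone_def)
qed

lemma order_dual_uminus:
  assumes "L \<in> order_dual m \<Omega>"
  shows "(\<lambda>v. - L v) \<in> order_dual m \<Omega>"
proof -
  obtain P Q where "P \<in> dual_pos_cone m \<Omega>" "Q \<in> dual_pos_cone m \<Omega>" "L = (\<lambda>v. P v - Q v)"
    using assms by (auto simp: order_dual_def)
  moreover from this have "(\<lambda>v. - L v) = (\<lambda>v. Q v - P v)" by simp
  ultimately show ?thesis
    unfolding order_dual_def by (intro CollectI exI[of _ Q] exI[of _ P] conjI)
qed

text \<open>On the reals \<open>Inf\<close> is by definition the negated \<open>Sup\<close> of the
  negated set. The lower bound of the theorem can therefore reuse all facts about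
  \<open>dual_sup\<close>.\<close>

lemma dual_inf_eq_uminus_dual_sup:
  "dual_inf m \<Omega> L (\<lambda>_. 0) = (\<lambda>v. - dual_sup m \<Omega> (\<lambda>v. - L v) (\<lambda>_. 0) v)"
proof -
  have "(INF z\<in>A. L z) = - (SUP z\<in>A. - L z)" for A
    by (simp add: Inf_real_def image_image)
  then show ?thesis by (simp add: dual_inf_def dual_sup_def cone_extension_def fun_eq_iff)
qed

section \<open>The differential of the energy\<close>

text \<open>Infinitesimal strict convexity supplies a linear derivative at f. Convexity makes it a
  subgradient; conversely, any subgradient lies below it in every direction, and two linear
  functionals so ordered coincide. The subdifferential is thus the singleton that the Laplacian is
  read off from.\<close>

lemma energy_differential:
  assumes m: "sets m = sets borel" and isc: "infinitesimally_strictly_convex m"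
    and \<Omega>: "open \<Omega>" and f: "f \<in> sobolev0 m \<Omega>"
  obtains L where "L \<in> sobolev0_dual m \<Omega>"
    and "\<And>v. v \<in> sobolev0 m \<Omega> \<Longrightarrow>
      ((\<lambda>\<epsilon>. (energy m (\<lambda>x. f x + \<epsilon> * v x) - energy m f) / \<epsilon>) \<longlongrightarrow> L v) (at 0)"
    and "\<And>v. v \<in> sobolev0 m \<Omega> \<Longrightarrow> energy m f + L v \<le> energy m (\<lambda>x. f x + v x)"
    and "subdifferential m \<Omega> (local_energy m \<Omega> f) (\<lambda>_. 0) = {L}"
proof -
  have fs: "f \<in> sobolev m" using f by (rule sobolev0_subset)
  obtain L0 where L0: "L0 \<in> sobolev0_dual m UNIV"
    "\<And>v. v \<in> sobolev m \<Longrightarrow> ((\<lambda>\<epsilon>. (energy m (\<lambda>x. f x + \<epsilon> * v x) - energy m f) / \<epsilon>) \<longlongrightarrow> L0 v) (at 0)"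
    using isc fs unfolding infinitesimally_strictly_convex_def by blast
  \<comment> \<open>Members of \<open>sobolev0_dual\<close> vanish outside W0 by convention; without
    this reset the singleton could not be an equality of functions.\<close>
  define L where "L v = (if v \<in> sobolev0 m \<Omega> then L0 v else 0)" for v
  have lim: "((\<lambda>\<epsilon>. (energy m (\<lambda>x. f x + \<epsilon> * v x) - energy m f) / \<epsilon>) \<longlongrightarrow> L v) (at 0)"
    if "v \<in> sobolev0 m \<Omega>" for v
    using L0(2)[OF sobolev0_subset[OF that]] that by (simp add: L_def)
  have "\<exists>C. \<forall>v\<in>sobolev0 m \<Omega>. \<bar>L0 v\<bar> \<le> C * sobolev_norm m v"
    using dual_bound[OF L0(1)] sobolev0_subset unfolding sobolev0_UNIV by metis
  moreover have "L0 (\<lambda>x. v x + w x) = L0 v + L0 w" "L0 (\<lambda>x. c * v x) = c * L0 v"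
    if "v \<in> sobolev0 m \<Omega>" "w \<in> sobolev0 m \<Omega>" for v w c
    using dual_add[OF L0(1)] dual_cmult[OF L0(1)] that[THEN sobolev0_subset] by (simp_all add: sobolev0_UNIV)
  ultimately have L: "L \<in> sobolev0_dual m \<Omega>"
    unfolding sobolev0_dual_def using sobolev0_add[OF m] sobolev0_cmult[OF m]
    by (simp add: L_def cong: ball_cong)
  have sub: "energy m f + L v \<le> energy m (\<lambda>x. f x + v x)" if v: "v \<in> sobolev0 m \<Omega>" for v
  proof -
    have fv: "(\<lambda>x. f x + v x) \<in> sobolev m" using sobolev0_add[OF m f v] by (rule sobolev0_subset)
    have "\<forall>\<^sub>F \<epsilon> in at_right 0. (energy m (\<lambda>x. f x + \<epsilon> * v x) - energy m f) / \<epsilon>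
        \<le> energy m (\<lambda>x. f x + v x) - energy m f"
      using eventually_at_right_less[of 0] eventually_at_right_real[of 0 1, OF zero_less_one]
    proof eventually_elim
      case (elim \<epsilon>)
      \<comment> \<open>A convex combination of f and f + v, so the difference quotient at
        \<epsilon> in (0,1) is at most the one at 1.\<close>
      have "(\<lambda>x. f x + \<epsilon> * v x) = (\<lambda>x. (1 - \<epsilon>) * f x + \<epsilon> * (f x + v x))" by (auto simp: algebra_simps)
      then have "energy m (\<lambda>x. f x + \<epsilon> * v x) \<le> (1 - \<epsilon>) * energy m f + \<epsilon> * energy m (\<lambda>x. f x + v x)"
        using energy_convex[OF m fs fv, of \<epsilon>] elim by simp
      then have "energy m (\<lambda>x. f x + \<epsilon> * v x) - energy m f
          \<le> (energy m (\<lambda>x. f x + v x) - energy m f) * \<epsilon>"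
        by (simp add: algebra_simps)
      then show ?case by (subst pos_divide_le_eq) (use elim in auto)
    qed
    from tendsto_upperbound[OF tendsto_mono[OF at_le lim[OF v]] this] show ?thesis by simp
  qed
  have le_eq: "local_energy m \<Omega> f (\<lambda>x. v x) = energy m (\<lambda>x. f x + v x)" if "v \<in> sobolev0 m \<Omega>" for v
    using local_energy_eq[OF m \<Omega> f that] by simp
  have zero: "(\<lambda>_. 0) \<in> sobolev0 m \<Omega>" using sobolev0_cmult[OF m f, of 0] by simp
  have "subdifferential m \<Omega> (local_energy m \<Omega> f) (\<lambda>_. 0) = {M \<in> sobolev0_dual m \<Omega>.
      \<forall>v\<in>sobolev0 m \<Omega>. energy m f + M v \<le> energy m (\<lambda>x. f x + v x)}"
    unfolding subdifferential_def using le_eq le_eq[OF zero] by (simp cong: ball_cong)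
  also have "\<dots> = {L}"
  proof (intro equalityI subsetI; clarsimp simp: L sub)
    fix M assume M: "M \<in> sobolev0_dual m \<Omega>"
      and Msub: "\<forall>v\<in>sobolev0 m \<Omega>. energy m f + M v \<le> energy m (\<lambda>x. f x + v x)"
    have le: "M v \<le> L v" if v: "v \<in> sobolev0 m \<Omega>" for v
    proof -
      have "\<forall>\<^sub>F \<epsilon> in at_right 0. M v \<le> (energy m (\<lambda>x. f x + \<epsilon> * v x) - energy m f) / \<epsilon>"
        using eventually_at_right_less[of 0]
      proof eventually_elim
        case (elim \<epsilon>)
        have "energy m f + \<epsilon> * M v \<le> energy m (\<lambda>x. f x + \<epsilon> * v x)"
          using Msub[rule_format, OF sobolev0_cmult[OF m v, of \<epsilon>]] dual_cmult[OF M v, of \<epsilon>] by simp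
        then have "M v * \<epsilon> \<le> energy m (\<lambda>x. f x + \<epsilon> * v x) - energy m f"
          by (simp add: algebra_simps)
        then show ?case by (subst pos_le_divide_eq) (use elim in auto)
      qed
      from tendsto_lowerbound[OF tendsto_mono[OF at_le lim[OF v]] this] show ?thesis by simp
    qed
    show "M = L"
    proof
      fix v
      show "M v = L v"
      proof (cases "v \<in> sobolev0 m \<Omega>")
        case True
        \<comment> \<open>The inequality in direction -v is the reverse inequality in direction
          v.\<close>
        have "M (\<lambda>x. - 1 * v x) \<le> L (\<lambda>x. - 1 * v x)" by (rule le[OF sobolev0_cmult[OF m True]])
        then show ?thesis
          unfolding dual_cmult[OF M True] dual_cmult[OF L True] using le[OF True] by simp
      next
        case False
        then show ?thesis using M by (simp add: sobolev0_dual_def L_def)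
      qed
    qed
  qed
  finally show thesis using that L lim sub by blast
qed

text \<open>
  The two competitors \<open>min (u + \<epsilon> v) \<psi>\<close> and \<open>max (u + \<epsilon> v) \<psi>\<close> exchange energy by
  locality: the first one is admissible in the obstacle problem, and the increment of the
  second one over \<open>\<psi>\<close> is \<open>\<epsilon> z\<close> for some \<open>0 \<le> z \<le> v\<close>.
\<close>

lemma energy_increment_above:
  assumes m: "sets m = sets borel" and \<phi>: "\<phi> \<in> sobolev0 m \<Omega>" and \<psi>: "\<psi> \<in> sobolev0 m \<Omega>"
    and le: "AE x in m. \<phi> x \<le> \<psi> x"
    and min: "is_arg_min (energy m) (\<lambda>w. w \<in> order_segment m \<Omega> \<phi> \<psi>) u"
    and sub: "\<And>w. w \<in> sobolev0 m \<Omega> \<Longrightarrow> energy m \<psi> + L w \<le> energy m (\<lambda>x. \<psi> x + w x)"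
    and L: "L \<in> sobolev0_dual m \<Omega>"
    and v: "v \<in> nonneg_cone m \<Omega>" and \<epsilon>: "0 < \<epsilon>"
  obtains z where "z \<in> order_segment m \<Omega> (\<lambda>_. 0) v"
    and "L z \<le> (energy m (\<lambda>x. u x + \<epsilon> * v x) - energy m u) / \<epsilon>"
proof -
  have u: "u \<in> sobolev0 m \<Omega>" "AE x in m. \<phi> x \<le> u x" "AE x in m. u x \<le> \<psi> x"
    using min by (auto simp: is_arg_min_def order_segment_def)
  have v0: "v \<in> sobolev0 m \<Omega>" "AE x in m. 0 \<le> v x" using v by (auto simp: nonneg_cone_def)
  define w where "w x = u x + \<epsilon> * v x" for x
  have w: "w \<in> sobolev0 m \<Omega>"
    using sobolev0_linear_combination[OF m u(1) v0(1), of 1 \<epsilon>] by (simp add: w_def[abs_def])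
  define p q where "p x = max (w x) (\<psi> x)" and "q x = min (w x) (\<psi> x)" for x
  have pq: "p \<in> sobolev0 m \<Omega>" "q \<in> sobolev0 m \<Omega>"
    unfolding p_def q_def by (rule sobolev0_max_min[OF m w \<psi>])+
  \<comment> \<open>Explicitly z is the positive part of v - (\<psi> - u) / \<epsilon>; it lies
    between 0 and v because u \<le> \<psi>.\<close>
  define z where "z x = (1 / \<epsilon>) * (p x - \<psi> x)" for x
  have z: "z \<in> sobolev0 m \<Omega>"
    unfolding z_def by (intro sobolev0_cmult[OF m] sobolev0_diff[OF m] pq \<psi>)
  have "AE x in m. 0 \<le> z x \<and> z x \<le> v x"
    using u(3) v0(2)
  proof eventually_elim
    case (elim x)
    have "0 \<le> \<epsilon> * v x" using \<epsilon> elim by simp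
    then have "0 \<le> p x - \<psi> x" "p x - \<psi> x \<le> v x * \<epsilon>"
      using elim by (auto simp: p_def w_def mult.commute)
    then show ?case using \<epsilon> by (simp add: z_def pos_divide_le_eq)
  qed
  then have zs: "z \<in> order_segment m \<Omega> (\<lambda>_. 0) v" using z by (simp add: order_segment_def)
  have "AE x in m. \<phi> x \<le> q x \<and> q x \<le> \<psi> x"
    using u(2) v0(2) le
  proof eventually_elim
    case (elim x)
    have "0 \<le> \<epsilon> * v x" using \<epsilon> elim by simp
    then show ?case using elim by (auto simp: q_def w_def)
  qed
  then have "energy m u \<le> energy m q"
    using min pq(2) by (auto simp: is_arg_min_def order_segment_def not_less)
  moreover have "energy m p + energy m q = energy m w + energy m \<psi>"
    unfolding p_def[abs_def] q_def[abs_def] by (rule energy_max_min[OF m w[THEN sobolev0_subset] \<psi>[THEN sobolev0_subset]])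
  moreover have "(\<lambda>x. \<psi> x + \<epsilon> * z x) = p" using \<epsilon> by (auto simp: z_def)
  then have "energy m \<psi> + \<epsilon> * L z \<le> energy m p"
    using sub[OF sobolev0_cmult[OF m z, of \<epsilon>]] dual_cmult[OF L z, of \<epsilon>] by simp
  ultimately have "\<epsilon> * L z \<le> energy m w - energy m u" by linarith
  then have "L z \<le> (energy m w - energy m u) / \<epsilon>" using \<epsilon> by (simp add: le_divide_eq mult.commute)
  then show thesis using that[OF zs] by (simp add: w_def[abs_def])
qed

text \<open>The mirror image at the lower obstacle. With \<epsilon> negative, u + \<epsilon> v lies
  below u, so the maximum with \<phi> is the admissible competitor and the minimum is \<phi> +
  \<epsilon> z; dividing by \<epsilon> reverses the inequality.\<close>

lemma energy_increment_below:
  assumes m: "sets m = sets borel" and \<phi>: "\<phi> \<in> sobolev0 m \<Omega>" and \<psi>: "\<psi> \<in> sobolev0 m \<Omega>"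
    and le: "AE x in m. \<phi> x \<le> \<psi> x"
    and min: "is_arg_min (energy m) (\<lambda>w. w \<in> order_segment m \<Omega> \<phi> \<psi>) u"
    and sub: "\<And>w. w \<in> sobolev0 m \<Omega> \<Longrightarrow> energy m \<phi> + L w \<le> energy m (\<lambda>x. \<phi> x + w x)"
    and L: "L \<in> sobolev0_dual m \<Omega>"
    and v: "v \<in> nonneg_cone m \<Omega>" and \<epsilon>: "\<epsilon> < 0"
  obtains z where "z \<in> order_segment m \<Omega> (\<lambda>_. 0) v"
    and "(energy m (\<lambda>x. u x + \<epsilon> * v x) - energy m u) / \<epsilon> \<le> L z"
proof -
  have u: "u \<in> sobolev0 m \<Omega>" "AE x in m. \<phi> x \<le> u x" "AE x in m. u x \<le> \<psi> x"
    using min by (auto simp: is_arg_min_def order_segment_def)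
  have v0: "v \<in> sobolev0 m \<Omega>" "AE x in m. 0 \<le> v x" using v by (auto simp: nonneg_cone_def)
  define w where "w x = u x + \<epsilon> * v x" for x
  have w: "w \<in> sobolev0 m \<Omega>"
    using sobolev0_linear_combination[OF m u(1) v0(1), of 1 \<epsilon>] by (simp add: w_def[abs_def])
  define p q where "p x = max (w x) (\<phi> x)" and "q x = min (w x) (\<phi> x)" for x
  have pq: "p \<in> sobolev0 m \<Omega>" "q \<in> sobolev0 m \<Omega>"
    unfolding p_def q_def by (rule sobolev0_max_min[OF m w \<phi>])+
  \<comment> \<open>Since \<epsilon> is negative, this is the positive part of v - (u - \<phi>) /
    |\<epsilon>|, which lies between 0 and v because \<phi> \<le> u.\<close>
  define z where "z x = (1 / \<epsilon>) * (q x - \<phi> x)" for x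
  have z: "z \<in> sobolev0 m \<Omega>"
    unfolding z_def by (intro sobolev0_cmult[OF m] sobolev0_diff[OF m] pq \<phi>)
  have "AE x in m. 0 \<le> z x \<and> z x \<le> v x"
    using u(2) v0(2)
  proof eventually_elim
    case (elim x)
    have "\<epsilon> * v x \<le> 0" using \<epsilon> elim by (simp add: mult_nonpos_nonneg)
    then have "q x - \<phi> x \<le> 0" "v x * \<epsilon> \<le> q x - \<phi> x"
      using elim by (auto simp: q_def w_def mult.commute)
    then show ?case using \<epsilon> by (simp add: z_def neg_divide_le_eq zero_le_divide_iff)
  qed
  then have zs: "z \<in> order_segment m \<Omega> (\<lambda>_. 0) v" using z by (simp add: order_segment_def)
  have "AE x in m. \<phi> x \<le> p x \<and> p x \<le> \<psi> x"
    using u(3) v0(2) le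
  proof eventually_elim
    case (elim x)
    have "\<epsilon> * v x \<le> 0" using \<epsilon> elim by (simp add: mult_nonpos_nonneg)
    then show ?case using elim by (auto simp: p_def w_def)
  qed
  then have "energy m u \<le> energy m p"
    using min pq(1) by (auto simp: is_arg_min_def order_segment_def not_less)
  moreover have "energy m p + energy m q = energy m w + energy m \<phi>"
    unfolding p_def[abs_def] q_def[abs_def] by (rule energy_max_min[OF m w[THEN sobolev0_subset] \<phi>[THEN sobolev0_subset]])
  moreover have "(\<lambda>x. \<phi> x + \<epsilon> * z x) = q" using \<epsilon> by (auto simp: z_def)
  then have "energy m \<phi> + \<epsilon> * L z \<le> energy m q"
    using sub[OF sobolev0_cmult[OF m z, of \<epsilon>]] dual_cmult[OF L z, of \<epsilon>] by simp
  ultimately have "\<epsilon> * L z \<le> energy m w - energy m u" by linarith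
  then have "(energy m w - energy m u) / \<epsilon> \<le> L z" using \<epsilon> by (simp add: divide_le_eq mult.commute)
  then show thesis using that[OF zs] by (simp add: w_def[abs_def])
qed

theorem theorem3p10:
  fixes m :: "'a::polish_space measure" and \<Omega> :: "'a set" and \<phi> \<psi> u :: "'a \<Rightarrow> real"
  assumes "metric_measure_space m"
    and "infinitesimally_strictly_convex m"
    and "open \<Omega>"
    and "\<phi> \<in> sobolev0 m \<Omega> \<inter> laplacian_domain m \<Omega>"
    and "\<psi> \<in> sobolev0 m \<Omega> \<inter> laplacian_domain m \<Omega>"
    and "AE x in m. \<phi> x \<le> \<psi> x"
    and "is_arg_min (energy m) (\<lambda>w. w \<in> order_segment m \<Omega> \<phi> \<psi>) u"
  shows "u \<in> laplacian_domain m \<Omega> \<and>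
    dual_prec m \<Omega> (dual_inf m \<Omega> (laplacian m \<Omega> \<phi>) (\<lambda>_. 0)) (laplacian m \<Omega> u) \<and>
    dual_prec m \<Omega> (laplacian m \<Omega> u) (dual_sup m \<Omega> (laplacian m \<Omega> \<psi>) (\<lambda>_. 0))"
proof -
  have m: "sets m = sets borel"
    using assms(1) by (simp add: metric_measure_space_def radon_measure_def)
  have \<phi>: "\<phi> \<in> sobolev0 m \<Omega>" and \<psi>: "\<psi> \<in> sobolev0 m \<Omega>" using assms by auto
  have u: "u \<in> sobolev0 m \<Omega>" using assms(7) by (simp add: is_arg_min_def order_segment_def)
  obtain A where A: "A \<in> sobolev0_dual m \<Omega>"
    "\<And>v. v \<in> sobolev0 m \<Omega> \<Longrightarrow> ((\<lambda>\<epsilon>. (energy m (\<lambda>x. \<phi> x + \<epsilon> * v x) - energy m \<phi>) / \<epsilon>) \<longlongrightarrow> A v) (at 0)"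
    "\<And>v. v \<in> sobolev0 m \<Omega> \<Longrightarrow> energy m \<phi> + A v \<le> energy m (\<lambda>x. \<phi> x + v x)"
    "subdifferential m \<Omega> (local_energy m \<Omega> \<phi>) (\<lambda>_. 0) = {A}"
    using energy_differential[OF m assms(2,3) \<phi>] by blast
  obtain B where B: "B \<in> sobolev0_dual m \<Omega>"
    "\<And>v. v \<in> sobolev0 m \<Omega> \<Longrightarrow> ((\<lambda>\<epsilon>. (energy m (\<lambda>x. \<psi> x + \<epsilon> * v x) - energy m \<psi>) / \<epsilon>) \<longlongrightarrow> B v) (at 0)"
    "\<And>v. v \<in> sobolev0 m \<Omega> \<Longrightarrow> energy m \<psi> + B v \<le> energy m (\<lambda>x. \<psi> x + v x)"
    "subdifferential m \<Omega> (local_energy m \<Omega> \<psi>) (\<lambda>_. 0) = {B}"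
    using energy_differential[OF m assms(2,3) \<psi>] by blast
  obtain U where U: "U \<in> sobolev0_dual m \<Omega>"
    "\<And>v. v \<in> sobolev0 m \<Omega> \<Longrightarrow> ((\<lambda>\<epsilon>. (energy m (\<lambda>x. u x + \<epsilon> * v x) - energy m u) / \<epsilon>) \<longlongrightarrow> U v) (at 0)"
    "\<And>v. v \<in> sobolev0 m \<Omega> \<Longrightarrow> energy m u + U v \<le> energy m (\<lambda>x. u x + v x)"
    "subdifferential m \<Omega> (local_energy m \<Omega> u) (\<lambda>_. 0) = {U}"
    using energy_differential[OF m assms(2,3) u] by blast
  have AB: "A \<in> order_dual m \<Omega>" "B \<in> order_dual m \<Omega>"
    using assms(4,5) A(4) B(4) by (auto simp: laplacian_domain_def)
  have lap: "laplacian m \<Omega> \<phi> = (\<lambda>v. - A v)" "laplacian m \<Omega> \<psi> = (\<lambda>v. - B v)" "laplacian m \<Omega> u = (\<lambda>v. - U v)"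
    using A(4) B(4) U(4) by (simp_all add: laplacian_def)
  \<comment> \<open>Laplacians are minus the differentials A, B and U. So S is the upper bound of
    the theorem, and the lower bound is -I, because the infimum of -A with 0 is minus the supremum
    of A with 0.\<close>
  define S where "S = dual_sup m \<Omega> (\<lambda>v. - B v) (\<lambda>_. 0)"
  define I where "I = dual_sup m \<Omega> A (\<lambda>_. 0)"
  note nB = order_dual_uminus[OF AB(2)]
  have S: "S \<in> dual_pos_cone m \<Omega>" unfolding S_def by (rule dual_sup_pos[OF m nB])
  have I: "I \<in> dual_pos_cone m \<Omega>" unfolding I_def by (rule dual_sup_pos[OF m AB(1)])
  \<comment> \<open>The function z supplied for each \<epsilon> varies with \<epsilon>, but
    \<open>S v\<close> is a supremum over the whole order segment and bounds -B z for all of them at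
    once; this makes the limit possible.\<close>
  have upper: "- S v \<le> U v" if v: "v \<in> nonneg_cone m \<Omega>" for v
  proof -
    have v0: "v \<in> sobolev0 m \<Omega>" using v by (simp add: nonneg_cone_def)
    have "\<forall>\<^sub>F \<epsilon> in at_right 0. - S v \<le> (energy m (\<lambda>x. u x + \<epsilon> * v x) - energy m u) / \<epsilon>"
      using eventually_at_right_less[of 0]
    proof eventually_elim
      case (elim \<epsilon>)
      obtain z where z: "z \<in> order_segment m \<Omega> (\<lambda>_. 0) v"
        "B z \<le> (energy m (\<lambda>x. u x + \<epsilon> * v x) - energy m u) / \<epsilon>"
        using energy_increment_above[OF m \<phi> \<psi> assms(6,7) B(3,1) v elim] .
      then show ?case using order_dual_sup(2)[OF m nB v z(1)] unfolding S_def by linarith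
    qed
    from tendsto_lowerbound[OF tendsto_mono[OF at_le U(2)[OF v0]] this] show ?thesis by simp
  qed
  \<comment> \<open>Here the difference quotients are taken from the left; two-sided
    differentiability at u gives the same limit U v.\<close>
  have lower: "U v \<le> I v" if v: "v \<in> nonneg_cone m \<Omega>" for v
  proof -
    have v0: "v \<in> sobolev0 m \<Omega>" using v by (simp add: nonneg_cone_def)
    have "\<forall>\<^sub>F \<epsilon>::real in at_left 0. \<epsilon> < 0" by (simp add: eventually_at_filter)
    then have "\<forall>\<^sub>F \<epsilon> in at_left 0. (energy m (\<lambda>x. u x + \<epsilon> * v x) - energy m u) / \<epsilon> \<le> I v"
    proof eventually_elim
      case (elim \<epsilon>)
      obtain z where z: "z \<in> order_segment m \<Omega> (\<lambda>_. 0) v"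
        "(energy m (\<lambda>x. u x + \<epsilon> * v x) - energy m u) / \<epsilon> \<le> A z"
        using energy_increment_below[OF m \<phi> \<psi> assms(6,7) A(3,1) v elim] .
      then show ?case using order_dual_sup(2)[OF m AB(1) v z(1)] unfolding I_def by linarith
    qed
    from tendsto_upperbound[OF tendsto_mono[OF at_le U(2)[OF v0]] this] show ?thesis by simp
  qed
  have SD: "S \<in> sobolev0_dual m \<Omega>" "I \<in> sobolev0_dual m \<Omega>" using S I by (simp_all add: dual_pos_cone_def)
  have SU: "(\<lambda>v. S v + U v) \<in> dual_pos_cone m \<Omega>"
    using dual_linear_combination[OF SD(1) U(1), of 1 1] upper
    by (fastforce simp: dual_pos_cone_def nonneg_cone_def)
  have IU: "(\<lambda>v. I v - U v) \<in> dual_pos_cone m \<Omega>"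
    using dual_linear_combination[OF SD(2) U(1), of 1 "- 1"] lower
    by (fastforce simp: dual_pos_cone_def nonneg_cone_def)
  \<comment> \<open>The upper bound says that S + U is positive, as is S itself, so U is a
    difference of positive functionals and u lies in the domain of the Laplacian.\<close>
  have "(\<lambda>v. (S v + U v) - S v) \<in> order_dual m \<Omega>"
    unfolding order_dual_def
    by (intro CollectI exI[of _ "\<lambda>v. S v + U v"] exI[of _ S] conjI refl SU S)
  then have "U \<in> order_dual m \<Omega>" by simp
  then have "u \<in> laplacian_domain m \<Omega>"
    using U(4) sobolev0_subset[OF u] by (simp add: laplacian_domain_def)
  moreover have "dual_prec m \<Omega> (dual_inf m \<Omega> (laplacian m \<Omega> \<phi>) (\<lambda>_. 0)) (laplacian m \<Omega> u)"
    using IU by (simp add: dual_prec_def lap dual_inf_eq_uminus_dual_sup I_def)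
  moreover have "dual_prec m \<Omega> (laplacian m \<Omega> u) (dual_sup m \<Omega> (laplacian m \<Omega> \<psi>) (\<lambda>_. 0))"
    using SU by (simp add: dual_prec_def lap S_def)
  ultimately show ?thesis by blast
qed

end
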